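(* Let $E\subset[0,1)$ be the Erdős set. The following three statements are equivalent: (i) Szemerédi's theorem: every $A\subset\mathbb{N}$ with positive upper Banach density contains arbitrarily long arithmetic progressions; (ii) $\dim_{\mathrm{H}}E=0$; (iii) the set $E+EE=\{a+bc:a,b,c\in E\}$ does not contain any interval of positive length.
   Context: $\mathbb{N}=\{1,2,3,\dots\}$. Each $x\in[0,1)$ is identified with its binary expansion $x_1x_2\dots\in\{0,1\}^{\mathbb{N}}$, $x=\sum_{i\ge1}2^{-i}x_i$; if $x$ is a dyadic rational, the expansion with only finitely many digits $1$ is always used. The set of positions of digit $1$ of $x$ is $A_x=\{n\in\mathbb{N}:x_n=1\}$. Erdős set: $x\in[0,1)$ is called Erdősian if $A_x$ does not contain arbitrarily long arithmetic progressions (i.e. there is $k\in\mathbb{N}$ such that $A_x$ contains no $k$-term arithmetic progression with nonzero common difference). The Erdős set $E$ is the set of all Erdősian numbers in $[0,1)$. In $E+EE$, $E$ is considered as a subset of $[0,1)\subset\mathbb{R}$ and products and sums are taken in $\mathbb{R}$. $\dim_{\mathrm{H}}$ denotes Hausdorff dimension. Upper Banach density: for $A\subset\mathbb{N}$ put $A(n)=\#(A\cap[1,n])$; the upper Banach density of $A$ is $d_B(A)=\limsup_{k,M\to\infty}\frac1k\bigl(A(M+k-1)-A(M)\bigr)$. *)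

theory Defs
  imports "HOL-Analysis.Analysis"
begin

section \<open>Binary expansions and the Erdos set\<close>

text \<open>The set of positive integers is rendered as \<open>{1..} :: nat set\<close>.\<close>

definition dyadic_rational :: "real \<Rightarrow> bool" where
  "dyadic_rational x \<longleftrightarrow> (\<exists>(m::int) (k::nat). x = of_int m / 2 ^ k)"

text \<open>Digit sequences are extensional functions on \<open>{1..}\<close>, so that the expansion is
  unique as an element of the function type.\<close>

definition binary_expansion :: "real \<Rightarrow> (nat \<Rightarrow> nat) \<Rightarrow> bool" where
  "binary_expansion x b \<longleftrightarrow>
     b \<in> {1..} \<rightarrow>\<^sub>E {0, 1} \<and>
     (\<lambda>i. real (b (Suc i)) / 2 ^ Suc i) sums x \<and>
     (dyadic_rational x \<longrightarrow> finite {n \<in> {1..}. b n = 1})"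

definition binary_digits :: "real \<Rightarrow> nat \<Rightarrow> nat" where
  "binary_digits x = (THE b. binary_expansion x b)"

definition one_positions :: "real \<Rightarrow> nat set" where
  "one_positions x = {n \<in> {1..}. binary_digits x n = 1}"

definition contains_AP :: "nat set \<Rightarrow> nat \<Rightarrow> bool" where
  "contains_AP A k \<longleftrightarrow> (\<exists>a d. d > 0 \<and> (\<forall>i<k. a + i * d \<in> A))"

definition arbitrarily_long_APs :: "nat set \<Rightarrow> bool" where
  "arbitrarily_long_APs A \<longleftrightarrow> (\<forall>k\<ge>1. contains_AP A k)"

definition Erdosian :: "real \<Rightarrow> bool" where
  "Erdosian x \<longleftrightarrow> \<not> arbitrarily_long_APs (one_positions x)"

definition Erdos_set :: "real set" where
  "Erdos_set = {x \<in> {0..<1}. Erdosian x}"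

section \<open>Upper Banach density\<close>

definition counting :: "nat set \<Rightarrow> nat \<Rightarrow> nat" where
  "counting A n = card (A \<inter> {1..n})"

text \<open>The limit superior is the joint one, with \<open>k\<close> and \<open>M\<close> tending to infinity
  independently of each other.\<close>

definition upper_Banach_density :: "nat set \<Rightarrow> ereal" where
  "upper_Banach_density A =
     Limsup (sequentially \<times>\<^sub>F sequentially)
       (\<lambda>(k, M). ereal ((real (counting A (M + k - 1)) - real (counting A M)) / real k))"

definition Szemeredi_statement :: bool where
  "Szemeredi_statement \<longleftrightarrow>
     (\<forall>A \<subseteq> {1..}. upper_Banach_density A > 0 \<longrightarrow> arbitrarily_long_APs A)"

section \<open>Hausdorff dimension\<close>

text \<open>The case distinctions implement the usual conventions \<open>diam(\<emptyset>)^s = 0\<close> for all \<open>s\<close>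
  and \<open>diam(U)^0 = 1\<close> for nonempty \<open>U\<close> (note that \<open>0 powr 0 = 0\<close>). Covering sets are required
  to be bounded because \<^const>\<open>diameter\<close> is real-valued and meaningless on unbounded sets.\<close>

definition diam_powr :: "real \<Rightarrow> 'a::metric_space set \<Rightarrow> ennreal" where
  "diam_powr s U =
     (if U = {} then 0 else if s = 0 then 1 else ennreal (diameter U powr s))"

definition Hausdorff_premeasure :: "real \<Rightarrow> real \<Rightarrow> 'a::metric_space set \<Rightarrow> ennreal" where
  "Hausdorff_premeasure s \<delta> A =
     Inf {(\<Sum>i. diam_powr s (U i)) | U :: nat \<Rightarrow> 'a set.
            A \<subseteq> (\<Union>i. U i) \<and> (\<forall>i. bounded (U i) \<and> diameter (U i) \<le> \<delta>)}"

definition Hausdorff_measure :: "real \<Rightarrow> 'a::metric_space set \<Rightarrow> ennreal" where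
  "Hausdorff_measure s A = (SUP \<delta>\<in>{0<..}. Hausdorff_premeasure s \<delta> A)"

definition Hausdorff_dim :: "'a::metric_space set \<Rightarrow> ennreal" where
  "Hausdorff_dim A = Inf {ennreal s | s. s \<ge> 0 \<and> Hausdorff_measure s A = 0}"

section \<open>Well-definedness of the binary digits\<close>

lemma binary_expansion_floor:
  assumes "binary_expansion x b"
  shows "\<lfloor>2 ^ n * x\<rfloor> = (\<Sum>i<n. int (b (Suc i)) * 2 ^ (n - Suc i))"
proof -
  define f where "f = (\<lambda>i. real (b (Suc i)) / 2 ^ Suc i)"
  have b01: "b (Suc i) = 0 \<or> b (Suc i) = 1" for i
    using assms by (auto simp: binary_expansion_def PiE_iff)
  have fs: "f sums x" and fin: "dyadic_rational x \<Longrightarrow> finite {n \<in> {1..}. b n = 1}"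
    using assms by (auto simp: binary_expansion_def f_def)
  have tail: "(\<lambda>i. f (i + n)) sums (x - sum f {..<n})"
    using fs by (simp add: sums_iff_shift)
  have geo: "(\<lambda>i. (1/2) ^ Suc n * (1/2) ^ i) sums ((1/2::real) ^ n)"
    using sums_mult[OF geometric_sums[of "1/2::real"], of "(1/2) ^ Suc n"] by simp
  have le: "f (i + n) \<le> (1/2) ^ Suc n * (1/2) ^ i" for i
    using b01[of "i + n"] by (auto simp: f_def power_add power_one_over field_simps)
  have head: "2 ^ n * sum f {..<n} = of_int (\<Sum>i<n. int (b (Suc i)) * 2 ^ (n - Suc i))"
  proof -
    have "2 ^ n * f i = real (b (Suc i)) * 2 ^ (n - Suc i)" if "i < n" for i
    proof -
      have "(2::real) ^ n = 2 ^ (n - Suc i) * 2 ^ Suc i"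
        using that by (simp flip: power_add del: power_Suc)
      then show ?thesis by (simp add: f_def)
    qed
    then show ?thesis by (simp add: sum_distrib_left)
  qed
  have nonneg: "0 \<le> x - sum f {..<n}"
    by (rule sums_le[OF _ sums_zero tail]) (simp add: f_def)
  have "\<exists>j. b (Suc (j + n)) = 0"
  proof (rule ccontr)
    assume "\<nexists>j. b (Suc (j + n)) = 0"
    then have all1: "b (Suc (j + n)) = 1" for j using b01 by metis
    then have eq: "(\<lambda>i. f (i + n)) = (\<lambda>i. (1/2) ^ Suc n * (1/2) ^ i)"
      by (simp add: fun_eq_iff f_def power_add power_one_over field_simps)
    have "x - sum f {..<n} = (1/2) ^ n"
      using tail geo unfolding eq by (rule sums_unique2)
    then have "2 ^ n * x = 2 ^ n * sum f {..<n} + 1"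
      by (simp add: power_one_over field_simps)
    then have "x = of_int ((\<Sum>i<n. int (b (Suc i)) * 2 ^ (n - Suc i)) + 1) / 2 ^ n"
      unfolding head by (simp add: field_simps)
    then have "dyadic_rational x" unfolding dyadic_rational_def by blast
    then have "finite {m \<in> {1..}. b m = 1}" by (rule fin)
    moreover have "range (\<lambda>j. Suc (j + n)) \<subseteq> {m \<in> {1..}. b m = 1}" using all1 by auto
    ultimately have "finite (range (\<lambda>j. Suc (j + n)))" using finite_subset by blast
    then show False by (simp add: finite_image_iff inj_on_def)
  qed
  then obtain j where j: "b (Suc (j + n)) = 0" by blast
  have "x - sum f {..<n} < (1/2) ^ n"
  proof -
    define g where "g = (\<lambda>i. (1/2) ^ Suc n * (1/2) ^ i - f (i + n))"
    have g: "g sums ((1/2) ^ n - (x - sum f {..<n}))"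
      unfolding g_def by (rule sums_diff[OF geo tail])
    have "0 \<le> g i" for i using le[of i] by (simp add: g_def)
    moreover have "0 < g j" using j by (simp add: g_def f_def)
    ultimately have "0 < suminf g" using suminf_pos2[OF sums_summable[OF g]] by blast
    then show ?thesis using sums_unique[OF g] by simp
  qed
  then have "2 ^ n * x < 2 ^ n * sum f {..<n} + 1"
    by (simp add: power_one_over field_simps)
  moreover have "2 ^ n * sum f {..<n} \<le> 2 ^ n * x" using nonneg by simp
  ultimately show ?thesis unfolding head by (simp add: floor_eq_iff)
qed

lemma binary_expansion_exists:
  assumes "x \<in> {0..<1}"
  shows "binary_expansion x (\<lambda>n\<in>{1..}. nat (\<lfloor>2 ^ n * x\<rfloor> mod 2))"
proof -
  define b where "b = (\<lambda>n\<in>{1..}. nat (\<lfloor>2 ^ n * x\<rfloor> mod 2))"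
  have step: "real (b (Suc n)) = of_int \<lfloor>2 ^ Suc n * x\<rfloor> - 2 * of_int \<lfloor>2 ^ n * x\<rfloor>" for n
  proof -
    have "\<lfloor>2 ^ Suc n * x\<rfloor> div 2 = \<lfloor>2 ^ n * x\<rfloor>"
      using floor_divide_real_eq_div[of 2 "2 ^ Suc n * x"] by simp
    then have "int (b (Suc n)) = \<lfloor>2 ^ Suc n * x\<rfloor> - 2 * \<lfloor>2 ^ n * x\<rfloor>"
      by (simp add: b_def minus_mult_div_eq_mod[symmetric] del: power_Suc)
    then have "real_of_int (int (b (Suc n))) = real_of_int (\<lfloor>2 ^ Suc n * x\<rfloor> - 2 * \<lfloor>2 ^ n * x\<rfloor>)"
      by (rule arg_cong)
    then show ?thesis by simp
  qed
  have part: "(\<Sum>i<n. real (b (Suc i)) / 2 ^ Suc i) = of_int \<lfloor>2 ^ n * x\<rfloor> / 2 ^ n" for n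
  proof (induction n)
    case 0
    then show ?case using assms by (simp add: floor_eq_iff)
  next
    case (Suc n)
    then show ?case unfolding sum.lessThan_Suc Suc step
      by (simp add: field_simps)
  qed
  have "(\<lambda>n. of_int \<lfloor>2 ^ n * x\<rfloor> / 2 ^ n) \<longlonglongrightarrow> x"
  proof (rule tendsto_sandwich[of "\<lambda>n. x - (1/2) ^ n" _ _ "\<lambda>_. x"])
    show "\<forall>\<^sub>F n in sequentially. x - (1/2) ^ n \<le> of_int \<lfloor>2 ^ n * x\<rfloor> / 2 ^ n"
    proof (rule always_eventually, rule allI)
      fix n
      have "x - (1/2) ^ n = (2 ^ n * x - 1) / 2 ^ n" by (simp add: power_one_over diff_divide_distrib)
      also have "\<dots> \<le> of_int \<lfloor>2 ^ n * x\<rfloor> / 2 ^ n"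
        by (intro divide_right_mono) (linarith, simp)
      finally show "x - (1/2) ^ n \<le> of_int \<lfloor>2 ^ n * x\<rfloor> / 2 ^ n" .
    qed
    show "\<forall>\<^sub>F n in sequentially. of_int \<lfloor>2 ^ n * x\<rfloor> / 2 ^ n \<le> x"
    proof (rule always_eventually, rule allI)
      fix n
      have "of_int \<lfloor>2 ^ n * x\<rfloor> \<le> 2 ^ n * x" by linarith
      then show "of_int \<lfloor>2 ^ n * x\<rfloor> / 2 ^ n \<le> x" by (simp add: field_simps)
    qed
    have "(\<lambda>n. x - (1/2) ^ n) \<longlonglongrightarrow> x - 0"
      by (intro tendsto_diff tendsto_const LIMSEQ_realpow_zero) auto
    then show "(\<lambda>n. x - (1/2) ^ n) \<longlonglongrightarrow> x" by simp
  qed auto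
  then have sums: "(\<lambda>i. real (b (Suc i)) / 2 ^ Suc i) sums x"
    unfolding sums_def part .
  have ext: "b \<in> {1..} \<rightarrow>\<^sub>E {0, 1}"
  proof -
    have "nat (m mod 2) \<in> {0, 1}" for m :: int
      by (cases "even m") (auto simp: even_iff_mod_2_eq_zero odd_iff_mod_2_eq_one)
    then show ?thesis by (auto simp: b_def)
  qed
  have fin: "finite {n \<in> {1..}. b n = 1}" if "dyadic_rational x"
  proof -
    obtain m :: int and k :: nat where x: "x = of_int m / 2 ^ k"
      using \<open>dyadic_rational x\<close> dyadic_rational_def by blast
    have "b n \<noteq> 1" if n: "n > k" for n
    proof -
      have "(2::real) ^ n = 2 ^ (n - k) * 2 ^ k" using n by (simp flip: power_add)
      then have "2 ^ n * x = of_int (2 ^ (n - k) * m)" by (simp add: x)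
      then have "\<lfloor>2 ^ n * x\<rfloor> = 2 ^ (n - k) * m" by (simp only: floor_of_int)
      moreover have "even (2 ^ (n - k) * m)" using n by simp
      ultimately have "\<lfloor>2 ^ n * x\<rfloor> mod 2 = 0" by presburger
      then show ?thesis using n by (simp add: b_def)
    qed
    then have "{n \<in> {1..}. b n = 1} \<subseteq> {..k}" by (auto simp: not_less[symmetric])
    then show ?thesis by (rule finite_subset) simp
  qed
  show ?thesis unfolding b_def[symmetric] binary_expansion_def using ext sums fin by blast
qed

lemma binary_expansion_unique:
  assumes "binary_expansion x b" "binary_expansion x c"
  shows "b = c"
proof (rule PiE_ext)
  show "b \<in> {1..} \<rightarrow>\<^sub>E {0, 1}" "c \<in> {1..} \<rightarrow>\<^sub>E {0, 1}"
    using assms by (auto simp only: binary_expansion_def)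
  fix n :: nat assume "n \<in> {1..}"
  then obtain k where n: "n = Suc k" by (cases n) auto
  have rec: "int (d (Suc k)) = \<lfloor>2 ^ Suc k * x\<rfloor> - 2 * \<lfloor>2 ^ k * x\<rfloor>"
    if d: "binary_expansion x d" for d
  proof -
    have "(\<Sum>i<k. int (d (Suc i)) * 2 ^ (Suc k - Suc i))
        = 2 * (\<Sum>i<k. int (d (Suc i)) * 2 ^ (k - Suc i))"
      unfolding sum_distrib_left by (rule sum.cong) (auto simp: Suc_diff_Suc simp flip: power_Suc)
    then show ?thesis unfolding binary_expansion_floor[OF d] sum.lessThan_Suc by simp
  qed
  show "b n = c n" unfolding n using rec[OF assms(1)] rec[OF assms(2)] by simp
qed

lemma binary_digits_expansion:
  assumes "x \<in> {0..<1}"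
  shows "binary_expansion x (binary_digits x)"
  unfolding binary_digits_def
  using binary_expansion_exists[OF assms] binary_expansion_unique by (metis theI)

lemma binary_digits_eq:
  assumes "x \<in> {0..<1}" "n \<ge> 1"
  shows "binary_digits x n = nat (\<lfloor>2 ^ n * x\<rfloor> mod 2)"
  using binary_expansion_unique[OF binary_digits_expansion binary_expansion_exists, OF assms(1) assms(1)]
    assms(2) by simp

end

theory Submission
  imports Defs
begin

text \<open>
  Szemeredi's theorem makes the number of \<open>k\<close>-AP-free subsets of \<open>{1..n}\<close> subexponential. Hence
  the part of the Erdos set without \<open>k\<close>-term progressions has box dimension 0, and so does its
  image under \<open>(a, b, c) \<mapsto> a + b c\<close>. This gives (ii) and (iii), since these parts exhaust the
  Erdos set.

  If Szemeredi's theorem fails, a compactness argument yields an AP-free set of positive lower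
  density. Finitely many translates of its initial segments cover all but a small proportion of an
  interval, and by van der Waerden's theorem the union still has no long progressions. So there
  is a set \<open>Q\<close> without long progressions which has density at least \<open>1 - 1/40\<close> in every initial
  segment and contains \<open>{1..n0}\<close> for a prescribed \<open>n0\<close>. The compact set \<open>D\<close> of numbers whose base
  4 digits are supported on \<open>Q\<close> consists of Erdosian numbers. Its dimension is at least 1/2, because
  \<open>[0, 1)\<close> is contained in the sum of \<open>D\<close> and the set of numbers with digits supported off
  \<open>Q\<close>, which has box dimension less than 1/2.

  Moreover \<open>D + D D\<close> is everything modulo 1, hence contains an interval. Consider the \<open>h\<close>-th Fourier
  coefficient of the distribution of \<open>a + b c\<close> modulo 1, with random digits on \<open>Q\<close>. It is zero for
  \<open>0 < \<bar>h\<bar> < 4 ^ n0\<close>, as the first \<open>n0\<close> digits of \<open>a\<close> are unrestricted. The absolute values of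
  those with \<open>4 ^ (n - 1) \<le> \<bar>h\<bar> < 4 ^ n\<close> sum to at most a constant times \<open>(93 / 100) ^ n\<close>, because two
  consecutive binary digits gain more than square root cancellation on average. So the
  nonzero frequencies are dominated by the zeroth coefficient.\<close>

section \<open>Van der Waerden's theorem\<close>

text \<open>The bound concerns \<open>a + k * d\<close>, one step past the \<open>k\<close> coloured
  terms, so that the place of a further term still lies below \<open>n\<close>. The next term of a
  progression can thus serve as a focus.\<close>

definition mono_AP :: "(nat \<Rightarrow> nat) \<Rightarrow> nat \<Rightarrow> nat \<Rightarrow> bool" where
  "mono_AP c k n \<longleftrightarrow> (\<exists>a d. d > 0 \<and> a + k * d < n \<and> (\<forall>i<k. c (a + i * d) = c a))"

text \<open>Colour focusing: \<open>s\<close> monochromatic progressions of pairwise different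
  colours whose next terms all coincide with the focus \<open>f\<close>.\<close>

definition focused_APs :: "(nat \<Rightarrow> nat) \<Rightarrow> nat \<Rightarrow> nat \<Rightarrow> nat \<Rightarrow> bool" where
  "focused_APs c k s n \<longleftrightarrow>
     (\<exists>a d f. f < n \<and> inj_on (\<lambda>i. c (a i)) {..<s} \<and>
        (\<forall>i<s. d i > 0 \<and> a i + k * d i = f \<and> (\<forall>j<k. c (a i + j * d i) = c (a i))))"

text \<open>Blocks of length \<open>2 * n\<close> are coloured by their patterns, and
  \<open>W\<close> yields \<open>k\<close> equal blocks in progression. If the focus inside the
  first block has the colour of one of the \<open>s\<close> progressions there, that one extends.
  Otherwise the progressions are run diagonally through the blocks, with step
  \<open>d i + 2 * n * D\<close>, and the translates of the focus form a further progression of a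
  new colour; all have their focus in the block number \<open>y + k * D\<close>.\<close>

lemma focused_APs_step:
  fixes r :: nat
  assumes k: "k > 0"
    and W: "\<And>r. \<exists>W. \<forall>c. (\<forall>x. c x < r) \<longrightarrow> mono_AP c k W"
    and IH: "\<And>c. \<forall>x. c x < r \<Longrightarrow> mono_AP c (Suc k) n \<or> focused_APs c k s n"
  shows "\<exists>n'. \<forall>c. (\<forall>x. c x < r) \<longrightarrow> mono_AP c (Suc k) n' \<or> focused_APs c k (Suc s) n'"
proof -
  define P where "P = {..<2 * n} \<rightarrow>\<^sub>E {..<r}"
  have "finite P" unfolding P_def by (intro finite_PiE) auto
  then obtain h :: "(nat \<Rightarrow> nat) \<Rightarrow> nat" and R where h: "h ` P = {i. i < R}" "inj_on h P"
    using finite_imp_inj_to_nat_seg[of P] by metis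
  obtain W where W: "\<And>c. \<forall>x. c x < R \<Longrightarrow> mono_AP c k W" using W by metis
  have "mono_AP c (Suc k) (2 * n * W) \<or> focused_APs c k (Suc s) (2 * n * W)"
    if c: "\<forall>x. c x < r" for c
  proof (rule disjCI)
    assume nofoc: "\<not> focused_APs c k (Suc s) (2 * n * W)"
    define B where "B = (\<lambda>y. \<lambda>i\<in>{..<2 * n}. c (2 * n * y + i))"
    have BP: "B y \<in> P" for y using c by (auto simp: B_def P_def)
    have "\<forall>x. h (B x) < R" using BP h(1) by blast
    from W[OF this] obtain y D where D: "D > 0" and yW: "y + k * D < W"
      and yD: "\<And>i. i < k \<Longrightarrow> h (B (y + i * D)) = h (B y)"
      unfolding mono_AP_def by blast
    have Beq: "B (y + i * D) = B y" if "i < k" for i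
      using yD[OF that] h(2) BP by (auto dest: inj_onD)
    have ceq: "c (2 * n * (y + i * D) + x) = c (2 * n * y + x)" if "i < k" "x < 2 * n" for i x
      using fun_cong[OF Beq[OF that(1)], of x] that(2) by (simp add: B_def)
    have far: "2 * n * (y + k * D) + x < 2 * n * W" if "x < 2 * n" for x
    proof -
      have "2 * n * Suc (y + k * D) \<le> 2 * n * W" using yW by (intro mult_le_mono2) simp
      then show ?thesis using that by simp
    qed
    define u where "u = 2 * n * y"
    have "mono_AP (\<lambda>x. c (u + x)) (Suc k) n \<or> focused_APs (\<lambda>x. c (u + x)) k s n"
      using c by (intro IH) simp
    then show "mono_AP c (Suc k) (2 * n * W)"
    proof
      assume "mono_AP (\<lambda>x. c (u + x)) (Suc k) n"
      then obtain a d where ad: "d > 0" "a + Suc k * d < n"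
        "\<And>i. i < Suc k \<Longrightarrow> c (u + (a + i * d)) = c (u + a)"
        unfolding mono_AP_def by blast
      have "u + (a + Suc k * d) \<le> 2 * n * (y + k * D) + (a + Suc k * d)" by (simp add: u_def)
      also have "\<dots> < 2 * n * W" using ad(2) by (intro far) linarith
      finally have "(u + a) + Suc k * d < 2 * n * W" by simp
      then show ?thesis unfolding mono_AP_def
        using ad(1,3) by (intro exI[of _ "u + a"] exI[of _ d]) (simp add: add.assoc)
    next
      assume "focused_APs (\<lambda>x. c (u + x)) k s n"
      then obtain a d f where f: "f < n" and inj: "inj_on (\<lambda>i. c (u + a i)) {..<s}"
        and ad: "\<And>i. i < s \<Longrightarrow> d i > 0" "\<And>i. i < s \<Longrightarrow> a i + k * d i = f"
          "\<And>i j. i < s \<Longrightarrow> j < k \<Longrightarrow> c (u + (a i + j * d i)) = c (u + a i)"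
        unfolding focused_APs_def by blast
      show ?thesis
      proof (cases "\<exists>i<s. c (u + a i) = c (u + f)")
        case True
        then obtain i where i: "i < s" "c (u + a i) = c (u + f)" by blast
        \<comment> \<open>One step past the focus is still needed below \<open>2 * n\<close>. This
          explains the factor 2 in the block length: the focus and the step are both below
          \<open>n\<close>.\<close>
        have "d i \<le> k * d i" using k by (cases k) auto
        then have "a i + Suc k * d i < 2 * n" using f ad(2)[OF i(1)] unfolding mult_Suc by linarith
        have "u + (a i + Suc k * d i) \<le> 2 * n * (y + k * D) + (a i + Suc k * d i)"
          by (simp add: u_def)
        also have "\<dots> < 2 * n * W" by (intro far) fact
        finally have "(u + a i) + Suc k * d i < 2 * n * W" by simp
        moreover have "c (u + a i + j * d i) = c (u + a i)" if "j < Suc k" for j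
        proof (cases "j = k")
          case True
          then show ?thesis using ad(2)[OF i(1)] i(2) by (simp add: add.assoc)
        next
          case False
          then show ?thesis using ad(3)[OF i(1), of j] that by (simp add: add.assoc)
        qed
        ultimately show ?thesis unfolding mono_AP_def
          using ad(1)[OF i(1)] by (intro exI[of _ "u + a i"] exI[of _ "d i"]) simp
      next
        case False
        define a' where "a' = (\<lambda>i. if i = s then u + f else u + a i)"
        define d' where "d' = (\<lambda>i. if i = s then 2 * n * D else d i + 2 * n * D)"
        have n0: "n > 0" using f by simp
        have "inj_on (\<lambda>i. c (a' i)) {..<Suc s}"
        proof (rule inj_onI)
          fix i j assume "i \<in> {..<Suc s}" "j \<in> {..<Suc s}" "c (a' i) = c (a' j)"
          then show "i = j"
            using False inj_onD[OF inj, of i j] unfolding a'_def less_Suc_eq lessThan_iff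
            by (metis (full_types))
        qed
        moreover have "d' i > 0 \<and> a' i + k * d' i = 2 * n * (y + k * D) + f \<and>
            (\<forall>j<k. c (a' i + j * d' i) = c (a' i))" if "i < Suc s" for i
        proof (cases "i = s")
          case True
          have "c (u + f + j * (2 * n * D)) = c (u + f)" if "j < k" for j
            using ceq[OF that, of f] f by (simp add: u_def algebra_simps)
          then show ?thesis using True D n0
            by (simp add: a'_def d'_def u_def algebra_simps)
        next
          case False
          then have i: "i < s" using that by simp
          have "c (u + a i + j * (d i + 2 * n * D)) = c (u + a i)" if "j < k" for j
          proof -
            have "j * d i \<le> k * d i" using that by simp
            then have "a i + j * d i < 2 * n" using ad(2)[OF i] f by linarith
            from ceq[OF that this] have "c (u + a i + j * (d i + 2 * n * D)) = c (u + (a i + j * d i))"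
              by (simp add: u_def algebra_simps)
            then show ?thesis using ad(3)[OF i that] by simp
          qed
          moreover have "u + a i + k * (d i + 2 * n * D) = 2 * n * (y + k * D) + f"
            using ad(2)[OF i] by (auto simp: u_def algebra_simps)
          ultimately show ?thesis using False ad(1)[OF i]
            by (simp add: a'_def d'_def)
        qed
        moreover have "2 * n * (y + k * D) + f < 2 * n * W" using f by (intro far) simp
        ultimately have "focused_APs c k (Suc s) (2 * n * W)"
          unfolding focused_APs_def by blast
        with nofoc show ?thesis by blast
      qed
    qed
  qed
  then show ?thesis by blast
qed

text \<open>With \<open>r\<close> colours there cannot be \<open>r + 1\<close> focused progressions
  of different colours, so after \<open>r + 1\<close> rounds of the focusing step only the long
  monochromatic progression remains.\<close>

theorem van_der_Waerden: "\<exists>W. \<forall>c. (\<forall>x. c x < r) \<longrightarrow> mono_AP c k W"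
proof (induction k arbitrary: r)
  case 0
  show ?case unfolding mono_AP_def by (intro exI[of _ 1] allI impI exI[of _ 0]) auto
next
  case (Suc k)
  show ?case
  proof (cases "k = 0")
    case True
    show ?thesis unfolding mono_AP_def True
      by (intro exI[of _ 2] allI impI exI[of _ 0] exI[of _ 1]) auto
  next
    case False
    have "\<exists>n. \<forall>c. (\<forall>x. c x < r) \<longrightarrow> mono_AP c (Suc k) n \<or> focused_APs c k s n" for s
    proof (induction s)
      case 0
      show ?case unfolding focused_APs_def by (intro exI[of _ 1] allI impI disjI2 exI[of _ 0]) auto
    next
      case (Suc s)
      then show ?case using focused_APs_step[OF _ \<open>\<And>r. \<exists>W. \<forall>c. (\<forall>x. c x < r) \<longrightarrow> mono_AP c k W\<close>, of r]
        False by (metis neq0_conv)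
    qed
    then obtain n where n: "\<And>c. \<forall>x. c x < r \<Longrightarrow> mono_AP c (Suc k) n \<or> focused_APs c k (Suc r) n"
      by meson
    have "\<not> focused_APs c k (Suc r) n" if "\<forall>x. c x < r" for c
    proof
      assume "focused_APs c k (Suc r) n"
      then obtain a where "inj_on (\<lambda>i. c (a i)) {..<Suc r}" unfolding focused_APs_def by blast
      moreover have "(\<lambda>i. c (a i)) ` {..<Suc r} \<subseteq> {..<r}" using that by auto
      ultimately have "card {..<Suc r} \<le> card {..<r}" by (intro card_inj_on_le) auto
      then show False by simp
    qed
    then show ?thesis using n by blast
  qed
qed

lemma contains_AP_mono: "contains_AP A k \<Longrightarrow> A \<subseteq> B \<Longrightarrow> j \<le> k \<Longrightarrow> contains_AP B j"
  unfolding contains_AP_def by (meson less_le_trans subsetD)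

text \<open>Colour the terms of a long progression in the union by the index of a set containing
  them. A monochromatic subprogression lies in a single set. The length \<open>K\<close> depends on
  \<open>m\<close> and \<open>k\<close> only, not on the sets.\<close>

lemma AP_free_Union:
  fixes m :: nat
  shows "\<exists>K. \<forall>F. (\<forall>i<m. \<not> contains_AP (F i) k) \<longrightarrow> \<not> contains_AP (\<Union>i<m. F i) K"
proof -
  obtain W where W: "\<And>c. \<forall>x. c x < Suc m \<Longrightarrow> mono_AP c k W" using van_der_Waerden[of "Suc m" k] by blast
  have "\<not> contains_AP (\<Union>i<m. F i) (Suc W)" if F: "\<And>i. i < m \<Longrightarrow> \<not> contains_AP (F i) k" for F
  proof
    assume "contains_AP (\<Union>i<m. F i) (Suc W)"
    then obtain a d where d: "d > 0" and ad: "\<And>i. i < Suc W \<Longrightarrow> \<exists>j<m. a + i * d \<in> F j"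
      unfolding contains_AP_def UN_iff Bex_def lessThan_iff by blast
    \<comment> \<open>Indices beyond the progression receive the default colour 0, which is
      admissible among \<open>Suc m\<close> colours even for \<open>m = 0\<close>.\<close>
    define c where "c = (\<lambda>i. if i < Suc W then SOME j. j < m \<and> a + i * d \<in> F j else 0)"
    have c: "c i < m \<and> a + i * d \<in> F (c i)" if "i < Suc W" for i
      unfolding c_def using someI_ex[OF ad[OF that]] that by simp
    have "\<forall>x. c x < Suc m" using c by (auto simp: c_def less_Suc_eq)
    from W[OF this] obtain b e where be: "e > 0" "b + k * e < W" "\<And>i. i < k \<Longrightarrow> c (b + i * e) = c b"
      unfolding mono_AP_def by blast
    have "a + b * d + i * (e * d) \<in> F (c b)" if "i < k" for i
    proof -
      have "i * e \<le> k * e" using that by simp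
      then have "b + i * e < Suc W" using be(2) by linarith
      from c[OF this] be(3)[OF that] show ?thesis by (simp add: algebra_simps)
    qed
    then have "contains_AP (F (c b)) k" unfolding contains_AP_def using d be(1)
      by (intro exI[of _ "a + b * d"] exI[of _ "e * d"]) auto
    moreover have "c b < m" using c[of b] be(2) by simp
    ultimately show False using F by blast
  qed
  then show ?thesis by blast
qed

section \<open>Dense sets without long progressions\<close>

text \<open>Density is required in every initial segment: this is a condition on finite prefixes, so
  it survives a compactness argument, and it controls all scales of an expansion at once.\<close>

definition dense_AP_free :: "nat \<Rightarrow> real \<Rightarrow> nat set \<Rightarrow> bool" where
  "dense_AP_free k \<delta> B \<longleftrightarrow> B \<subseteq> {1..} \<and> \<not> contains_AP B k \<and>
     (\<forall>n. \<delta> * real n \<le> real (card (B \<inter> {1..n})))"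

text \<open>Koenig's lemma for the binary tree of admissible prefixes. \<open>ext m S\<close> says
  that \<open>S\<close> has admissible continuations of every length; a branch through such nodes is
  the required set.\<close>

lemma dense_AP_free_compactness:
  assumes "\<And>n. \<exists>T\<subseteq>{1..n}. \<not> contains_AP T k \<and> (\<forall>m\<le>n. \<delta> * real m \<le> real (card (T \<inter> {1..m})))"
  shows "\<exists>B. dense_AP_free k \<delta> B"
proof -
  define good where "good = (\<lambda>n T. T \<subseteq> {1..n} \<and> \<not> contains_AP T k \<and>
    (\<forall>m\<le>n. \<delta> * real m \<le> real (card (T \<inter> {1..m}))))"
  have good_restrict: "good m (T \<inter> {1..m})" if "good n T" "m \<le> n" for n m T
  proof -
    have "T \<inter> {1..m} \<inter> {1..i} = T \<inter> {1..i}" if "i \<le> m" for i using that by auto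
    moreover have "\<not> contains_AP (T \<inter> {1..m}) k"
      using \<open>good n T\<close> contains_AP_mono[of "T \<inter> {1..m}" k T k] unfolding good_def by blast
    ultimately show ?thesis using that unfolding good_def by auto
  qed
  define ext where "ext = (\<lambda>m S. \<forall>n\<ge>m. \<exists>T. good n T \<and> T \<inter> {1..m} = S)"
  have step: "\<exists>S'. ext (Suc m) S' \<and> S' \<inter> {1..m} = S" if S: "ext m S" for m S
  proof (rule ccontr)
    assume neg: "\<nexists>S'. ext (Suc m) S' \<and> S' \<inter> {1..m} = S"
    have Sm: "S \<subseteq> {1..m}" using S unfolding ext_def by blast
    \<comment> \<open>If both continuations of \<open>S\<close> died out, at lengths
      \<open>n1\<close> and \<open>n2\<close>, an admissible continuation of length
      \<open>max n1 n2\<close> would have to restrict to one of them.\<close>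
    have "\<not> ext (Suc m) S" "\<not> ext (Suc m) (insert (Suc m) S)"
      using neg Sm by auto
    then obtain n1 n2 where n: "n1 \<ge> Suc m" "n2 \<ge> Suc m"
      and n1: "\<And>T. good n1 T \<Longrightarrow> T \<inter> {1..Suc m} \<noteq> S"
      and n2: "\<And>T. good n2 T \<Longrightarrow> T \<inter> {1..Suc m} \<noteq> insert (Suc m) S"
      unfolding ext_def by meson
    obtain T where T: "good (max n1 n2) T" "T \<inter> {1..m} = S"
      using S n unfolding ext_def by (metis Suc_leD max.coboundedI1)
    have "T \<inter> {1..n1} \<inter> {1..Suc m} \<noteq> S"
      by (intro n1 good_restrict[OF T(1)]) simp
    moreover have "T \<inter> {1..n2} \<inter> {1..Suc m} \<noteq> insert (Suc m) S"
      by (intro n2 good_restrict[OF T(1)]) simp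
    moreover have "T \<inter> {1..n1} \<inter> {1..Suc m} = T \<inter> {1..Suc m}" "T \<inter> {1..n2} \<inter> {1..Suc m} = T \<inter> {1..Suc m}"
      using n by auto
    moreover have "{1..Suc m} = insert (Suc m) {1..m}" by auto
    ultimately show False using T(2) by (cases "Suc m \<in> T") auto
  qed
  have "ext 0 {}" using assms unfolding ext_def good_def by auto
  then obtain S where S: "\<And>m. ext m (S m)" "\<And>m. S (Suc m) \<inter> {1..m} = S m"
    using dependent_nat_choice[of ext "\<lambda>m S S'. S' \<inter> {1..m} = S"] step by metis
  have nested: "S (m + i) \<inter> {1..m} = S m" for m i
  proof (induction i)
    case 0
    show ?case using S(1)[of m] unfolding ext_def by auto
  next
    case (Suc i)
    have "S (m + Suc i) \<inter> {1..m} = S (m + Suc i) \<inter> {1..m + i} \<inter> {1..m}" by auto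
    then show ?case using S(2)[of "m + i"] Suc by simp
  qed
  define B where "B = (\<Union>m. S m)"
  have B: "B \<inter> {1..m} = S m" for m
  proof -
    have "S i \<inter> {1..m} \<subseteq> S m" for i
    proof (cases "m \<le> i")
      case True
      then show ?thesis using nested[of m "i - m"] by simp
    next
      case False
      then show ?thesis using nested[of i "m - i"] by auto
    qed
    moreover have "S m \<subseteq> {1..m}" using nested[of m 0] by auto
    ultimately show ?thesis unfolding B_def by auto
  qed
  have goodB: "\<exists>T. good m T \<and> T = S m" for m
    using S(1)[of m] unfolding ext_def good_def by (metis inf.absorb1 le_refl)
  have "\<not> contains_AP B k"
  proof
    assume "contains_AP B k"
    then obtain a d where ad: "d > 0" "\<And>i. i < k \<Longrightarrow> a + i * d \<in> B" unfolding contains_AP_def by blast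
    have "a + i * d \<in> S (a + k * d)" if "i < k" for i
    proof -
      have "B \<subseteq> {1..}" using goodB unfolding B_def good_def by fastforce
      moreover have "i * d \<le> k * d" using that by simp
      ultimately show ?thesis using ad(2)[OF that] unfolding B[symmetric] by auto
    qed
    then have "contains_AP (S (a + k * d)) k" using ad(1) unfolding contains_AP_def by blast
    then show False using goodB[of "a + k * d"] unfolding good_def by blast
  qed
  moreover have "B \<subseteq> {1..}" using goodB unfolding B_def good_def by fastforce
  moreover have "\<delta> * real n \<le> real (card (B \<inter> {1..n}))" for n
    using goodB[of n] unfolding good_def by (metis B inf.absorb1 le_refl)
  ultimately show ?thesis unfolding dense_AP_free_def by blast
qed

lemma contains_AP_shift: "contains_AP {x. s + x \<in> A} k \<Longrightarrow> contains_AP A k"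
  unfolding contains_AP_def by (metis (mono_tags, lifting) add.assoc mem_Collect_eq)

text \<open>All prefixes of a window become dense when the window starts at a minimum of
  the function \<open>s \<mapsto> #(T \<inter> [1, s]) - \<delta>' s\<close>.\<close>

lemma dense_AP_free_if_long_windows:
  assumes "0 \<le> \<delta>'" "\<delta>' < \<delta>"
    and windows: "\<And>n. \<exists>L\<ge>n. \<exists>M T. T \<subseteq> {M + 1..M + L} \<and> \<not> contains_AP T k \<and> \<delta> * real L \<le> real (card T)"
  shows "\<exists>B. dense_AP_free k \<delta>' B"
proof (rule dense_AP_free_compactness)
  fix n
  obtain L M T where L: "L \<ge> nat \<lceil>real n / (\<delta> - \<delta>')\<rceil>"
    and T: "T \<subseteq> {M + 1..M + L}" "\<not> contains_AP T k" "\<delta> * real L \<le> real (card T)"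
    using windows by metis
  have "real n / (\<delta> - \<delta>') \<le> real L" using L by linarith
  then have nL: "real n \<le> (\<delta> - \<delta>') * real L" using assms by (simp add: field_simps)
  define N where "N = (\<lambda>s. card (T \<inter> {M + 1..M + s}))"
  have N_add: "N (s + i) = N s + card (T \<inter> {M + s + 1..M + s + i})" for s i
  proof -
    have "T \<inter> {M + 1..M + (s + i)} = (T \<inter> {M + 1..M + s}) \<union> (T \<inter> {M + s + 1..M + s + i})" by auto
    then show ?thesis unfolding N_def by (simp add: card_Un_disjoint disjoint_iff)
  qed
  define g where "g = (\<lambda>s. real (N s) - \<delta>' * real s)"
  define s where "s = arg_min_on g {..L}"
  have s: "s \<le> L" and smin: "\<And>i. i \<le> L \<Longrightarrow> g s \<le> g i"
    using arg_min_if_finite[of "{..L}" g] unfolding s_def by (auto simp: not_less)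
  have "N L = card T" unfolding N_def using T(1) by (simp add: inf_absorb1)
  then have "real n \<le> g L" using T(3) nL unfolding g_def by (simp add: algebra_simps)
  have "g 0 = 0" by (simp add: g_def N_def)
  then have "g s \<le> 0" using smin[of 0] by simp
  \<comment> \<open>\<open>g\<close> grows by at most 1 per position, \<open>g s\<close> is at most
    0 and \<open>g L\<close> is at least \<open>n\<close>, so at least \<open>n\<close> positions
    follow \<open>s\<close>. The lower bound \<open>n / (\<delta> - \<delta>')\<close> for
    \<open>L\<close> was chosen to make \<open>g L\<close> this large.\<close>
  have sn: "s + n \<le> L"
  proof (rule ccontr)
    assume "\<not> s + n \<le> L"
    have "N L = N s + card (T \<inter> {M + s + 1..M + s + (L - s)})" using N_add[of s "L - s"] s by simp
    also have "card (T \<inter> {M + s + 1..M + s + (L - s)}) \<le> card {M + s + 1..M + s + (L - s)}"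
      by (intro card_mono) auto
    finally have "N L \<le> N s + (L - s)" by simp
    moreover have "\<delta>' * real s \<le> \<delta>' * real L" using s assms by (intro mult_left_mono) auto
    ultimately have "g L \<le> g s + real (L - s)" unfolding g_def by linarith
    then show False using \<open>real n \<le> g L\<close> \<open>g s \<le> 0\<close> \<open>\<not> s + n \<le> L\<close> s by linarith
  qed
  define T' where "T' = {x. M + s + x \<in> T} \<inter> {1..n}"
  have "\<not> contains_AP T' k"
    using T(2) contains_AP_shift contains_AP_mono[of T' k "{x. M + s + x \<in> T}" k] unfolding T'_def by blast
  moreover have "\<delta>' * real m \<le> real (card (T' \<inter> {1..m}))" if "m \<le> n" for m
  proof -
    have "(\<lambda>x. M + s + x) ` (T' \<inter> {1..m}) = T \<inter> {M + s + 1..M + s + m}"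
    proof (intro set_eqI iffI)
      fix y assume "y \<in> T \<inter> {M + s + 1..M + s + m}"
      then show "y \<in> (\<lambda>x. M + s + x) ` (T' \<inter> {1..m})"
        using that by (intro image_eqI[of _ _ "y - (M + s)"]) (auto simp: T'_def)
    qed (auto simp: T'_def)
    then have "card (T' \<inter> {1..m}) = card (T \<inter> {M + s + 1..M + s + m})"
      by (metis (no_types, lifting) card_image inj_on_def add_left_cancel)
    then have "real (card (T' \<inter> {1..m})) = real (N (s + m)) - real (N s)" using N_add[of s m] by simp
    moreover have "g s \<le> g (s + m)" using sn that by (intro smin) linarith
    ultimately show ?thesis unfolding g_def by (simp add: algebra_simps)
  qed
  moreover have "T' \<subseteq> {1..n}" unfolding T'_def by auto
  ultimately show "\<exists>T\<subseteq>{1..n}. \<not> contains_AP T k \<and> (\<forall>m\<le>n. \<delta>' * real m \<le> real (card (T \<inter> {1..m})))"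
    by blast
qed

section \<open>Upper Banach density and AP-free sets dense in all initial segments\<close>

lemma counting_diff:
  assumes "a \<le> b"
  shows "real (counting A b) - real (counting A a) = real (card (A \<inter> {a + 1..b}))"
proof -
  have "A \<inter> {1..b} = (A \<inter> {1..a}) \<union> (A \<inter> {a + 1..b})" using assms by auto
  then show ?thesis unfolding counting_def by (simp add: card_Un_disjoint disjoint_iff)
qed

text \<open>The joint limit superior of a counterexample exceeds some \<open>\<delta>\<close>, hence
  there are arbitrarily long windows of density \<open>\<delta>\<close>. Passing from windows to
  initial segments requires a strictly smaller density, here \<open>\<delta> / 2\<close>.\<close>

lemma dense_AP_free_if_not_Szemeredi:
  assumes "\<not> Szemeredi_statement"
  shows "\<exists>k \<delta> B. \<delta> > 0 \<and> dense_AP_free k \<delta> B"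
proof -
  obtain A k where A: "A \<subseteq> {1..}" "upper_Banach_density A > 0" "\<not> contains_AP A k"
    using assms unfolding Szemeredi_statement_def arbitrarily_long_APs_def by blast
  then obtain \<delta> :: real where \<delta>: "0 < \<delta>" "ereal \<delta> < upper_Banach_density A"
    by (metis ereal_dense2 ereal_less(2))
  have windows: "\<exists>L\<ge>n. \<exists>M T. T \<subseteq> {M + 1..M + L} \<and> \<not> contains_AP T k \<and> \<delta> * real L \<le> real (card T)" for n
  proof -
    define f where "f = (\<lambda>(L, M). ereal ((real (counting A (M + L - 1)) - real (counting A M)) / real L))"
    have "\<not> (\<forall>\<^sub>F p in sequentially \<times>\<^sub>F sequentially. f p \<le> ereal \<delta>)"
    proof
      assume "\<forall>\<^sub>F p in sequentially \<times>\<^sub>F sequentially. f p \<le> ereal \<delta>"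
      then have "Limsup (sequentially \<times>\<^sub>F sequentially) f \<le> ereal \<delta>" by (rule Limsup_bounded)
      then show False using \<delta>(2) unfolding upper_Banach_density_def f_def by simp
    qed
    then obtain L M where LM: "L \<ge> max 1 n" "\<not> f (L, M) \<le> ereal \<delta>"
      unfolding eventually_prod_sequentially by (metis (no_types, lifting))
    then have "\<delta> * real L < real (counting A (M + L - 1)) - real (counting A M)"
      by (simp add: f_def field_simps)
    also have "\<dots> = real (card (A \<inter> {M + 1..M + L - 1}))"
    proof (rule counting_diff)
      have "1 \<le> L" using LM(1) by simp
      then show "M \<le> M + L - 1" by linarith
    qed
    finally have "\<delta> * real L \<le> real (card (A \<inter> {M + 1..M + L - 1}))" by simp
    moreover have "\<not> contains_AP (A \<inter> {M + 1..M + L - 1}) k"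
      using A(3) contains_AP_mono[of "A \<inter> {M + 1..M + L - 1}" k A k] by blast
    moreover have "A \<inter> {M + 1..M + L - 1} \<subseteq> {M + 1..M + L}" by auto
    ultimately show ?thesis using LM(1) by (metis max.boundedE)
  qed
  have "\<exists>B. dense_AP_free k (\<delta> / 2) B"
    by (rule dense_AP_free_if_long_windows[OF _ _ windows]) (use \<delta> in auto)
  then show ?thesis using \<delta>(1) half_gt_zero by blast
qed

text \<open>Windows that start at a fixed large \<open>N\<close> and grow in length inherit the
  density of the initial segments, since at most \<open>N\<close> elements lie before them.\<close>

lemma not_Szemeredi_if_dense_AP_free:
  assumes "dense_AP_free k \<delta> B" "\<delta> > 0"
  shows "\<not> Szemeredi_statement"
proof
  assume S: "Szemeredi_statement"
  have B: "B \<subseteq> {1..}" "\<not> contains_AP B k" "\<And>n. \<delta> * real n \<le> real (card (B \<inter> {1..n}))"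
    using assms unfolding dense_AP_free_def by auto
  have "\<not> contains_AP B (max 1 k)" using B(2) contains_AP_mono[of B "max 1 k" B k] by auto
  then have "\<not> upper_Banach_density B > 0"
    using S B(1) unfolding Szemeredi_statement_def arbitrarily_long_APs_def by (metis max.cobounded1)
  then have "upper_Banach_density B < ereal (\<delta> / 2)" using assms(2)
    by (metis ereal_less(2) half_gt_zero le_less_trans linorder_not_le)
  then have "\<forall>\<^sub>F p in sequentially \<times>\<^sub>F sequentially.
    (\<lambda>(L, M). ereal ((real (counting B (M + L - 1)) - real (counting B M)) / real L)) p < ereal (\<delta> / 2)"
    unfolding upper_Banach_density_def by (rule Limsup_lessD)
  then obtain N where N: "\<And>L M. L \<ge> N \<Longrightarrow> M \<ge> N \<Longrightarrow>
      (real (counting B (M + L - 1)) - real (counting B M)) / real L < \<delta> / 2"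
    unfolding eventually_prod_sequentially by auto
  \<comment> \<open>With this \<open>L\<close> the loss \<open>\<delta> + N\<close>, caused by the
    elements up to \<open>N\<close> and by the window ending at \<open>N + L - 1\<close>, is at most
    half of \<open>\<delta> * L\<close>.\<close>
  obtain L :: nat where L: "real L \<ge> 2 * (\<delta> + real N) / \<delta>" "L \<ge> N" "L \<ge> 1"
    using real_arch_simple[of "max (2 * (\<delta> + real N) / \<delta>) (real (N + 1))"] by auto
  have "2 * (\<delta> + real N) \<le> \<delta> * real L" using L(1) assms(2) by (simp add: field_simps)
  moreover have "real (counting B N) \<le> real N"
    unfolding counting_def using card_mono[of "{1..N}" "B \<inter> {1..N}"] by simp
  moreover have "\<delta> * (real L - 1) \<le> \<delta> * real (N + L - 1)"
    using L(3) assms(2) by (intro mult_left_mono) auto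
  ultimately have "\<delta> / 2 * real L \<le> real (counting B (N + L - 1)) - real (counting B N)"
    using B(3)[of "N + L - 1"] unfolding counting_def by (simp add: algebra_simps)
  then show False using N[of L N] L by (simp add: field_simps)
qed

section \<open>Raising the density by translates\<close>

text \<open>Averaging over shifts: each pair \<open>(x, b)\<close> belongs to the shift
  \<open>t = x + n - b\<close>, one of \<open>2 * n\<close> values, so some shift receives at least
  the mean number of pairs. The equation \<open>x + n = b + t\<close> encodes translation by
  \<open>t - n\<close>, possibly negative, within the natural numbers.\<close>

lemma translate_meeting:
  fixes V T :: "nat set"
  assumes "V \<subseteq> {1..n}" "T \<subseteq> {1..n}" "n \<ge> 1"
  obtains t where "real (card V) * real (card T) \<le> 2 * real n * real (card {x \<in> V. \<exists>b\<in>T. x + n = b + t})"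
proof -
  have fin: "finite V" "finite T" using assms finite_subset by auto
  define P where "P = (\<lambda>t. {x \<in> V. \<exists>b\<in>T. x + n = b + t})"
  have "V \<times> T \<subseteq> (\<Union>t\<in>{1..2 * n}. (\<lambda>x. (x, x + n - t)) ` P t)"
  proof
    fix p assume "p \<in> V \<times> T"
    then obtain x b where p: "p = (x, b)" "x \<in> V" "b \<in> T" by blast
    then have "1 \<le> x" "x \<le> n" "1 \<le> b" "b \<le> n" using assms by auto
    then have "x + n - b \<in> {1..2 * n}" "x + n = b + (x + n - b)" "b = x + n - (x + n - b)" by auto
    then show "p \<in> (\<Union>t\<in>{1..2 * n}. (\<lambda>x. (x, x + n - t)) ` P t)"
      using p unfolding P_def by blast
  qed
  then have "card (V \<times> T) \<le> card (\<Union>t\<in>{1..2 * n}. (\<lambda>x. (x, x + n - t)) ` P t)"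
    using fin by (intro card_mono) (auto simp: P_def)
  also have "\<dots> \<le> (\<Sum>t\<in>{1..2 * n}. card ((\<lambda>x. (x, x + n - t)) ` P t))" by (rule card_UN_le) simp
  also have "\<dots> \<le> (\<Sum>t\<in>{1..2 * n}. card (P t))"
    using fin by (intro sum_mono card_image_le) (auto simp: P_def)
  finally have le: "card V * card T \<le> (\<Sum>t\<in>{1..2 * n}. card (P t))" by (simp add: card_cartesian_product)
  define m where "m = Max ((\<lambda>t. card (P t)) ` {1..2 * n})"
  have "m \<in> (\<lambda>t. card (P t)) ` {1..2 * n}" unfolding m_def using assms(3) by (intro Max_in) auto
  then obtain t where t: "card (P t) = m" by blast
  have "(\<Sum>t\<in>{1..2 * n}. card (P t)) \<le> (\<Sum>t\<in>{1..2 * n}. m)"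
    unfolding m_def by (intro sum_mono Max_ge) auto
  then have "card V * card T \<le> 2 * n * card (P t)" using le t by simp
  then have "real (card V * card T) \<le> real (2 * n * card (P t))" by (rule of_nat_mono)
  then show ?thesis by (intro that[of t]) (simp add: P_def)
qed

text \<open>Greedy choice: the next translate of \<open>T\<close> covers at least the proportion
  \<open>\<delta> / 2\<close> of what is still uncovered.\<close>

lemma cover_by_translates:
  assumes T: "T \<subseteq> {1..n}" "\<not> contains_AP T k" "\<delta> * real n \<le> real (card T)" and "n \<ge> 1" "\<delta> \<le> 1"
  shows "\<exists>F. (\<forall>i<m. F i \<subseteq> {1..n} \<and> \<not> contains_AP (F i) k) \<and>
    real (card ({1..n} - (\<Union>i<m. F i))) \<le> (1 - \<delta> / 2) ^ m * real n"
proof (induction m)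
  case 0
  show ?case by simp
next
  case (Suc m)
  then obtain F where F: "\<And>i. i < m \<Longrightarrow> F i \<subseteq> {1..n}" "\<And>i. i < m \<Longrightarrow> \<not> contains_AP (F i) k"
    and small: "real (card ({1..n} - (\<Union>i<m. F i))) \<le> (1 - \<delta> / 2) ^ m * real n" by blast
  define V where "V = {1..n} - (\<Union>i<m. F i)"
  obtain t where t: "real (card V) * real (card T) \<le> 2 * real n * real (card {x \<in> V. \<exists>b\<in>T. x + n = b + t})"
    using translate_meeting[of V n T] T(1) \<open>n \<ge> 1\<close> unfolding V_def by blast
  define S where "S = {x \<in> {1..n}. \<exists>b\<in>T. x + n = b + t}"
  have VS: "{x \<in> V. \<exists>b\<in>T. x + n = b + t} = V \<inter> S" unfolding S_def V_def by auto
  have "\<not> contains_AP S k"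
  proof
    assume "contains_AP S k"
    then obtain a d where ad: "d > 0" "\<And>i. i < k \<Longrightarrow> a + i * d \<in> S" unfolding contains_AP_def by blast
    \<comment> \<open>The first term \<open>a\<close> itself lies in \<open>S\<close>, so
      \<open>t\<close> is at most \<open>a + n\<close> and the subtraction is not truncated.\<close>
    have "(a + n - t) + i * d \<in> T" if i: "i < k" for i
    proof -
      obtain b where b: "b \<in> T" "a + i * d + n = b + t" using ad(2)[OF i] unfolding S_def by blast
      have "a \<in> S" using ad(2)[of 0] i by simp
      then have "t \<le> a + n" unfolding S_def by auto
      then show ?thesis using b by (metis Nat.add_diff_assoc2 add.assoc add.commute add_diff_cancel_right')
    qed
    then show False using T(2) ad(1) unfolding contains_AP_def by blast
  qed
  define F' where "F' = F(m := S)"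
  have U: "{1..n} - (\<Union>i<Suc m. F' i) = V - S" unfolding V_def F'_def lessThan_Suc by auto
  have "card (V - S) = card V - card (V \<inter> S)" by (metis card_Diff_subset_Int V_def finite_Diff finite_Int finite_atLeastAtMost)
  moreover have "card (V \<inter> S) \<le> card V" by (intro card_mono) (auto simp: V_def)
  ultimately have eq: "real (card (V - S)) = real (card V) - real (card (V \<inter> S))" by simp
  have "real (card V) * (\<delta> * real n) \<le> real (card V) * real (card T)" using T(3) by (intro mult_left_mono) auto
  then have "real n * (\<delta> * real (card V)) \<le> real n * (2 * real (card (V \<inter> S)))"
    using t unfolding VS by (simp add: algebra_simps)
  then have "\<delta> * real (card V) \<le> 2 * real (card (V \<inter> S))" using \<open>n \<ge> 1\<close> by (simp add: mult_le_cancel_left_pos)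
  then have "real (card (V - S)) \<le> (1 - \<delta> / 2) * real (card V)" unfolding eq by (simp add: algebra_simps)
  also have "\<dots> \<le> (1 - \<delta> / 2) * ((1 - \<delta> / 2) ^ m * real n)"
    using small \<open>\<delta> \<le> 1\<close> unfolding V_def by (intro mult_left_mono) auto
  finally have "real (card ({1..n} - (\<Union>i<Suc m. F' i))) \<le> (1 - \<delta> / 2) ^ Suc m * real n"
    unfolding U by simp
  moreover have "F' i \<subseteq> {1..n} \<and> \<not> contains_AP (F' i) k" if "i < Suc m" for i
  proof (cases "i = m")
    case True
    then show ?thesis using \<open>\<not> contains_AP S k\<close> by (auto simp: F'_def S_def)
  qed (use that F in \<open>auto simp: F'_def less_Suc_eq\<close>)
  ultimately show ?case by blast
qed

text \<open>The number \<open>m\<close> of translates that leave a proportion below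
  \<open>\<epsilon> / 2\<close> does not depend on the length of the interval. Van der Waerden's
  theorem therefore bounds the progressions in all these unions by one \<open>K\<close>, and the
  unions supply the long dense windows.\<close>

lemma dense_AP_free_boost:
  assumes B: "dense_AP_free k \<delta> B" "\<delta> > 0" and \<epsilon>: "0 < \<epsilon>" "\<epsilon> \<le> 1"
  shows "\<exists>K B'. dense_AP_free K (1 - \<epsilon>) B'"
proof -
  define \<delta>' where "\<delta>' = min \<delta> 1"
  have \<delta>': "0 < \<delta>'" "\<delta>' \<le> 1" "\<And>n. \<delta>' * real n \<le> real (card (B \<inter> {1..n}))"
  proof -
    show "\<delta>' * real n \<le> real (card (B \<inter> {1..n}))" for n
    proof -
      have "\<delta>' * real n \<le> \<delta> * real n" by (intro mult_right_mono) (auto simp: \<delta>'_def)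
      then show ?thesis using B(1) unfolding dense_AP_free_def by (meson order_trans)
    qed
  qed (use B(2) in \<open>auto simp: \<delta>'_def\<close>)
  obtain m where m: "(1 - \<delta>' / 2) ^ m < \<epsilon> / 2"
    using real_arch_pow_inv[of "\<epsilon> / 2" "1 - \<delta>' / 2"] \<epsilon> \<delta>' by auto
  obtain K where K: "\<And>F. \<forall>i<m. \<not> contains_AP (F i) k \<Longrightarrow> \<not> contains_AP (\<Union>i<m. F i) K"
    using AP_free_Union[of m k] by blast
  have "\<exists>B'. dense_AP_free K (1 - \<epsilon>) B'"
  proof (rule dense_AP_free_if_long_windows[where \<delta> = "1 - \<epsilon> / 2"])
    fix n :: nat
    define L where "L = max n 1"
    have "\<not> contains_AP (B \<inter> {1..L}) k"
      using B(1) contains_AP_mono[of "B \<inter> {1..L}" k B k] unfolding dense_AP_free_def by blast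
    then obtain F where F: "\<And>i. i < m \<Longrightarrow> F i \<subseteq> {1..L} \<and> \<not> contains_AP (F i) k"
      and small: "real (card ({1..L} - (\<Union>i<m. F i))) \<le> (1 - \<delta>' / 2) ^ m * real L"
      using cover_by_translates[of "B \<inter> {1..L}" L k \<delta>' m] \<delta>' by (auto simp: L_def)
    have sub: "(\<Union>i<m. F i) \<subseteq> {1..L}" using F by blast
    then have "card ({1..L} - (\<Union>i<m. F i)) = L - card (\<Union>i<m. F i)"
      by (simp add: card_Diff_subset finite_subset)
    moreover have "(1 - \<delta>' / 2) ^ m * real L \<le> \<epsilon> / 2 * real L" using m by (intro mult_right_mono) auto
    ultimately have "(1 - \<epsilon> / 2) * real L \<le> real (card (\<Union>i<m. F i))"
      using small by (simp add: algebra_simps)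
    then show "\<exists>L\<ge>n. \<exists>M T. T \<subseteq> {M + 1..M + L} \<and> \<not> contains_AP T K \<and> (1 - \<epsilon> / 2) * real L \<le> real (card T)"
      using sub K[of F] F by (intro exI[of _ L] conjI exI[of _ 0] exI[of _ "\<Union>i<m. F i"]) (auto simp: L_def)
  qed (use \<epsilon> in auto)
  then show ?thesis by blast
qed

section \<open>Consequences of Szemeredi's theorem\<close>

text \<open>Otherwise dense AP-free subsets of arbitrarily long initial intervals would serve as
  windows and yield an infinite set contradicting Szemeredi's theorem.\<close>

lemma sparse_if_Szemeredi:
  assumes "Szemeredi_statement" "\<epsilon> > 0"
  shows "\<exists>n0. \<forall>n\<ge>n0. \<forall>T\<subseteq>{1..n}. \<not> contains_AP T k \<longrightarrow> real (card T) < \<epsilon> * real n"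
proof (rule ccontr)
  assume "\<not> ?thesis"
  then have *: "\<exists>n\<ge>n0. \<exists>T\<subseteq>{1..n}. \<not> contains_AP T k \<and> \<epsilon> * real n \<le> real (card T)" for n0
    by (auto simp: not_less)
  have "\<exists>B. dense_AP_free k (\<epsilon> / 2) B"
  proof (rule dense_AP_free_if_long_windows[where \<delta> = \<epsilon>])
    fix n
    show "\<exists>L\<ge>n. \<exists>M T. T \<subseteq> {M + 1..M + L} \<and> \<not> contains_AP T k \<and> \<epsilon> * real L \<le> real (card T)"
      using *[of n] by (metis add_0)
  qed (use assms in auto)
  then show False using not_Szemeredi_if_dense_AP_free assms half_gt_zero by blast
qed

lemma sum_Pow_power_card:
  fixes z :: real
  assumes "finite X"
  shows "(\<Sum>T\<in>Pow X. z ^ card T) = (1 + z) ^ card X"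
  using prod_add[OF assms, of "\<lambda>_. z" "\<lambda>_. 1"] by (simp add: add.commute)

definition AP_free_subsets :: "nat \<Rightarrow> nat \<Rightarrow> nat set set" where
  "AP_free_subsets k n = {T. T \<subseteq> {1..n} \<and> \<not> contains_AP T k}"

lemma finite_AP_free_subsets: "finite (AP_free_subsets k n)"
  by (rule finite_subset[of _ "Pow {1..n}"]) (auto simp: AP_free_subsets_def)

text \<open>Sets of relative density \<open>\<epsilon>\<close> are counted with the weights
  \<open>z ^ card T\<close>, which are at least \<open>z ^ (\<epsilon> n)\<close> and sum to \<open>(1 + z) ^ n\<close>.\<close>

lemma few_AP_free_subsets:
  assumes "Szemeredi_statement" "\<eta> > 0"
  shows "\<exists>n0. \<forall>n\<ge>n0. real (card (AP_free_subsets k n)) \<le> 2 powr (\<eta> * real n)"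
proof -
  \<comment> \<open>The parameters make \<open>1 + z\<close> and
    \<open>z powr (- \<epsilon>)\<close> each at most \<open>2 powr (\<eta> / 2)\<close>, half of
    the allowed growth rate. The denominator contains \<open>1 - ln z\<close> instead of
    \<open>- ln z\<close> so that it stays positive for \<open>z = 1\<close>.\<close>
  define z where "z = min 1 (2 powr (\<eta> / 2) - 1)"
  have z: "0 < z" "z \<le> 1" "1 + z \<le> 2 powr (\<eta> / 2)" using assms(2) by (auto simp: z_def)
  define \<epsilon> where "\<epsilon> = \<eta> * ln 2 / (2 * (1 - ln z))"
  have lz: "ln z \<le> 0" using z by simp
  then have \<epsilon>: "\<epsilon> > 0" using assms(2) unfolding \<epsilon>_def by (intro divide_pos_pos) auto
  have "- \<epsilon> * ln z \<le> \<epsilon> * (1 - ln z)" using \<epsilon> by (simp add: algebra_simps)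
  also have "\<dots> = \<eta> / 2 * ln 2" unfolding \<epsilon>_def using lz by (simp add: field_simps)
  finally have \<epsilon>z: "z powr (- \<epsilon>) \<le> 2 powr (\<eta> / 2)" using z by (simp add: powr_def)
  obtain n0 where n0: "\<And>n T. n \<ge> n0 \<Longrightarrow> T \<subseteq> {1..n} \<Longrightarrow> \<not> contains_AP T k \<Longrightarrow> real (card T) < \<epsilon> * real n"
    using sparse_if_Szemeredi[OF assms(1) \<epsilon>] by blast
  have "real (card (AP_free_subsets k n)) \<le> 2 powr (\<eta> * real n)" if "n \<ge> n0" for n
  proof -
    have "1 \<le> z powr (- \<epsilon> * real n) * z ^ card T" if T: "T \<in> AP_free_subsets k n" for T
    proof -
      have "real (card T) < \<epsilon> * real n" using n0[OF \<open>n \<ge> n0\<close>] T unfolding AP_free_subsets_def by blast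
      then have "z powr (\<epsilon> * real n) \<le> z powr real (card T)" using z by (intro powr_mono') auto
      have "1 = z powr (- \<epsilon> * real n) * z powr (\<epsilon> * real n)" using z by (simp flip: powr_add)
      also have "\<dots> \<le> z powr (- \<epsilon> * real n) * z powr real (card T)"
        using \<open>z powr (\<epsilon> * real n) \<le> z powr real (card T)\<close> by (intro mult_left_mono) auto
      finally show ?thesis using z by (simp add: powr_realpow)
    qed
    then have "(\<Sum>T\<in>AP_free_subsets k n. 1) \<le> (\<Sum>T\<in>AP_free_subsets k n. z powr (- \<epsilon> * real n) * z ^ card T)"
      by (rule sum_mono)
    also have "\<dots> \<le> (\<Sum>T\<in>Pow {1..n}. z powr (- \<epsilon> * real n) * z ^ card T)"
      using z by (intro sum_mono2) (auto simp: AP_free_subsets_def)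
    also have "\<dots> = z powr (- \<epsilon> * real n) * (1 + z) ^ n"
      using sum_Pow_power_card[of "{1..n}" z] by (simp flip: sum_distrib_left)
    also have "z powr (- \<epsilon> * real n) = (z powr (- \<epsilon>)) ^ n" using z by (simp add: powr_powr flip: powr_realpow)
    also have "(z powr (- \<epsilon>)) ^ n * (1 + z) ^ n \<le> (2 powr (\<eta> / 2)) ^ n * (2 powr (\<eta> / 2)) ^ n"
      using z \<epsilon>z by (intro mult_mono power_mono) auto
    also have "\<dots> = 2 powr (\<eta> * real n)" by (simp add: powr_powr flip: powr_realpow powr_add)
    finally show ?thesis by simp
  qed
  then show ?thesis by blast
qed

section \<open>Binary prefixes of numbers without long progressions\<close>

definition Erdos_level :: "nat \<Rightarrow> real set" where
  "Erdos_level k = {x \<in> {0..<1}. \<not> contains_AP (one_positions x) k}"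

lemma Erdos_set_levels: "Erdos_set = (\<Union>k. Erdos_level k)"
proof -
  have "contains_AP A 0" for A unfolding contains_AP_def by auto
  then show ?thesis
    unfolding Erdos_set_def Erdosian_def arbitrarily_long_APs_def Erdos_level_def
    by (auto simp: Suc_le_eq) (metis neq0_conv)
qed

lemma Erdos_level_mono: "j \<le> k \<Longrightarrow> Erdos_level j \<subseteq> Erdos_level k"
  unfolding Erdos_level_def using contains_AP_mono by blast

definition level_prefixes :: "nat \<Rightarrow> nat \<Rightarrow> int set" where
  "level_prefixes k n = (\<lambda>x. \<lfloor>2 ^ n * x\<rfloor>) ` Erdos_level k"

text \<open>The integer part of \<open>2 ^ n * x\<close> is the sum of \<open>2 ^ (n - i)\<close>
  over the positions \<open>i\<close> up to \<open>n\<close> with digit 1, and these positions form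
  an AP-free subset of \<open>{1..n}\<close>.\<close>

lemma level_prefixes:
  shows "finite (level_prefixes k n)" (is ?A)
    and "card (level_prefixes k n) \<le> card (AP_free_subsets k n)" (is ?B)
proof -
  have "level_prefixes k n \<subseteq> (\<lambda>T. \<Sum>i\<in>T. 2 ^ (n - i)) ` AP_free_subsets k n"
    unfolding level_prefixes_def
  proof (rule image_subsetI)
    fix x assume "x \<in> Erdos_level k"
    then have x: "x \<in> {0..<1}" and free: "\<not> contains_AP (one_positions x) k" by (auto simp: Erdos_level_def)
    define b where "b = binary_digits x"
    define T where "T = one_positions x \<inter> {1..n}"
    have bexp: "binary_expansion x b" unfolding b_def by (rule binary_digits_expansion[OF x])
    have b01: "b i = 0 \<or> b i = 1" if "i \<ge> 1" for i
      using bexp that by (auto simp: binary_expansion_def PiE_iff)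
    have "\<lfloor>2 ^ n * x\<rfloor> = (\<Sum>i<n. int (b (Suc i)) * 2 ^ (n - Suc i))"
      by (rule binary_expansion_floor[OF bexp])
    also have "\<dots> = (\<Sum>i\<in>{1..n}. int (b i) * 2 ^ (n - i))"
      by (rule sum.reindex_bij_witness[of _ "\<lambda>i. i - 1" Suc]) auto
    also have "\<dots> = (\<Sum>i\<in>T. int (b i) * 2 ^ (n - i))"
    proof (intro sum.mono_neutral_right ballI)
      fix i assume "i \<in> {1..n} - T"
      then have "b i = 0" using b01[of i] by (auto simp: T_def one_positions_def b_def)
      then show "int (b i) * 2 ^ (n - i) = 0" by simp
    qed (auto simp: T_def)
    also have "\<dots> = (\<Sum>i\<in>T. 2 ^ (n - i))"
      by (intro sum.cong) (auto simp: T_def one_positions_def b_def)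
    finally have "\<lfloor>2 ^ n * x\<rfloor> = (\<Sum>i\<in>T. 2 ^ (n - i))" .
    moreover have "T \<in> AP_free_subsets k n"
      using free contains_AP_mono[of T k "one_positions x" k] unfolding AP_free_subsets_def T_def by blast
    ultimately show "\<lfloor>2 ^ n * x\<rfloor> \<in> (\<lambda>T. \<Sum>i\<in>T. 2 ^ (n - i)) ` AP_free_subsets k n" by blast
  qed
  note sub = this
  show ?A using finite_subset[OF sub] finite_AP_free_subsets by blast
  have "card (level_prefixes k n) \<le> card ((\<lambda>T. \<Sum>i\<in>T. 2 ^ (n - i) :: int) ` AP_free_subsets k n)"
    using sub finite_AP_free_subsets by (intro card_mono) auto
  also have "\<dots> \<le> card (AP_free_subsets k n)" by (rule card_image_le[OF finite_AP_free_subsets])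
  finally show ?B .
qed

lemma Erdos_level_prefix:
  assumes "x \<in> Erdos_level k"
  obtains m where "m \<in> level_prefixes k n" "of_int m / 2 ^ n \<le> x" "x \<le> of_int m / 2 ^ n + 1 / 2 ^ n"
proof (rule that)
  show "\<lfloor>2 ^ n * x\<rfloor> \<in> level_prefixes k n" using assms by (auto simp: level_prefixes_def)
  have "of_int \<lfloor>2 ^ n * x\<rfloor> \<le> 2 ^ n * x" "2 ^ n * x \<le> of_int \<lfloor>2 ^ n * x\<rfloor> + 1" by linarith+
  then show "of_int \<lfloor>2 ^ n * x\<rfloor> / 2 ^ n \<le> x" "x \<le> of_int \<lfloor>2 ^ n * x\<rfloor> / 2 ^ n + 1 / 2 ^ n"
    by (simp_all add: field_simps)
qed

lemma few_level_prefixes: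
  assumes "Szemeredi_statement" "\<eta> > 0"
  shows "\<exists>n0. \<forall>n\<ge>n0. real (card (level_prefixes k n)) \<le> 2 powr (\<eta> * real n)"
  using few_AP_free_subsets[OF assms, of k] level_prefixes(2)[of k]
  by (meson of_nat_le_iff order_trans)

section \<open>Smallness of the Erdos set and of its sums\<close>

lemma two_powr_small:
  assumes "s > 0" "e > 0"
  shows "\<exists>n0. \<forall>n\<ge>n0. 2 powr (- s * real n) \<le> e"
proof -
  have "2 powr (- s) < 2 powr 0" using assms by (intro powr_less_mono) auto
  then have "2 powr (- s) < 1" by simp
  then have "(\<lambda>n. (2 powr (- s)) ^ n) \<longlonglongrightarrow> 0" by (intro LIMSEQ_realpow_zero) auto
  then have "\<forall>\<^sub>F n in sequentially. (2 powr (- s)) ^ n < e" using assms(2) by (rule order_tendstoD)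
  then obtain n0 where "\<And>n. n \<ge> n0 \<Longrightarrow> (2 powr (- s)) ^ n < e"
    unfolding eventually_sequentially by blast
  then show ?thesis
    by (intro exI[of _ n0]) (auto simp: powr_powr less_imp_le simp flip: powr_realpow)
qed

text \<open>At most \<open>2 powr (n / 6)\<close> prefixes per variable give at most
  \<open>2 powr (n / 2)\<close> triples. Each triple confines \<open>a + b * c\<close> to an
  interval of length \<open>3 / 2 ^ n\<close>, so the total length tends to 0.\<close>

lemma negligible_Erdos_level_sums:
  assumes "Szemeredi_statement"
  shows "negligible {a + b * c | a b c. a \<in> Erdos_level k \<and> b \<in> Erdos_level k \<and> c \<in> Erdos_level k}"
    (is "negligible ?X")
  unfolding negligible_outer_le
proof (intro allI impI)
  fix e :: real assume "e > 0"
  obtain n1 where n1: "\<And>n. n \<ge> n1 \<Longrightarrow> real (card (level_prefixes k n)) \<le> 2 powr (1 / 6 * real n)"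
    using few_level_prefixes[OF assms, of "1 / 6" k] by auto
  obtain n2 where n2: "\<And>n. n \<ge> n2 \<Longrightarrow> 2 powr (- (1 / 2) * real n) \<le> e / 3"
    using two_powr_small[of "1 / 2" "e / 3"] \<open>e > 0\<close> by auto
  define n where "n = max n1 n2"
  define V where "V = level_prefixes k n"
  have finV: "finite V" unfolding V_def by (rule level_prefixes)
  define I where "I = (\<lambda>(p, q, r). {(of_int p / 2 ^ n + (of_int q / 2 ^ n) * (of_int r / 2 ^ n)) ..
    (of_int p / 2 ^ n + (of_int q / 2 ^ n) * (of_int r / 2 ^ n)) + 3 / 2 ^ n :: real})"
  define T where "T = (\<Union>t\<in>V \<times> V \<times> V. I t)"
  have "?X \<subseteq> T"
  proof
    fix x assume "x \<in> ?X"
    then obtain a b c where x: "x = a + b * c" and abc: "a \<in> Erdos_level k" "b \<in> Erdos_level k" "c \<in> Erdos_level k"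
      by blast
    obtain p where p: "p \<in> V" "of_int p / 2 ^ n \<le> a" "a \<le> of_int p / 2 ^ n + 1 / 2 ^ n"
      using Erdos_level_prefix[OF abc(1)] unfolding V_def by blast
    obtain q where q: "q \<in> V" "of_int q / 2 ^ n \<le> b" "b \<le> of_int q / 2 ^ n + 1 / 2 ^ n"
      using Erdos_level_prefix[OF abc(2)] unfolding V_def by blast
    obtain r where r: "r \<in> V" "of_int r / 2 ^ n \<le> c" "c \<le> of_int r / 2 ^ n + 1 / 2 ^ n"
      using Erdos_level_prefix[OF abc(3)] unfolding V_def by blast
    have pos: "m \<ge> 0" if "m \<in> V" for m
      using that unfolding V_def level_prefixes_def Erdos_level_def by auto
    define q' r' :: real where "q' = of_int q / 2 ^ n" and "r' = of_int r / 2 ^ n"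
    have q'r': "0 \<le> q'" "0 \<le> r'" using pos q(1) r(1) by (auto simp: q'_def r'_def)
    have bc: "b < 1" "c < 1" "0 \<le> b" "0 \<le> c" using abc by (auto simp: Erdos_level_def)
    have q'1: "q' \<le> 1" using q(2) bc unfolding q'_def by linarith
    have "q' * r' \<le> b * c" using q r q'r' bc by (intro mult_mono) (auto simp: q'_def r'_def)
    \<comment> \<open>Rounding \<open>b\<close> and \<open>c\<close> down costs
      \<open>1 / 2 ^ n\<close> each; rounding \<open>a\<close> costs another
      \<open>1 / 2 ^ n\<close>, hence the length of the intervals \<open>I\<close>.\<close>
    moreover have "b * c \<le> q' * r' + 2 / 2 ^ n"
    proof -
      have "b * c - q' * r' = (b - q') * c + q' * (c - r')" by (simp add: algebra_simps)
      also have "(b - q') * c \<le> (1 / 2 ^ n) * 1" using q bc by (intro mult_mono) (auto simp: q'_def)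
      also have "q' * (c - r') \<le> 1 * (1 / 2 ^ n)" using q'1 r q'r' by (intro mult_mono) (auto simp: r'_def)
      finally show ?thesis by simp
    qed
    moreover have "3 / 2 ^ n = 1 / 2 ^ n + 2 / (2 ^ n :: real)" by (simp flip: add_divide_distrib)
    ultimately have "x \<in> I (p, q, r)" using p(2,3)
      unfolding x I_def prod.case q'_def[symmetric] r'_def[symmetric] atLeastAtMost_iff
      by (intro conjI; linarith)
    then show "x \<in> T" unfolding T_def using p(1) q(1) r(1) by blast
  qed
  moreover have "T \<in> lmeasurable"
    unfolding T_def I_def using finV by (intro fmeasurable.finite_UN) auto
  moreover have "measure lebesgue T \<le> e"
  proof -
    have "measure lebesgue T \<le> (\<Sum>t\<in>V \<times> V \<times> V. measure lebesgue (I t))"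
      unfolding T_def using finV by (intro measure_UNION_le) (auto simp: I_def)
    also have "\<dots> = (\<Sum>t\<in>V \<times> V \<times> V. 3 / 2 ^ n)" by (intro sum.cong) (auto simp: I_def)
    also have "\<dots> = real (card V) ^ 3 * (3 / 2 ^ n)"
      by (simp add: card_cartesian_product power3_eq_cube)
    also have "\<dots> \<le> (2 powr (1 / 6 * real n)) ^ 3 * (3 / 2 ^ n)"
      using n1[of n] unfolding V_def n_def by (intro mult_right_mono power_mono) auto
    also have "\<dots> = 3 * 2 powr (- (1 / 2) * real n)"
    proof -
      have "(2 powr (1 / 6 * real n)) ^ 3 = 2 powr (1 / 2 * real n)"
        by (simp add: powr_powr flip: powr_realpow)
      moreover have "3 / 2 ^ n = 3 * 2 powr (- real n)"
        by (simp add: powr_minus_divide powr_realpow)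
      moreover have "2 powr (1 / 2 * real n) * 2 powr (- real n) = 2 powr (- (1 / 2) * real n)"
        by (simp flip: powr_add)
      ultimately show ?thesis by simp
    qed
    also have "\<dots> \<le> e" using n2[of n] unfolding n_def by simp
    finally show ?thesis .
  qed
  ultimately show "\<exists>T. ?X \<subseteq> T \<and> T \<in> lmeasurable \<and> measure lebesgue T \<le> e" by blast
qed

text \<open>The levels increase, so any three elements share one level. The sum set is thus
  contained in a countable union of null sets.\<close>

lemma no_interval_if_Szemeredi:
  assumes "Szemeredi_statement" "u < v"
  shows "\<not> {u<..<v} \<subseteq> {a + b * c | a b c. a \<in> Erdos_set \<and> b \<in> Erdos_set \<and> c \<in> Erdos_set}"
proof
  define X where "X = (\<lambda>k. {a + b * c | a b c. a \<in> Erdos_level k \<and> b \<in> Erdos_level k \<and> c \<in> Erdos_level k})"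
  assume sub: "{u<..<v} \<subseteq> {a + b * c | a b c. a \<in> Erdos_set \<and> b \<in> Erdos_set \<and> c \<in> Erdos_set}"
  have "{u<..<v} \<subseteq> (\<Union>k. X k)"
  proof
    fix x assume "x \<in> {u<..<v}"
    then obtain a b c i j l where x: "x = a + b * c" "a \<in> Erdos_level i" "b \<in> Erdos_level j" "c \<in> Erdos_level l"
      using sub unfolding Erdos_set_levels by blast
    then have "x \<in> X (max i (max j l))"
      unfolding X_def using Erdos_level_mono[of _ "max i (max j l)"]
      by (smt (verit, best) max.cobounded1 max.cobounded2 max.coboundedI2 mem_Collect_eq subsetD)
    then show "x \<in> (\<Union>k. X k)" by blast
  qed
  moreover have "negligible (\<Union>k. X k)"
    unfolding X_def by (intro negligible_countable_Union) (use negligible_Erdos_level_sums[OF assms(1)] in auto)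
  ultimately have "negligible {u<..<v}" by (rule negligible_subset[rotated])
  then show False using assms(2) open_not_negligible[of "{u<..<v}"] by auto
qed

text \<open>Level \<open>k\<close> is covered at its own scale \<open>n k\<close>, fine enough for a
  cost of at most \<open>e / 2 ^ (k + 1)\<close>. The covers of all levels together then cost at
  most \<open>e\<close>.\<close>

lemma Hausdorff_dim_Erdos_set_if_Szemeredi:
  assumes "Szemeredi_statement"
  shows "Hausdorff_dim Erdos_set = 0"
proof -
  have pre: "Hausdorff_premeasure s \<delta> Erdos_set \<le> ennreal e"
    if "s > 0" "\<delta> > 0" "e > 0" for s \<delta> e :: real
  proof -
    \<comment> \<open>The prefix count grows at most like \<open>2 powr (s / 2 * n)\<close>, while
      each interval weighs \<open>2 powr (- s * n)\<close>.\<close>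
    have "\<exists>n. real (card (level_prefixes k n)) * (1 / 2 ^ n) powr s \<le> e * (1 / 2) ^ Suc k \<and> 1 / 2 ^ n \<le> \<delta>" for k
    proof -
      obtain n1 where n1: "\<And>n. n \<ge> n1 \<Longrightarrow> real (card (level_prefixes k n)) \<le> 2 powr (s / 2 * real n)"
        using few_level_prefixes[OF assms, of "s / 2" k] \<open>s > 0\<close> by auto
      obtain n2 where n2: "\<And>n. n \<ge> n2 \<Longrightarrow> 2 powr (- (s / 2) * real n) \<le> e * (1 / 2) ^ Suc k"
        using two_powr_small[of "s / 2" "e * (1 / 2) ^ Suc k"] \<open>s > 0\<close> \<open>e > 0\<close> by auto
      obtain n3 where n3: "\<And>n. n \<ge> n3 \<Longrightarrow> 2 powr (- 1 * real n) \<le> \<delta>"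
        using two_powr_small[of 1 \<delta>] \<open>\<delta> > 0\<close> by auto
      define n where "n = max n1 (max n2 n3)"
      have le: "n1 \<le> n" "n2 \<le> n" "n3 \<le> n" unfolding n_def by linarith+
      have inv: "1 / 2 ^ n = 2 powr (- real n)" by (simp add: powr_minus_divide powr_realpow)
      have "real (card (level_prefixes k n)) * (1 / 2 ^ n) powr s \<le> 2 powr (s / 2 * real n) * 2 powr (- real n * s)"
        unfolding inv powr_powr using n1[OF le(1)] by (intro mult_right_mono) auto
      also have "\<dots> = 2 powr (- (s / 2) * real n)" by (simp add: algebra_simps flip: powr_add)
      also have "\<dots> \<le> e * (1 / 2) ^ Suc k" by (rule n2[OF le(2)])
      finally show ?thesis using n3[OF le(3)] inv by (intro exI[of _ n]) simp
    qed
    then obtain n where n: "\<And>k. real (card (level_prefixes k (n k))) * (1 / 2 ^ n k) powr s \<le> e * (1 / 2) ^ Suc k"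
      "\<And>k. 1 / 2 ^ n k \<le> \<delta>" by metis
    define V where "V = (\<lambda>k. level_prefixes k (n k))"
    have "\<exists>h. bij_betw h {..<card (V k)} (V k)" for k
      unfolding V_def lessThan_atLeast0 by (rule ex_bij_betw_nat_finite[OF level_prefixes(1)])
    then obtain h where h: "\<And>k. bij_betw (h k) {..<card (V k)} (V k)" by metis
    \<comment> \<open>Indices beyond the number of prefixes give the empty set, of weight 0, so that
      the double family can be enumerated by \<open>prod_decode\<close>.\<close>
    define J where "J = (\<lambda>k i. if i < card (V k) then {of_int (h k i) / 2 ^ n k .. of_int (h k i) / 2 ^ n k + 1 / 2 ^ n k :: real} else {})"
    define U where "U = (\<lambda>p. case prod_decode p of (k, i) \<Rightarrow> J k i)"
    have diamJ: "diameter (J k i) = (if i < card (V k) then 1 / 2 ^ n k else 0)" for k i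
      by (simp add: J_def diameter_closed_interval)
    have "Erdos_set \<subseteq> (\<Union>p. U p)"
    proof
      fix x assume "x \<in> Erdos_set"
      then obtain k where "x \<in> Erdos_level k" unfolding Erdos_set_levels by blast
      then obtain m where m: "m \<in> V k" "of_int m / 2 ^ n k \<le> x" "x \<le> of_int m / 2 ^ n k + 1 / 2 ^ n k"
        using Erdos_level_prefix unfolding V_def by blast
      have "m \<in> h k ` {..<card (V k)}" using h[of k] m(1) unfolding bij_betw_def by blast
      then obtain i where "i < card (V k)" "h k i = m" by blast
      then have "x \<in> J k i" using m by (simp add: J_def)
      then have "x \<in> U (prod_encode (k, i))" by (simp add: U_def)
      then show "x \<in> (\<Union>p. U p)" by blast
    qed
    moreover have "bounded (U p) \<and> diameter (U p) \<le> \<delta>" for p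
    proof (cases "prod_decode p")
      case (Pair k i)
      have "bounded (J k i)" by (simp add: J_def)
      then show ?thesis using n(2)[of k] \<open>\<delta> > 0\<close> Pair by (simp add: U_def diamJ)
    qed
    ultimately have "Hausdorff_premeasure s \<delta> Erdos_set \<le> (\<Sum>p. diam_powr s (U p))"
      unfolding Hausdorff_premeasure_def by (intro Inf_lower CollectI exI[of _ U]) simp
    also have "\<dots> = (\<Sum>k. \<Sum>i. diam_powr s (J k i))"
    proof -
      define f where "f = (\<lambda>(k, i). diam_powr s (J k i))"
      have "(\<Sum>p. f (prod_decode p)) = (\<Sum>k. \<Sum>i. f (k, i))"
        by (rule suminf_ennreal_2dimen) (rule refl)
      moreover have "f (prod_decode p) = diam_powr s (U p)" for p
        by (cases "prod_decode p") (simp add: U_def f_def)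
      moreover have "f (k, i) = diam_powr s (J k i)" for k i
        unfolding f_def by (rule prod.case)
      ultimately show ?thesis by (simp only:)
    qed
    also have "\<dots> \<le> (\<Sum>k. ennreal (e * (1 / 2) ^ Suc k))"
    proof (intro suminf_le summableI)
      fix k
      have "(\<Sum>i. diam_powr s (J k i)) = (\<Sum>i<card (V k). diam_powr s (J k i))"
        by (intro suminf_finite) (auto simp: diam_powr_def J_def)
      also have "\<dots> = (\<Sum>i<card (V k). ennreal ((1 / 2 ^ n k) powr s))"
        using \<open>s > 0\<close> diamJ by (intro sum.cong) (auto simp: diam_powr_def J_def)
      also have "\<dots> = ennreal (real (card (V k)) * (1 / 2 ^ n k) powr s)"
        by (simp add: ennreal_mult ennreal_of_nat_eq_real_of_nat)
      also have "\<dots> \<le> ennreal (e * (1 / 2) ^ Suc k)" using n(1)[of k] unfolding V_def by (intro ennreal_leI)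
      finally show "(\<Sum>i. diam_powr s (J k i)) \<le> ennreal (e * (1 / 2) ^ Suc k)" .
    qed
    also have "\<dots> = ennreal e"
    proof (rule suminf_ennreal_eq)
      show "(\<lambda>k. e * (1 / 2) ^ Suc k) sums e"
        using sums_mult[OF power_half_series, of e] by simp
    qed (use \<open>e > 0\<close> in auto)
    finally show ?thesis .
  qed
  have "Hausdorff_dim Erdos_set \<le> ennreal s" if "s > 0" for s
  proof -
    have "Hausdorff_premeasure s \<delta> Erdos_set = 0" if \<delta>: "\<delta> > 0" for \<delta>
    proof -
      have "Hausdorff_premeasure s \<delta> Erdos_set \<le> 0"
      proof (rule ennreal_le_epsilon)
        fix e :: real assume "e > 0"
        from pre[OF \<open>s > 0\<close> \<delta> this] show "Hausdorff_premeasure s \<delta> Erdos_set \<le> 0 + ennreal e"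
          by (simp only: add_0)
      qed
      then show ?thesis by simp
    qed
    then have "Hausdorff_measure s Erdos_set = 0"
      unfolding Hausdorff_measure_def by (simp cong: SUP_cong_simp)
    then show ?thesis
      unfolding Hausdorff_dim_def using that by (intro Inf_lower CollectI exI[of _ s]) simp
  qed
  note le = this
  have "Hausdorff_dim Erdos_set \<le> 0"
  proof (rule ennreal_le_epsilon)
    fix e :: real assume "e > 0"
    from le[OF this] show "Hausdorff_dim Erdos_set \<le> 0 + ennreal e" by (simp only: add_0)
  qed
  then show ?thesis by simp
qed

section \<open>Restricted base 4 expansions\<close>

text \<open>Base 4 treats two consecutive binary digits as one unit; the gain over square root
  cancellation comes from such pairs. Positions outside \<open>Q\<close> carry the digit 0.\<close>

fun digit_sums :: "nat set \<Rightarrow> nat \<Rightarrow> real set" where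
  "digit_sums Q 0 = {0}"
| "digit_sums Q (Suc n) =
    (if Suc n \<in> Q then (\<lambda>(v, d). v + real d / 4 ^ Suc n) ` (digit_sums Q n \<times> {..<4}) else digit_sums Q n)"

text \<open>Closed cells at every level replace infinite digit series; the set is then visibly an
  intersection of closed sets.\<close>

definition digit_expansions :: "nat set \<Rightarrow> real set" where
  "digit_expansions Q = {y. \<forall>n. \<exists>p\<in>digit_sums Q n. p \<le> y \<and> y \<le> p + 1 / 4 ^ n}"

lemma Int_Suc: "Q \<inter> {1..Suc n} = (if Suc n \<in> Q then insert (Suc n) (Q \<inter> {1..n}) else Q \<inter> {1..n})"
  by (auto simp: le_Suc_eq)

lemma card_Int_Suc: "card (Q \<inter> {1..Suc n}) = card (Q \<inter> {1..n}) + (if Suc n \<in> Q then 1 else 0)"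
  unfolding Int_Suc by simp

lemma finite_digit_sums: "finite (digit_sums Q n)"
  by (induction n) auto

lemma card_digit_sums: "card (digit_sums Q n) \<le> 4 ^ card (Q \<inter> {1..n})"
proof (induction n)
  case (Suc n)
  have "card ((\<lambda>(v, d). v + real d / 4 ^ Suc n) ` (digit_sums Q n \<times> {..<4})) \<le> card (digit_sums Q n \<times> {..<4::nat})"
    by (intro card_image_le finite_cartesian_product finite_digit_sums) simp
  also have "\<dots> \<le> 4 * 4 ^ card (Q \<inter> {1..n})" using Suc by (simp add: card_cartesian_product)
  finally have "card ((\<lambda>(v, d). v + real d / 4 ^ Suc n) ` (digit_sums Q n \<times> {..<4})) \<le> 4 ^ Suc (card (Q \<inter> {1..n}))"
    by simp
  then show ?case using Suc unfolding card_Int_Suc by simp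
qed simp

lemma zero_in_digit_sums: "0 \<in> digit_sums Q n"
  by (induction n) (auto intro!: image_eqI[of _ _ "(0, 0)"])

lemma digit_sums_nat:
  assumes "v \<in> digit_sums Q n"
  obtains z :: nat where "v = real z / 4 ^ n" "z < 4 ^ n"
proof -
  have "\<exists>z::nat. v = real z / 4 ^ n \<and> z < 4 ^ n"
    using assms
  proof (induction n arbitrary: v)
    case (Suc n)
    obtain w d where w: "w \<in> digit_sums Q n" "d < 4" "v = w + real d / 4 ^ Suc n"
      using Suc.prems by (cases "Suc n \<in> Q") (auto intro: that[of _ 0])
    obtain z where z: "w = real z / 4 ^ n" "z < 4 ^ n" using Suc.IH[OF w(1)] by blast
    have "4 * z + d < 4 ^ Suc n" using z w(2) by simp
    moreover have "v = real (4 * z + d) / 4 ^ Suc n" using w(3) z(1) by (simp add: field_simps)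
    ultimately show ?case by blast
  qed auto
  then show ?thesis using that by blast
qed

lemma digit_sums_mono: "m \<le> n \<Longrightarrow> digit_sums Q m \<subseteq> digit_sums Q n"
proof (induction n rule: nat_induct_at_least)
  case (Suc n)
  then show ?case by (force intro: image_eqI[where x = "(_, 0)"])
qed simp

text \<open>The digits after position \<open>n\<close> contribute at most
  \<open>3 / 4 ^ (n + 1) + ... + 3 / 4 ^ N\<close>. The exact value of this sum is what makes the
  induction close.\<close>

lemma digit_sums_prefix:
  assumes "v \<in> digit_sums Q N" "n \<le> N"
  shows "\<exists>p\<in>digit_sums Q n. p \<le> v \<and> v \<le> p + 1 / 4 ^ n - 1 / 4 ^ N"
  using assms(2,1)
proof (induction N arbitrary: v rule: nat_induct_at_least)
  case (Suc N)
  obtain w d where w: "w \<in> digit_sums Q N" "d < 4" "v = w + real d / 4 ^ Suc N"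
    using Suc.prems by (cases "Suc N \<in> Q") (auto intro: that[of _ 0])
  obtain p where p: "p \<in> digit_sums Q n" "p \<le> w" "w \<le> p + 1 / 4 ^ n - 1 / 4 ^ N"
    using Suc.IH[OF w(1)] by blast
  have "real d / 4 ^ Suc N \<le> 3 / 4 ^ Suc N" using w(2) by (intro divide_right_mono) auto
  moreover have "1 / 4 ^ N = 3 / 4 ^ Suc N + 1 / (4 ^ Suc N :: real)" by simp
  ultimately have "v \<le> p + 1 / 4 ^ n - 1 / 4 ^ Suc N" using p(3) w(3) by linarith
  moreover have "p \<le> v" using p(2) w(3) by (simp add: add_increasing2)
  ultimately show ?case using p(1) by blast
qed auto

lemma digit_sums_subset_expansions: "digit_sums Q N \<subseteq> digit_expansions Q"
proof
  fix v assume v: "v \<in> digit_sums Q N"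
  have "\<exists>p\<in>digit_sums Q n. p \<le> v \<and> v \<le> p + 1 / 4 ^ n" for n
  proof (cases "n \<le> N")
    case True
    obtain p where "p \<in> digit_sums Q n" "p \<le> v" "v \<le> p + 1 / 4 ^ n - 1 / 4 ^ N"
      using digit_sums_prefix[OF v True] by blast
    moreover have "v \<le> p + 1 / 4 ^ n"
      using \<open>v \<le> p + 1 / 4 ^ n - 1 / 4 ^ N\<close> by (rule order_trans) simp
    ultimately show ?thesis by blast
  next
    case False
    then show ?thesis using v digit_sums_mono[of N n Q] by (intro bexI[of _ v]) auto
  qed
  then show "v \<in> digit_expansions Q" unfolding digit_expansions_def by blast
qed

lemma digit_expansions_bounds:
  assumes "x \<in> digit_expansions Q"
  shows "0 \<le> x" "x \<le> 1"
proof -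
  have "\<exists>p\<in>digit_sums Q 0. p \<le> x \<and> x \<le> p + 1 / 4 ^ 0"
    using assms unfolding digit_expansions_def by blast
  then show "0 \<le> x" "x \<le> 1" by auto
qed

lemma compact_digit_expansions: "compact (digit_expansions Q)"
proof -
  have "digit_expansions Q = (\<Inter>n. \<Union>p\<in>digit_sums Q n. {p .. p + 1 / 4 ^ n})"
    unfolding digit_expansions_def by (auto simp: Bex_def)
  then have "closed (digit_expansions Q)"
    using finite_digit_sums by (auto intro!: closed_INT closed_UN)
  moreover have "digit_expansions Q \<subseteq> {0..1}" using digit_expansions_bounds by auto
  ultimately show ?thesis by (metis bounded_closed_interval bounded_subset compact_eq_bounded_closed)
qed

text \<open>A digit forced to be 0 confines \<open>4 ^ n * x\<close> to the first quarter of a unit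
  cell, with the right endpoint included.\<close>

lemma digit_expansions_zero_digit:
  assumes x: "x \<in> digit_expansions Q" and n: "Suc n \<notin> Q"
  obtains z :: nat where "real z \<le> 4 ^ n * x" "4 ^ n * x \<le> real z + 1 / 4" "z < 4 ^ n"
proof -
  obtain p where p: "p \<in> digit_sums Q (Suc n)" "p \<le> x" "x \<le> p + 1 / 4 ^ Suc n"
    using x unfolding digit_expansions_def by blast
  then have "p \<in> digit_sums Q n" using n by simp
  then obtain z where z: "p = real z / 4 ^ n" "z < 4 ^ n" by (rule digit_sums_nat)
  show ?thesis by (rule that[OF _ _ z(2)]) (use p z(1) in \<open>auto simp: field_simps\<close>)
qed

lemma not_contains_AP_finite: "finite A \<Longrightarrow> \<not> contains_AP A (Suc (card A))"
proof
  assume A: "finite A" and "contains_AP A (Suc (card A))"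
  then obtain a d where ad: "d > 0" "\<And>i. i < Suc (card A) \<Longrightarrow> a + i * d \<in> A"
    unfolding contains_AP_def by blast
  have "card ((\<lambda>i. a + i * d) ` {..<Suc (card A)}) \<le> card A"
    using A ad(2) by (intro card_mono) auto
  moreover have "inj_on (\<lambda>i. a + i * d) {..<Suc (card A)}" using ad(1) by (auto simp: inj_on_def)
  ultimately show False by (simp add: card_image)
qed

text \<open>The base 4 digit at \<open>q\<close> occupies the binary positions
  \<open>2 * q - 1\<close> and \<open>2 * q\<close>, so for nondyadic \<open>x\<close> the map
  \<open>p \<mapsto> (p + 1) div 2\<close> sends positions of ones into \<open>Q\<close>. Dyadic
  numbers have only finitely many ones and are treated apart, because their finite expansion need
  not be the one supported on \<open>Q\<close>.\<close>

lemma digit_expansions_subset_Erdos_set: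
  assumes "\<not> contains_AP Q K"
  shows "digit_expansions Q \<subseteq> Erdos_set"
proof
  fix x assume x: "x \<in> digit_expansions Q"
  \<comment> \<open>A missing position forces \<open>x < 1\<close>, as \<open>4 ^ m * x\<close>
    exceeds an integer below \<open>4 ^ m\<close> by at most 1/4.\<close>
  have "\<exists>n. Suc n \<notin> Q"
  proof (rule ccontr)
    assume "\<nexists>n. Suc n \<notin> Q"
    then have "contains_AP Q K" unfolding contains_AP_def by (intro exI[of _ 1]) auto
    then show False using assms by blast
  qed
  then obtain m where m: "Suc m \<notin> Q" by blast
  obtain z where "4 ^ m * x \<le> real z + 1 / 4" "z < 4 ^ m" by (rule digit_expansions_zero_digit[OF x m])
  moreover from this have "real (Suc z) \<le> real (4 ^ m)" by (intro of_nat_mono) simp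
  ultimately have "4 ^ m * x < 4 ^ m * 1"
    unfolding mult_1_right of_nat_power of_nat_numeral of_nat_Suc by linarith
  then have "x < 1" by (rule mult_left_less_imp_less) simp
  then have x01: "x \<in> {0..<1}" using digit_expansions_bounds[OF x] by simp
  have "\<exists>k\<ge>1. \<not> contains_AP (one_positions x) k"
  proof (cases "dyadic_rational x")
    case True
    then have "finite (one_positions x)"
      using binary_digits_expansion[OF x01] unfolding binary_expansion_def one_positions_def by blast
    then show ?thesis using not_contains_AP_finite by (intro exI[of _ "Suc (card (one_positions x))"]) auto
  next
    case False
    have sub: "(p + 1) div 2 \<in> Q" if p: "p \<in> one_positions x" for p
    proof (rule ccontr)
      assume notin: "(p + 1) div 2 \<notin> Q"
      have "p \<ge> 1" and digit: "binary_digits x p = 1" using p unfolding one_positions_def by auto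
      define n where "n = (p - 1) div 2"
      have pn: "p = 2 * n + 1 \<or> p = 2 * n + 2" and "(p + 1) div 2 = Suc n"
        using \<open>p \<ge> 1\<close> unfolding n_def by presburger+
      then obtain z where z: "real z \<le> 4 ^ n * x" "4 ^ n * x \<le> real z + 1 / 4"
        using digit_expansions_zero_digit[OF x, of n] notin by auto
      \<comment> \<open>The endpoint of the cell, at which the binary digit could be 1, is a dyadic
        number.\<close>
      have "4 ^ n * x \<noteq> real z + 1 / 4"
      proof
        assume "4 ^ n * x = real z + 1 / 4"
        then have "x = of_int (4 * int z + 1) / (4 * 4 ^ n)" by (simp add: field_simps)
        also have "4 * 4 ^ n = (2 ^ (2 * n + 2) :: real)" by (simp add: power_mult)
        finally have "x = of_int (4 * int z + 1) / 2 ^ (2 * n + 2)" .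
        then show False using False unfolding dyadic_rational_def by blast
      qed
      with z have z': "4 ^ n * x < real z + 1 / 4" by simp
      have "\<lfloor>2 ^ p * x\<rfloor> mod 2 = 0"
      proof (cases "p = 2 * n + 1")
        case True
        then have "2 ^ p * x = 2 * (4 ^ n * x)" by (simp add: power_mult)
        then have "\<lfloor>2 ^ p * x\<rfloor> = 2 * int z"
          unfolding floor_eq_iff of_int_mult of_int_numeral of_int_of_nat_eq using z z' by linarith
        then show ?thesis by simp
      next
        case False
        then have "2 ^ p * x = 4 * (4 ^ n * x)" using pn by (simp add: power_mult)
        then have "\<lfloor>2 ^ p * x\<rfloor> = 4 * int z"
          unfolding floor_eq_iff of_int_mult of_int_numeral of_int_of_nat_eq using z z' by linarith
        then show ?thesis by simp
      qed
      then show False using digit binary_digits_eq[OF x01 \<open>p \<ge> 1\<close>] by simp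
    qed
    have "\<not> contains_AP (one_positions x) (2 * K)"
    proof
      assume "contains_AP (one_positions x) (2 * K)"
      then obtain a d where ad: "d > 0" "\<And>i. i < 2 * K \<Longrightarrow> a + i * d \<in> one_positions x"
        unfolding contains_AP_def by blast
      \<comment> \<open>Only every second term is used: the difference \<open>2 * d\<close> is even,
        so halving turns the terms into a progression with difference \<open>d\<close>.\<close>
      have "(a + 1) div 2 + i * d \<in> Q" if "i < K" for i
      proof -
        have "(a + 2 * i * d + 1) div 2 \<in> Q" using ad(2)[of "2 * i"] that by (intro sub) simp
        moreover have "(a + 2 * i * d + 1) div 2 = (a + 1) div 2 + i * d" by simp
        ultimately show ?thesis by simp
      qed
      then show False using assms ad(1) unfolding contains_AP_def by blast
    qed
    then have "\<not> contains_AP (one_positions x) (max 1 (2 * K))"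
      using contains_AP_mono[of "one_positions x" "max 1 (2 * K)" "one_positions x" "2 * K"] by auto
    then show ?thesis by (metis max.cobounded1)
  qed
  then show "x \<in> Erdos_set"
    using x01 unfolding Erdos_set_def Erdosian_def arbitrarily_long_APs_def by blast
qed

lemma digit_sums_complement:
  "z < 4 ^ n \<Longrightarrow> \<exists>a\<in>digit_sums Q n. \<exists>b\<in>digit_sums (- Q) n. real z / 4 ^ n = a + b"
proof (induction n arbitrary: z)
  case (Suc n)
  define d where "d = z mod 4"
  have z: "z = 4 * (z div 4) + d" "d < 4" by (auto simp: d_def)
  have "z div 4 < 4 ^ n" using Suc.prems by (simp add: less_mult_imp_div_less mult.commute)
  from Suc.IH[OF this] obtain a b where ab: "a \<in> digit_sums Q n" "b \<in> digit_sums (- Q) n"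
    "real (z div 4) / 4 ^ n = a + b" by blast
  have "real z = 4 * real (z div 4) + real d" using z(1) by linarith
  then have "real z / 4 ^ Suc n = real (z div 4) / 4 ^ n + real d / 4 ^ Suc n"
    by (simp add: field_simps)
  then have eq: "real z / 4 ^ Suc n = a + b + real d / 4 ^ Suc n" using ab(3) by simp
  have *: "v + real d / 4 ^ Suc n \<in> (\<lambda>(v, d). v + real d / 4 ^ Suc n) ` (digit_sums R n \<times> {..<4})"
    if "v \<in> digit_sums R n" for v R
    using that z(2) by (intro image_eqI[of _ _ "(v, d)"]) auto
  show ?case
  proof (cases "Suc n \<in> Q")
    case True
    then show ?thesis using ab *[OF ab(1)] eq
      by (intro bexI[of _ "a + real d / 4 ^ Suc n"] bexI[of _ b]) auto
  next
    case False
    then show ?thesis using ab *[OF ab(2)] eq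
      by (intro bexI[of _ a] bexI[of _ "b + real d / 4 ^ Suc n"]) auto
  qed
qed auto

text \<open>Finite digit sums split according to \<open>Q\<close> and approximate \<open>x\<close>
  to within \<open>(1 / 4) ^ n\<close> for every \<open>n\<close>. By compactness the distance from
  \<open>x\<close> to the sums \<open>a + b\<close> attains its infimum 0.\<close>

lemma digit_expansions_complement:
  assumes "x \<in> {0..<1}"
  shows "\<exists>a\<in>digit_expansions Q. \<exists>b\<in>digit_expansions (- Q). x = a + b"
proof -
  define D where "D = digit_expansions Q \<times> digit_expansions (- Q)"
  have "compact D" unfolding D_def by (intro compact_Times compact_digit_expansions)
  moreover have "0 \<in> digit_expansions R" for R
    using zero_in_digit_sums digit_sums_subset_expansions by blast
  then have "D \<noteq> {}" unfolding D_def by blast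
  moreover have "continuous_on D (\<lambda>p. \<bar>x - (fst p + snd p)\<bar>)" by (intro continuous_intros)
  ultimately obtain p where p: "p \<in> D" and min: "\<And>q. q \<in> D \<Longrightarrow> \<bar>x - (fst p + snd p)\<bar> \<le> \<bar>x - (fst q + snd q)\<bar>"
    using continuous_attains_inf[of D "\<lambda>p. \<bar>x - (fst p + snd p)\<bar>"] by blast
  have "\<bar>x - (fst p + snd p)\<bar> \<le> (1 / 4) ^ n" for n
  proof -
    define z where "z = nat \<lfloor>4 ^ n * x\<rfloor>"
    have fl: "0 \<le> \<lfloor>4 ^ n * x\<rfloor>" using assms by simp
    have "4 ^ n * x < 4 ^ n" using assms by simp
    then have "\<lfloor>4 ^ n * x\<rfloor> < 4 ^ n" by (simp add: floor_less_iff)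
    then have "z < 4 ^ n" using fl unfolding z_def by (simp add: nat_less_iff)
    then obtain a b where ab: "a \<in> digit_sums Q n" "b \<in> digit_sums (- Q) n" "real z / 4 ^ n = a + b"
      using digit_sums_complement by blast
    then have "(a, b) \<in> D" unfolding D_def using digit_sums_subset_expansions by blast
    from min[OF this] have "\<bar>x - (fst p + snd p)\<bar> \<le> \<bar>x - real z / 4 ^ n\<bar>" using ab(3) by simp
    also have "\<dots> \<le> (1 / 4) ^ n"
    proof -
      have "real z = of_int \<lfloor>4 ^ n * x\<rfloor>" using fl unfolding z_def by simp
      then have "real z \<le> 4 ^ n * x" "4 ^ n * x \<le> real z + 1" by linarith+
      then have "real z / 4 ^ n \<le> x" "x \<le> real z / 4 ^ n + (1 / 4) ^ n"
        by (auto simp: field_simps power_one_over)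
      then show ?thesis by simp
    qed
    finally show ?thesis .
  qed
  then have "\<bar>x - (fst p + snd p)\<bar> \<le> 0"
    by (intro LIMSEQ_le_const[OF LIMSEQ_realpow_zero[of "1 / 4"]]) auto
  then show ?thesis using p unfolding D_def by (intro bexI[of _ "fst p"] bexI[of _ "snd p"]) auto
qed

section \<open>Hausdorff dimension\<close>

lemma one_fourth_power_bracket:
  assumes "0 < d" "d \<le> 1"
  obtains n where "d \<le> 1 / 4 ^ n" "1 / 4 ^ Suc n < (d :: real)"
proof -
  obtain m where m: "(1 / 4) ^ m < d" using real_arch_pow_inv[of d "1 / 4"] assms by auto
  define k where "k = (LEAST n. (1 / 4) ^ n < d)"
  have k: "(1 / 4) ^ k < d" unfolding k_def using m by (rule LeastI)
  then obtain n where n: "k = Suc n" using assms by (cases k) auto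
  have "\<not> (1 / 4) ^ n < d" using not_less_Least[of n "\<lambda>n. (1 / 4) ^ n < d"] n k_def by simp
  with k show ?thesis by (intro that[of n]) (auto simp: n power_one_over)
qed

text \<open>A cheap cover of the Erdos set by the \<open>U i\<close> would also cover the digit
  expansions on \<open>Q\<close>. Adding the at most \<open>2 ^ n\<close> digit sums off
  \<open>Q\<close> of length \<open>n\<close> thickens a set of diameter about \<open>4 ^ -n\<close>
  to measure about \<open>2 ^ -n\<close>, comparable to the square root of the diameter. Since the
  thickened sets cover \<open>[0, 1)\<close>, a total below 1 is absurd.\<close>

lemma Hausdorff_dim_Erdos_set_nonzero:
  assumes Q: "\<not> contains_AP Q K" "\<And>n. 2 * card (- Q \<inter> {1..n}) \<le> n"
  shows "Hausdorff_dim Erdos_set \<noteq> 0"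
proof
  assume "Hausdorff_dim Erdos_set = 0"
  then have "Inf {ennreal s | s. s \<ge> 0 \<and> Hausdorff_measure s Erdos_set = 0} < ennreal (1 / 2)"
    unfolding Hausdorff_dim_def by (simp only: ennreal_less_zero_iff)
  then obtain s where s: "0 \<le> s" "Hausdorff_measure s Erdos_set = 0" "ennreal s < ennreal (1 / 2)"
    unfolding Inf_less_iff by blast
  have s2: "s < 1 / 2" using s(3) unfolding ennreal_less_iff[OF s(1)] .
  have "Hausdorff_premeasure s 1 Erdos_set \<le> Hausdorff_measure s Erdos_set"
    unfolding Hausdorff_measure_def by (intro SUP_upper) simp
  \<comment> \<open>The threshold 1/16 leads to the final bound
    \<open>6 / 16 + 1 / 4 = 5 / 8\<close>, which is less than 1.\<close>
  then have "Hausdorff_premeasure s 1 Erdos_set < ennreal (1 / 16)" using s(2) by simp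
  then obtain U where U: "(\<Sum>i. diam_powr s (U i)) < ennreal (1 / 16)" "Erdos_set \<subseteq> (\<Union>i. U i)"
    "\<And>i. bounded (U i) \<and> diameter (U i) \<le> 1"
    unfolding Hausdorff_premeasure_def Inf_less_iff by blast
  have "\<exists>n. diameter (U i) \<le> 1 / 4 ^ n \<and> (U i \<noteq> {} \<longrightarrow>
      ennreal (3 / 2 ^ n) \<le> 6 * diam_powr s (U i) + ennreal (1 / 4 * (1 / 2) ^ Suc i))" for i
  proof (cases "diameter (U i) = 0")
    case True
    \<comment> \<open>A set of diameter 0 does not determine a scale. The scale \<open>i + 5\<close>
      is paid for by the summable error term alone.\<close>
    have "3 / 2 ^ (i + 5) \<le> 1 / 4 * (1 / 2 :: real) ^ Suc i" by (simp add: power_add field_simps)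
    then have "ennreal (3 / 2 ^ (i + 5)) \<le> ennreal (1 / 4 * (1 / 2) ^ Suc i)" by (rule ennreal_leI)
    also have "\<dots> \<le> 6 * diam_powr s (U i) + ennreal (1 / 4 * (1 / 2) ^ Suc i)" by simp
    finally show ?thesis using True by (intro exI[of _ "i + 5"]) simp
  next
    case False
    define d where "d = diameter (U i)"
    have d: "0 < d" "d \<le> 1" using False diameter_ge_0[of "U i"] U(3)[of i] by (auto simp: d_def)
    \<comment> \<open>At this scale \<open>1 / 2 ^ (n + 1)\<close> is at most
      \<open>d powr (1 / 2)\<close>, which is at most \<open>d powr s\<close> because
      \<open>d\<close> is at most 1 and \<open>s < 1 / 2\<close>. Hence the factor 6.\<close>
    obtain n where n: "d \<le> 1 / 4 ^ n" "1 / 4 ^ Suc n < d" by (rule one_fourth_power_bracket[OF d])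
    have "1 / 2 ^ Suc n = (1 / 4 ^ Suc n) powr (1 / 2 :: real)"
      by (simp add: powr_half_sqrt real_sqrt_divide real_sqrt_power del: power_Suc)
    also have "\<dots> \<le> d powr (1 / 2)" using n(2) by (intro powr_mono2) auto
    also have "\<dots> \<le> d powr s" using d s2 by (intro powr_mono') auto
    finally have "3 / 2 ^ n \<le> 6 * d powr s" by simp
    then have "ennreal (3 / 2 ^ n) \<le> ennreal (6 * d powr s)" by (rule ennreal_leI)
    also have "\<dots> = 6 * ennreal (d powr s)" by (simp add: ennreal_mult)
    also have "\<dots> = 6 * diam_powr s (U i)" if "U i \<noteq> {}"
      using that d by (auto simp: diam_powr_def d_def)
    finally have le: "U i \<noteq> {} \<Longrightarrow> ennreal (3 / 2 ^ n) \<le> 6 * diam_powr s (U i)" .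
    show ?thesis
    proof (intro exI[of _ n] conjI impI)
      assume "U i \<noteq> {}"
      from le[OF this] show "ennreal (3 / 2 ^ n) \<le> 6 * diam_powr s (U i) + ennreal (1 / 4 * (1 / 2) ^ Suc i)"
        by (rule order_trans) simp
    qed (use n(1) in \<open>simp add: d_def\<close>)
  qed
  then obtain n where n: "\<And>i. diameter (U i) \<le> 1 / 4 ^ n i"
    "\<And>i. U i \<noteq> {} \<Longrightarrow> ennreal (3 / 2 ^ n i) \<le> 6 * diam_powr s (U i) + ennreal (1 / 4 * (1 / 2) ^ Suc i)"
    by metis
  define u where "u = (\<lambda>i. SOME y. y \<in> U i)"
  \<comment> \<open>The margins allow \<open>a\<close> to differ from the chosen point
    \<open>u i\<close> by \<open>1 / 4 ^ n i\<close> on either side, and \<open>b\<close> to exceed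
    its prefix \<open>p\<close> by as much.\<close>
  define T where "T = (\<lambda>i. if U i = {} then {} else
    (\<Union>p\<in>digit_sums (- Q) (n i). {u i + p - 1 / 4 ^ n i .. u i + p + 2 / 4 ^ n i}))"
  have Tsets: "T i \<in> sets lborel" for i
    unfolding T_def using finite_digit_sums by (auto intro!: sets.finite_UN)
  have Tmeas: "emeasure lborel (T i) \<le> 6 * diam_powr s (U i) + ennreal (1 / 4 * (1 / 2) ^ Suc i)" for i
  proof (cases "U i = {}")
    case False
    have "emeasure lborel (T i) \<le> (\<Sum>p\<in>digit_sums (- Q) (n i). emeasure lborel {u i + p - 1 / 4 ^ n i .. u i + p + 2 / 4 ^ n i})"
      using False finite_digit_sums by (auto simp: T_def intro!: emeasure_subadditive_finite)
    also have "\<dots> = (\<Sum>p\<in>digit_sums (- Q) (n i). ennreal (3 / 4 ^ n i))"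
    proof (intro sum.cong refl)
      fix p
      have "u i + p - 1 / 4 ^ n i \<le> u i + p + 2 / 4 ^ n i" by (simp add: order_trans[of _ 0])
      moreover have "u i + p + 2 / 4 ^ n i - (u i + p - 1 / 4 ^ n i) = 3 / 4 ^ n i"
        by (simp add: field_simps)
      ultimately show "emeasure lborel {u i + p - 1 / 4 ^ n i .. u i + p + 2 / 4 ^ n i} = ennreal (3 / 4 ^ n i)"
        by (simp only: emeasure_lborel_Icc)
    qed
    also have "\<dots> = ennreal (real (card (digit_sums (- Q) (n i))) * (3 / 4 ^ n i))"
      by (simp add: ennreal_of_nat_eq_real_of_nat flip: ennreal_mult)
    also have "\<dots> \<le> ennreal (2 ^ n i * (3 / 4 ^ n i))"
    proof (intro ennreal_leI mult_right_mono)
      have "card (digit_sums (- Q) (n i)) \<le> 4 ^ card (- Q \<inter> {1..n i})" by (rule card_digit_sums)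
      also have "\<dots> = 2 ^ (2 * card (- Q \<inter> {1..n i}))" by (simp add: power_mult)
      also have "\<dots> \<le> 2 ^ n i" using Q(2) by (intro power_increasing) auto
      finally have "real (card (digit_sums (- Q) (n i))) \<le> real (2 ^ n i)" by (rule of_nat_mono)
      then show "real (card (digit_sums (- Q) (n i))) \<le> 2 ^ n i" by simp
    qed simp
    also have "2 ^ n i * (3 / 4 ^ n i) = 3 / (2 ^ n i :: real)"
    proof -
      have "(4::real) ^ n i = 2 ^ n i * 2 ^ n i" by (simp flip: power_mult_distrib)
      then show ?thesis by simp
    qed
    finally show ?thesis using n(2)[OF False] by (rule order_trans)
  qed (simp add: T_def)
  have "{0..<1} \<subseteq> (\<Union>i. T i)"
  proof
    fix x :: real assume "x \<in> {0..<1}"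
    then obtain a b where ab: "a \<in> digit_expansions Q" "b \<in> digit_expansions (- Q)" "x = a + b"
      using digit_expansions_complement by blast
    then obtain i where i: "a \<in> U i"
      using digit_expansions_subset_Erdos_set[OF Q(1)] U(2) by blast
    obtain p where p: "p \<in> digit_sums (- Q) (n i)" "p \<le> b" "b \<le> p + 1 / 4 ^ n i"
      using ab(2) unfolding digit_expansions_def by blast
    have "u i \<in> U i" unfolding u_def using i by (rule someI)
    then have "dist a (u i) \<le> 1 / 4 ^ n i"
      using diameter_bounded_bound[of "U i" a "u i"] U(3)[of i] n(1)[of i] i by auto
    then have "\<bar>a - u i\<bar> \<le> 1 / 4 ^ n i" by (simp add: dist_real_def)
    moreover have "2 / 4 ^ n i = 1 / 4 ^ n i + 1 / (4 ^ n i :: real)" by simp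
    ultimately have "x \<in> {u i + p - 1 / 4 ^ n i .. u i + p + 2 / 4 ^ n i}"
      using p(2,3) unfolding ab(3) atLeastAtMost_iff by linarith
    then have "x \<in> T i" using i p(1) unfolding T_def by auto
    then show "x \<in> (\<Union>i. T i)" by blast
  qed
  then have "emeasure lborel {0..<1::real} \<le> emeasure lborel (\<Union>i. T i)"
    using Tsets by (intro emeasure_mono) auto
  also have "\<dots> \<le> (\<Sum>i. emeasure lborel (T i))"
    using Tsets by (intro emeasure_subadditive_countably) auto
  also have "\<dots> \<le> (\<Sum>i. 6 * diam_powr s (U i) + ennreal (1 / 4 * (1 / 2) ^ Suc i))"
    using Tmeas by (intro suminf_le summableI)
  also have "\<dots> = 6 * (\<Sum>i. diam_powr s (U i)) + (\<Sum>i. ennreal (1 / 4 * (1 / 2) ^ Suc i))"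
    by (simp add: suminf_add[symmetric])
  also have "(\<Sum>i. ennreal (1 / 4 * (1 / 2) ^ Suc i)) = ennreal (1 / 4)"
    using sums_mult[OF power_half_series, of "1 / 4"] by (intro suminf_ennreal_eq) auto
  also have "6 * (\<Sum>i. diam_powr s (U i)) + ennreal (1 / 4) \<le> 6 * ennreal (1 / 16) + ennreal (1 / 4)"
    using U(1) by (intro add_mono mult_left_mono) auto
  also have "\<dots> = ennreal (5 / 8)"
  proof -
    have "6 * ennreal (1 / 16) = ennreal (6 * (1 / 16))" by (subst ennreal_mult) auto
    then show ?thesis by (simp flip: ennreal_plus)
  qed
  finally have "ennreal 1 \<le> ennreal (5 / 8)" by simp
  then show False by (simp add: ennreal_le_iff)
qed

section \<open>Fourier analysis of restricted digit sums\<close>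

text \<open>The expectation of \<open>f\<close> at a random digit sum with independent uniform
  digits on \<open>Q\<close>. The values may be real or complex, as both occur below.\<close>

fun digit_avg :: "nat set \<Rightarrow> nat \<Rightarrow> (real \<Rightarrow> 'a) \<Rightarrow> 'a::real_normed_vector" where
  "digit_avg Q 0 f = f 0"
| "digit_avg Q (Suc n) f =
    (if Suc n \<in> Q then (1 / 4) *\<^sub>R (\<Sum>d<4. digit_avg Q n (\<lambda>v. f (v + real d / 4 ^ Suc n)))
     else digit_avg Q n f)"

lemma digit_avg_sum: "digit_avg Q n (\<lambda>v. \<Sum>i\<in>I. f i v) = (\<Sum>i\<in>I. digit_avg Q n (f i))"
  by (induction n arbitrary: f) (simp_all add: scaleR_sum_right sum.swap[of _ _ I])

lemma digit_avg_cmult: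
  fixes c :: "'a::real_normed_algebra"
  shows "digit_avg Q n (\<lambda>v. c * f v) = c * digit_avg Q n f"
  by (induction n arbitrary: f) (simp_all add: sum_distrib_left)

lemma digit_avg_of_real:
  "digit_avg Q n (\<lambda>v. complex_of_real (f v)) = complex_of_real (digit_avg Q n f)"
  by (induction n arbitrary: f) (simp_all add: scaleR_conv_of_real)

lemma digit_avg_const: "digit_avg Q n (\<lambda>v. c) = c"
  by (induction n) (simp_all add: sum_constant_scaleR)

lemma digit_avg_norm: "norm (digit_avg Q n f) \<le> digit_avg Q n (\<lambda>v. norm (f v))"
proof (induction n arbitrary: f)
  case (Suc n)
  have "norm (\<Sum>d<4. digit_avg Q n (\<lambda>v. f (v + real d / 4 ^ Suc n)))
      \<le> (\<Sum>d<4. digit_avg Q n (\<lambda>v. norm (f (v + real d / 4 ^ Suc n))))"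
    by (intro sum_norm_le Suc)
  then show ?case using Suc by simp
qed simp

lemma digit_avg_mono:
  fixes f g :: "real \<Rightarrow> real"
  assumes "\<And>v. 0 \<le> v \<Longrightarrow> f v \<le> g v"
  shows "digit_avg Q n f \<le> digit_avg Q n g"
  using assms
proof (induction n arbitrary: f g)
  case (Suc n)
  have "(\<Sum>d<4. digit_avg Q n (\<lambda>v. f (v + real d / 4 ^ Suc n)))
      \<le> (\<Sum>d<4. digit_avg Q n (\<lambda>v. g (v + real d / 4 ^ Suc n)))"
    by (intro sum_mono Suc.IH Suc.prems add_nonneg_nonneg) auto
  then show ?case using Suc.IH[OF Suc.prems] by simp
qed simp

lemma digit_avg_le_some:
  fixes f :: "real \<Rightarrow> real"
  shows "\<exists>v\<in>digit_sums Q n. digit_avg Q n f \<le> f v"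
proof (induction n arbitrary: f)
  case (Suc n)
  show ?case
  proof (cases "Suc n \<in> Q")
    case True
    define A where "A = (\<lambda>d. digit_avg Q n (\<lambda>v. f (v + real d / 4 ^ Suc n)))"
    have "\<exists>d<4. digit_avg Q (Suc n) f \<le> A d"
    proof (rule ccontr)
      assume "\<not> ?thesis"
      then have "(\<Sum>d<4. A d) < (\<Sum>d<4::nat. digit_avg Q (Suc n) f)"
        by (intro sum_strict_mono) (auto simp: not_le lessThan_empty_iff simp del: digit_avg.simps)
      then show False using True by (simp add: A_def)
    qed
    then obtain d where d: "d < 4" "digit_avg Q (Suc n) f \<le> A d" by blast
    obtain v where v: "v \<in> digit_sums Q n" "A d \<le> f (v + real d / 4 ^ Suc n)"
      using Suc.IH unfolding A_def by blast
    have "v + real d / 4 ^ Suc n \<in> digit_sums Q (Suc n)"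
      using True v(1) d(1) by (auto intro!: image_eqI[of _ _ "(v, d)"])
    then show ?thesis using d(2) v(2) by (meson order_trans)
  qed (use Suc in auto)
qed simp

text \<open>The digits from \<open>n + 1\<close> to \<open>N\<close> displace the argument by at
  most \<open>1 / 4 ^ n - 1 / 4 ^ N\<close>. A pointwise bound uniform over such displacements lets
  them be averaged out.\<close>

lemma digit_avg_prefix:
  fixes f g :: "real \<Rightarrow> real"
  assumes "n \<le> N"
    and "\<And>w r. 0 \<le> w \<Longrightarrow> 0 \<le> r \<Longrightarrow> r \<le> 1 / 4 ^ n - 1 / 4 ^ N \<Longrightarrow> f (w + r) \<le> g w"
  shows "digit_avg Q N f \<le> digit_avg Q n g"
  using assms
proof (induction N arbitrary: f rule: nat_induct_at_least)
  case base
  have "f v \<le> g v" if "0 \<le> v" for v using base[of v 0] that by simp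
  then show ?case by (rule digit_avg_mono)
next
  case (Suc N)
  have shift: "digit_avg Q N (\<lambda>v. f (v + real d / 4 ^ Suc N)) \<le> digit_avg Q n g" if "d < 4" for d
  proof (rule Suc.IH)
    fix w r :: real assume r: "0 \<le> r" "r \<le> 1 / 4 ^ n - 1 / 4 ^ N" and w: "0 \<le> w"
    have "real d / 4 ^ Suc N \<le> 3 / 4 ^ Suc N" using that by (intro divide_right_mono) auto
    moreover have "1 / 4 ^ N = 3 / 4 ^ Suc N + 1 / (4 ^ Suc N :: real)" by simp
    ultimately have "r + real d / 4 ^ Suc N \<le> 1 / 4 ^ n - 1 / 4 ^ Suc N" using r(2) by linarith
    then have "f (w + (r + real d / 4 ^ Suc N)) \<le> g w" using r(1) w by (intro Suc.prems) auto
    then show "f (w + r + real d / 4 ^ Suc N) \<le> g w" by (simp add: add.assoc)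
  qed
  show ?case
  proof (cases "Suc N \<in> Q")
    case True
    have "(\<Sum>d<4. digit_avg Q N (\<lambda>v. f (v + real d / 4 ^ Suc N))) \<le> (\<Sum>d<4::nat. digit_avg Q n g)"
      using shift by (intro sum_mono) auto
    then show ?thesis using True by simp
  next
    case False
    then show ?thesis using shift[of 0] by simp
  qed
qed

lemma sum_lessThan_four_mult: "(\<Sum>j<4 * m. f j) = (\<Sum>i<m. \<Sum>d<4. f (4 * i + d))"
  for f :: "nat \<Rightarrow> 'a::comm_monoid_add"
proof -
  have "(\<Sum>j<m * 4. f j) = (\<Sum>i<m. sum f {i * 4..<i * 4 + 4})" by (rule sum.nat_group[symmetric])
  also have "\<dots> = (\<Sum>i<m. \<Sum>d<4. f (4 * i + d))"
  proof (rule sum.cong[OF refl])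
    fix i
    have "sum f {i * 4..<i * 4 + 4} = (\<Sum>d = 0..<4. f (d + i * 4))"
      using sum.shift_bounds_nat_ivl[of f 0 "i * 4" 4] by (simp add: add.commute)
    then show "sum f {i * 4..<i * 4 + 4} = (\<Sum>d<4. f (4 * i + d))"
      by (simp add: lessThan_atLeast0 ac_simps)
  qed
  finally show ?thesis by (simp add: mult.commute)
qed

lemma sum_lessThan_mult_four: "(\<Sum>j<4 * m. f j) = (\<Sum>i<m. \<Sum>d<4. f (i + d * m))"
  for f :: "nat \<Rightarrow> 'a::comm_monoid_add"
proof -
  have "(\<Sum>j<4 * m. f j) = (\<Sum>d<4. sum f {d * m..<d * m + m})" by (rule sum.nat_group[symmetric])
  also have "\<dots> = (\<Sum>d<4. \<Sum>i<m. f (i + d * m))"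
  proof (rule sum.cong[OF refl])
    fix d
    show "sum f {d * m..<d * m + m} = (\<Sum>i<m. f (i + d * m))"
      using sum.shift_bounds_nat_ivl[of f 0 "d * m" m] by (simp add: add.commute lessThan_atLeast0)
  qed
  also have "\<dots> = (\<Sum>i<m. \<Sum>d<4. f (i + d * m))" by (rule sum.swap)
  finally show ?thesis .
qed

text \<open>Nonnegativity permits enlarging the digit sums to all multiples of \<open>4 ^ -n\<close>
  in \<open>[0, 1)\<close>, while the normalisation still counts only the positions in
  \<open>Q\<close>. The loss is a factor 4 per position off \<open>Q\<close>.\<close>

lemma digit_avg_le_full:
  fixes g :: "real \<Rightarrow> real"
  assumes "\<And>v. 0 \<le> g v"
  shows "digit_avg Q n g \<le> (\<Sum>z<4 ^ n. g (real z / 4 ^ n)) / 4 ^ card (Q \<inter> {1..n})"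
  using assms
proof (induction n arbitrary: g)
  case (Suc n)
  let ?q = "card (Q \<inter> {1..n})"
  have split: "(\<Sum>z<4 ^ Suc n. g (real z / 4 ^ Suc n)) = (\<Sum>z<4 ^ n. \<Sum>d<4. g (real z / 4 ^ n + real d / 4 ^ Suc n))"
    unfolding power_Suc sum_lessThan_four_mult by (simp add: add_divide_distrib)
  show ?case
  proof (cases "Suc n \<in> Q")
    case True
    have "(\<Sum>d<4. digit_avg Q n (\<lambda>v. g (v + real d / 4 ^ Suc n)))
        \<le> (\<Sum>d<4. (\<Sum>z<4 ^ n. g (real z / 4 ^ n + real d / 4 ^ Suc n)) / 4 ^ ?q)"
      by (intro sum_mono Suc.IH Suc.prems)
    also have "\<dots> = (\<Sum>z<4 ^ Suc n. g (real z / 4 ^ Suc n)) / 4 ^ ?q"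
      unfolding split by (subst sum.swap) (simp add: sum_divide_distrib)
    finally have "digit_avg Q (Suc n) g \<le> 1 / 4 * ((\<Sum>z<4 ^ Suc n. g (real z / 4 ^ Suc n)) / 4 ^ ?q)"
      using True by (simp del: power_Suc)
    also have "\<dots> = (\<Sum>z<4 ^ Suc n. g (real z / 4 ^ Suc n)) / 4 ^ card (Q \<inter> {1..Suc n})"
      unfolding card_Int_Suc using True by simp
    finally show ?thesis .
  next
    case False
    have "(\<Sum>z<4 ^ n. g (real z / 4 ^ n)) \<le> (\<Sum>z<4 ^ n. \<Sum>d<4. g (real z / 4 ^ n + real d / 4 ^ Suc n))"
    proof (intro sum_mono)
      fix z
      show "g (real z / 4 ^ n) \<le> (\<Sum>d<4. g (real z / 4 ^ n + real d / 4 ^ Suc n))"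
        using member_le_sum[of 0 "{..<4}" "\<lambda>d. g (real z / 4 ^ n + real d / 4 ^ Suc n)"] Suc.prems by simp
    qed
    then have "(\<Sum>z<4 ^ n. g (real z / 4 ^ n)) / 4 ^ ?q \<le> (\<Sum>z<4 ^ Suc n. g (real z / 4 ^ Suc n)) / 4 ^ ?q"
      unfolding split by (intro divide_right_mono) auto
    with Suc.IH[OF Suc.prems] have "digit_avg Q n g \<le> (\<Sum>z<4 ^ Suc n. g (real z / 4 ^ Suc n)) / 4 ^ ?q"
      by (rule order_trans)
    then show ?thesis using False by (simp only: card_Int_Suc digit_avg.simps if_False add_0_right)
  qed
qed simp

section \<open>The Fourier factor of one base 4 digit\<close>

text \<open>A quarter of the modulus of \<open>1 + z + z ^ 2 + z ^ 3 = (1 + z) * (1 + z ^ 2)\<close>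
  at \<open>z = cis (2 * pi * t)\<close>.\<close>

definition digit_factor :: "real \<Rightarrow> real" where
  "digit_factor t = \<bar>cos (pi * t)\<bar> * \<bar>cos (2 * pi * t)\<bar>"

lemma norm_one_plus_cis: "norm (1 + cis (2 * x)) = 2 * \<bar>cos x\<bar>"
proof -
  have "1 + cis (2 * x) = cis x * (cis (- x) + cis x)" by (simp add: distrib_left cis_mult)
  also have "cis (- x) + cis x = of_real (2 * cos x)" by (simp add: complex_eq_iff)
  finally show ?thesis by (simp add: norm_mult)
qed

lemma norm_digit_sum: "norm (\<Sum>d<4. cis (2 * pi * t * real d)) = 4 * digit_factor t"
proof -
  have "(\<Sum>d<4. cis (2 * pi * t * real d)) = (1 + cis (2 * (pi * t))) * (1 + cis (2 * (2 * pi * t)))"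
    by (simp add: numeral_eq_Suc algebra_simps cis_mult)
  then show ?thesis by (simp only: norm_mult norm_one_plus_cis) (simp add: digit_factor_def)
qed

lemma digit_factor_nonneg: "0 \<le> digit_factor t"
  by (simp add: digit_factor_def)

lemma digit_factor_le_1: "digit_factor t \<le> 1"
  using mult_mono[of "\<bar>cos (pi * t)\<bar>" 1 "\<bar>cos (2 * pi * t)\<bar>" 1] by (simp add: digit_factor_def)

lemma digit_factor_minus: "digit_factor (- t) = digit_factor t"
  by (simp add: digit_factor_def)

lemma digit_factor_add_nat: "digit_factor (t + real k) = digit_factor t"
proof (induction k)
  case (Suc k)
  have "pi * (t + real (Suc k)) = pi * (t + real k) + pi" by (simp add: algebra_simps)
  moreover have "2 * pi * (t + real (Suc k)) = 2 * pi * (t + real k) + 2 * pi" by (simp add: algebra_simps)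
  ultimately have "digit_factor (t + real (Suc k)) = digit_factor (t + real k)"
    unfolding digit_factor_def by (simp only: cos_periodic cos_periodic_pi abs_minus_cancel)
  then show ?case using Suc by simp
qed simp

lemma cos_Lipschitz: "\<bar>cos a - cos b\<bar> \<le> \<bar>a - b\<bar>" for a b :: real
proof -
  have "\<bar>cos a - cos b\<bar> = 2 * \<bar>sin ((a + b) / 2)\<bar> * \<bar>sin ((b - a) / 2)\<bar>"
    unfolding cos_diff_cos by (simp add: abs_mult)
  also have "\<dots> \<le> 2 * 1 * \<bar>(b - a) / 2\<bar>"
    by (intro mult_mono abs_sin_x_le_abs_x) auto
  finally show ?thesis by simp
qed

text \<open>The two cosines have Lipschitz constants \<open>pi\<close> and \<open>2 * pi\<close> and
  are bounded by 1; 10 is an upper bound for \<open>3 * pi\<close>.\<close>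

lemma digit_factor_Lipschitz: "digit_factor t \<le> digit_factor s + 10 * \<bar>t - s\<bar>"
proof -
  define a a' b b' where "a = \<bar>cos (pi * t)\<bar>" and "a' = \<bar>cos (pi * s)\<bar>"
    and "b = \<bar>cos (2 * pi * t)\<bar>" and "b' = \<bar>cos (2 * pi * s)\<bar>"
  have "a - a' \<le> \<bar>cos (pi * t) - cos (pi * s)\<bar>" unfolding a_def a'_def by linarith
  also have "\<dots> \<le> \<bar>pi * t - pi * s\<bar>" by (rule cos_Lipschitz)
  also have "\<dots> = pi * \<bar>t - s\<bar>" by (simp add: abs_mult flip: right_diff_distrib)
  finally have a: "a - a' \<le> pi * \<bar>t - s\<bar>" .
  have "b - b' \<le> \<bar>cos (2 * pi * t) - cos (2 * pi * s)\<bar>" unfolding b_def b'_def by linarith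
  also have "\<dots> \<le> \<bar>2 * pi * t - 2 * pi * s\<bar>" by (rule cos_Lipschitz)
  also have "\<dots> = 2 * pi * \<bar>t - s\<bar>" by (simp add: abs_mult flip: right_diff_distrib)
  finally have b: "b - b' \<le> 2 * pi * \<bar>t - s\<bar>" .
  have "a * b - a' * b' = (a - a') * b + a' * (b - b')" by (simp add: algebra_simps)
  also have "(a - a') * b \<le> pi * \<bar>t - s\<bar> * 1"
    using a by (intro mult_mono) (auto simp: b_def)
  also have "a' * (b - b') \<le> a' * (2 * pi * \<bar>t - s\<bar>)"
    using b by (intro mult_left_mono) (auto simp: a'_def)
  also have "\<dots> \<le> 1 * (2 * pi * \<bar>t - s\<bar>)" by (intro mult_right_mono) (auto simp: a'_def)
  finally have "a * b \<le> a' * b' + 3 * pi * \<bar>t - s\<bar>" by simp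
  also have "3 * pi * \<bar>t - s\<bar> \<le> 10 * \<bar>t - s\<bar>" using pi_approx by (intro mult_right_mono) auto
  finally show ?thesis by (simp add: digit_factor_def a_def a'_def b_def b'_def)
qed

text \<open>With \<open>x = \<bar>cos (2 \<pi> t)\<bar>\<close> and \<open>y = \<bar>sin (2 \<pi> t)\<bar>\<close>, the sum is
  \<open>x \<surd>(1 + y) + y \<surd>(1 + x)\<close>, which is at most \<open>\<surd>(2 + \<surd>2)\<close> by Cauchy--Schwarz. The point is that
  this is less than 2, the value obtained from the quadratic mean.\<close>

lemma digit_factor_sum: "(\<Sum>k<4. digit_factor (t + real k / 4)) \<le> 37 / 20"
proof -
  define x y where "x = \<bar>cos (2 * pi * t)\<bar>" and "y = \<bar>sin (2 * pi * t)\<bar>"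
  have xy: "0 \<le> x" "0 \<le> y" "x\<^sup>2 + y\<^sup>2 = 1" by (auto simp: x_def y_def)
  have pair: "(\<bar>cos u\<bar> + \<bar>sin u\<bar>)\<^sup>2 = 1 + \<bar>sin (2 * u)\<bar>" for u :: real
    using sin_cos_squared_add[of u] by (simp add: power2_sum sin_double abs_mult)
  define p q where "p = \<bar>cos (pi * t)\<bar> + \<bar>sin (pi * t)\<bar>"
    and "q = \<bar>cos (pi * t + pi / 4)\<bar> + \<bar>sin (pi * t + pi / 4)\<bar>"
  have p2: "p\<^sup>2 = 1 + y" unfolding p_def pair by (simp add: y_def mult.assoc)
  have "2 * (pi * t + pi / 4) = 2 * pi * t + pi / 2" by (simp add: algebra_simps)
  then have q2: "q\<^sup>2 = 1 + x" unfolding q_def pair by (simp add: x_def sin_add mult.assoc)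
  have e1: "pi * (t + 1 / 4) = pi * t + pi / 4" "2 * pi * (t + 1 / 4) = 2 * pi * t + pi / 2"
    and e2: "pi * (t + 1 / 2) = pi * t + pi / 2" "2 * pi * (t + 1 / 2) = 2 * pi * t + pi"
    and e3: "pi * (t + 3 / 4) = (pi * t + pi / 4) + pi / 2" "2 * pi * (t + 3 / 4) = (2 * pi * t + pi / 2) + pi"
    by (simp_all add: algebra_simps)
  have shift: "\<bar>cos (u + pi / 2)\<bar> = \<bar>sin u\<bar>" for u :: real by (simp add: cos_add)
  have "(\<Sum>k<4. digit_factor (t + real k / 4))
      = digit_factor t + digit_factor (t + 1 / 4) + digit_factor (t + 1 / 2) + digit_factor (t + 3 / 4)"
    by (simp add: numeral_eq_Suc)
  also have "\<dots> = p * x + q * y"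
    unfolding digit_factor_def e1 e2 e3 shift cos_periodic_pi abs_minus_cancel p_def q_def x_def y_def
    by (simp add: algebra_simps)
  finally have S: "(\<Sum>k<4. digit_factor (t + real k / 4)) = p * x + q * y" .
  \<comment> \<open>Lagrange's identity gives the Cauchy-Schwarz bound.\<close>
  have "(p * x + q * y)\<^sup>2 + (p * y - q * x)\<^sup>2 = (p\<^sup>2 + q\<^sup>2) * (x\<^sup>2 + y\<^sup>2)"
    by (simp add: power2_eq_square algebra_simps)
  then have le: "(p * x + q * y)\<^sup>2 \<le> 2 + (x + y)" using xy(3) p2 q2 zero_le_power2[of "p * y - q * x"]
    by (simp only: mult_1_right)
  have "(x + y)\<^sup>2 + (x - y)\<^sup>2 = 2 * (x\<^sup>2 + y\<^sup>2)" by (simp add: power2_eq_square algebra_simps)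
  then have "(x + y)\<^sup>2 = 2 - (x - y)\<^sup>2" unfolding xy(3) by (simp only: eq_diff_eq mult_1_right)
  then have "(x + y)\<^sup>2 \<le> 2" by (simp only: diff_le_eq) simp
  \<comment> \<open>The rational 1422/1000 lies just above the square root of 2, and
    \<open>2 + 1422 / 1000\<close> is still below \<open>(37 / 20) ^ 2\<close>.\<close>
  also have "\<dots> \<le> (1422 / 1000)\<^sup>2" by (simp add: power2_eq_square)
  finally have "x + y \<le> 1422 / 1000" by (rule power2_le_imp_le) simp
  then have "(p * x + q * y)\<^sup>2 \<le> (37 / 20)\<^sup>2" using le by (simp add: power2_eq_square)
  then show ?thesis unfolding S by (rule power2_le_imp_le) simp
qed

text \<open>If \<open>i - 1\<close> is the number of trailing zeros of \<open>h\<close> in base 4,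
  then \<open>h / 4 ^ i\<close> has fractional part 1/4, 1/2 or 3/4, where one of the cosines
  vanishes.\<close>

lemma digit_factor_zero:
  "0 < h \<Longrightarrow> h < 4 ^ n \<Longrightarrow> \<exists>i\<in>{1..n}. digit_factor (real h / 4 ^ i) = 0"
proof (induction n arbitrary: h)
  case (Suc n)
  show ?case
  proof (cases "h mod 4 = 0")
    case True
    then obtain m where m: "h = 4 * m" by auto
    obtain i where i: "i \<in> {1..n}" "digit_factor (real m / 4 ^ i) = 0"
      using Suc.IH[of m] Suc.prems m by auto
    then show ?thesis by (intro bexI[of _ "Suc i"]) (auto simp: m)
  next
    case False
    have "h = h mod 4 + 4 * (h div 4)" by simp
    then have "real h = real (h mod 4) + 4 * real (h div 4)"
      by (metis of_nat_add of_nat_mult of_nat_numeral)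
    then have "real h / 4 = real (h mod 4) / 4 + real (h div 4)" by simp
    then have "digit_factor (real h / 4) = digit_factor (real (h mod 4) / 4)"
      by (simp only: digit_factor_add_nat)
    moreover have "h mod 4 = 1 \<or> h mod 4 = 2 \<or> h mod 4 = 3" using False by presburger
    then have "digit_factor (real (h mod 4) / 4) = 0"
    proof (elim disjE)
      assume "h mod 4 = 3"
      then have "2 * pi * (real (h mod 4) / 4) = pi / 2 + pi" by simp
      then show ?thesis unfolding digit_factor_def by (simp only: cos_periodic_pi) simp
    qed (auto simp: digit_factor_def)
    ultimately show ?thesis by (intro bexI[of _ 1]) auto
  qed
qed simp

text \<open>The modulus at \<open>t\<close> of the Fourier transform of the uniform distribution of
  digits on \<open>Q\<close>, see \<open>norm_digit_avg_cis\<close>.\<close>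

definition digit_prod :: "nat set \<Rightarrow> nat \<Rightarrow> real \<Rightarrow> real" where
  "digit_prod Q n t = (\<Prod>i\<in>Q \<inter> {1..n}. digit_factor (t / 4 ^ i))"

lemma digit_prod_nonneg: "0 \<le> digit_prod Q n t"
  unfolding digit_prod_def by (intro prod_nonneg ballI digit_factor_nonneg)

lemma digit_prod_minus: "digit_prod Q n (- t) = digit_prod Q n t"
  by (simp add: digit_prod_def digit_factor_minus)

lemma digit_prod_antimono: "n \<le> N \<Longrightarrow> digit_prod Q N t \<le> digit_prod Q n t"
proof (induction N rule: nat_induct_at_least)
  case (Suc N)
  have "digit_prod Q (Suc N) t \<le> digit_prod Q N t"
  proof -
    have "digit_factor (t / 4 ^ Suc N) * digit_prod Q N t \<le> digit_prod Q N t"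
      by (intro mult_left_le_one_le digit_prod_nonneg digit_factor_nonneg digit_factor_le_1)
    then show ?thesis unfolding digit_prod_def Int_Suc by simp
  qed
  then show ?case using Suc by simp
qed simp

lemma norm_digit_avg_cis: "norm (digit_avg Q n (\<lambda>v. cis (2 * pi * t * v))) = digit_prod Q n t"
proof (induction n)
  case (Suc n)
  have "digit_avg Q (Suc n) (\<lambda>v. cis (2 * pi * t * v)) =
      (1 / 4) *\<^sub>R (\<Sum>d<4. cis (2 * pi * (t / 4 ^ Suc n) * real d)) * digit_avg Q n (\<lambda>v. cis (2 * pi * t * v))"
    if "Suc n \<in> Q"
  proof -
    have "cis (2 * pi * t * (v + real d / 4 ^ Suc n)) =
        cis (2 * pi * (t / 4 ^ Suc n) * real d) * cis (2 * pi * t * v)" for v and d :: nat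
    proof -
      have "2 * pi * t * (v + real d / 4 ^ Suc n) = 2 * pi * (t / 4 ^ Suc n) * real d + 2 * pi * t * v"
        by (simp add: field_simps del: power_Suc)
      then show ?thesis by (simp only: cis_mult)
    qed
    then show ?thesis using that by (simp add: digit_avg_cmult sum_distrib_right)
  qed
  note step = this
  show ?case
  proof (cases "Suc n \<in> Q")
    case True
    then show ?thesis
      unfolding step[OF True] norm_mult norm_scaleR norm_digit_sum Suc
      unfolding digit_prod_def Int_Suc by simp
  next
    case False
    then show ?thesis using Suc unfolding digit_prod_def Int_Suc by simp
  qed
qed (simp add: digit_prod_def)

section \<open>Summing Fourier coefficients over ranges of frequencies\<close>

text \<open>A majorant of \<open>digit_prod\<close> on the points within distance 2 of the integer
  \<open>l\<close>; \<open>20 / 4 ^ i\<close> is the Lipschitz constant 10 times the displacement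
  \<open>2 / 4 ^ i\<close>. As a function of \<open>l\<close> it has period
  \<open>4 ^ n\<close>.\<close>

definition digit_bound :: "nat set \<Rightarrow> nat \<Rightarrow> nat \<Rightarrow> real" where
  "digit_bound Q n l = (\<Prod>i\<in>Q \<inter> {1..n}. digit_factor (real l / 4 ^ i) + 20 / 4 ^ i)"

lemma digit_bound_nonneg: "0 \<le> digit_bound Q n l"
  unfolding digit_bound_def by (intro prod_nonneg ballI add_nonneg_nonneg digit_factor_nonneg) simp

lemma digit_prod_le_bound:
  assumes "\<bar>t - real l\<bar> \<le> 2"
  shows "digit_prod Q n t \<le> digit_bound Q n l"
  unfolding digit_prod_def digit_bound_def
proof (intro prod_mono conjI digit_factor_nonneg)
  fix i
  have "\<bar>t / 4 ^ i - real l / 4 ^ i\<bar> = \<bar>t - real l\<bar> / 4 ^ i"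
    by (simp add: abs_divide flip: diff_divide_distrib)
  also have "\<dots> \<le> 2 / 4 ^ i" using assms by (intro divide_right_mono) auto
  finally show "digit_factor (t / 4 ^ i) \<le> digit_factor (real l / 4 ^ i) + 20 / 4 ^ i"
    using digit_factor_Lipschitz[of "t / 4 ^ i" "real l / 4 ^ i"] by simp
qed

text \<open>By periodicity a new position is summed over four equally spaced points: it contributes
  37/20 plus an error if it lies in \<open>Q\<close>, and 4 otherwise. The errors telescope in the
  exponent, since \<open>45 / 4 ^ (n + 1) = 15 * (1 / 4 ^ n - 1 / 4 ^ (n + 1))\<close>.\<close>

lemma digit_bound_sum:
  "(\<Sum>l<4 ^ n. digit_bound Q n l)
    \<le> exp (15 * (1 - 1 / 4 ^ n)) * ((37 / 20) ^ card (Q \<inter> {1..n}) * 4 ^ card (- Q \<inter> {1..n}))"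
proof (induction n)
  case (Suc n)
  define S where "S = (\<Sum>l<4 ^ n. digit_bound Q n l)"
  define R where "R = (37 / 20 :: real) ^ card (Q \<inter> {1..n}) * 4 ^ card (- Q \<inter> {1..n})"
  have IH: "S \<le> exp (15 * (1 - 1 / 4 ^ n)) * R" using Suc unfolding S_def R_def .
  have R0: "0 \<le> R" unfolding R_def by simp
  have periodic: "digit_bound Q n (l + d * 4 ^ n) = digit_bound Q n l" for l d
    unfolding digit_bound_def
  proof (intro prod.cong refl)
    fix i assume "i \<in> Q \<inter> {1..n}"
    then have "(4::real) ^ n = 4 ^ (n - i) * 4 ^ i" by (simp flip: power_add)
    then have "real (l + d * 4 ^ n) / 4 ^ i = real l / 4 ^ i + real (d * 4 ^ (n - i))"
      by (simp add: add_divide_distrib)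
    then show "digit_factor (real (l + d * 4 ^ n) / 4 ^ i) + 20 / 4 ^ i = digit_factor (real l / 4 ^ i) + 20 / 4 ^ i"
      by (simp only: digit_factor_add_nat)
  qed
  show ?case
  proof (cases "Suc n \<in> Q")
    case True
    have "(\<Sum>l<4 ^ Suc n. digit_bound Q (Suc n) l) =
        (\<Sum>l<4 ^ n. digit_bound Q n l * (\<Sum>d<4. digit_factor (real (l + d * 4 ^ n) / 4 ^ Suc n) + 20 / 4 ^ Suc n))"
    proof -
      have "digit_bound Q (Suc n) l = digit_bound Q n l * (digit_factor (real l / 4 ^ Suc n) + 20 / 4 ^ Suc n)" for l
        using True unfolding digit_bound_def Int_Suc by simp
      then show ?thesis unfolding power_Suc[of 4 n] sum_lessThan_mult_four
        by (simp only: periodic sum_distrib_left)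
    qed
    also have "\<dots> \<le> (\<Sum>l<4 ^ n. digit_bound Q n l * (37 / 20 * exp (45 / 4 ^ Suc n)))"
    proof (intro sum_mono mult_left_mono digit_bound_nonneg)
      fix l :: nat
      have "real (l + d * 4 ^ n) / 4 ^ Suc n = real l / 4 ^ Suc n + real d / 4" for d
        by (simp add: field_simps)
      then have "(\<Sum>d<4. digit_factor (real (l + d * 4 ^ n) / 4 ^ Suc n) + 20 / 4 ^ Suc n)
          = (\<Sum>d<4. digit_factor (real l / 4 ^ Suc n + real d / 4)) + 4 * (20 / 4 ^ Suc n)"
        unfolding sum.distrib by simp
      also have "\<dots> \<le> 37 / 20 + 80 / 4 ^ Suc n" using digit_factor_sum[of "real l / 4 ^ Suc n"] by simp
      \<comment> \<open>The constant 45 is an upper bound for \<open>80 / (37 / 20)\<close>.\<close>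
      also have "\<dots> \<le> 37 / 20 * (1 + 45 / 4 ^ Suc n)" by (simp add: field_simps)
      also have "\<dots> \<le> 37 / 20 * exp (45 / 4 ^ Suc n)" by (intro mult_left_mono exp_ge_add_one_self) simp
      finally show "(\<Sum>d<4. digit_factor (real (l + d * 4 ^ n) / 4 ^ Suc n) + 20 / 4 ^ Suc n)
          \<le> 37 / 20 * exp (45 / 4 ^ Suc n)" .
    qed
    also have "\<dots> = S * (37 / 20 * exp (45 / 4 ^ Suc n))" by (simp only: S_def sum_distrib_right)
    also have "\<dots> \<le> exp (15 * (1 - 1 / 4 ^ n)) * R * (37 / 20 * exp (45 / 4 ^ Suc n))"
      by (intro mult_right_mono IH) simp
    also have "\<dots> = (exp (15 * (1 - 1 / 4 ^ n)) * exp (45 / 4 ^ Suc n)) * (37 / 20 * R)" by simp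
    also have "exp (15 * (1 - 1 / 4 ^ n)) * exp (45 / 4 ^ Suc n) = exp (15 * (1 - 1 / 4 ^ Suc n) :: real)"
      by (simp add: field_simps flip: exp_add)
    also have "37 / 20 * R = (37 / 20) ^ card (Q \<inter> {1..Suc n}) * 4 ^ card (- Q \<inter> {1..Suc n})"
      unfolding R_def card_Int_Suc using True by simp
    finally show ?thesis .
  next
    case False
    have "(\<Sum>l<4 ^ Suc n. digit_bound Q (Suc n) l) = 4 * S"
    proof -
      have "digit_bound Q (Suc n) l = digit_bound Q n l" for l
        using False unfolding digit_bound_def Int_Suc by simp
      then show ?thesis unfolding power_Suc[of 4 n] sum_lessThan_mult_four S_def
        by (simp add: periodic sum_distrib_left)
    qed
    also have "\<dots> \<le> 4 * (exp (15 * (1 - 1 / 4 ^ Suc n)) * R)"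
    proof -
      have "exp (15 * (1 - 1 / 4 ^ n)) * R \<le> exp (15 * (1 - 1 / 4 ^ Suc n)) * R"
        using R0 by (intro mult_right_mono) (auto simp: field_simps)
      then show ?thesis using IH by simp
    qed
    also have "\<dots> = exp (15 * (1 - 1 / 4 ^ Suc n)) * ((37 / 20) ^ card (Q \<inter> {1..Suc n}) * 4 ^ card (- Q \<inter> {1..Suc n}))"
      unfolding R_def card_Int_Suc using False by simp
    finally show ?thesis .
  qed
qed (simp add: digit_bound_def)

text \<open>Each position in \<open>Q\<close> contributes
  \<open>(37 / 20) ^ 2 / 4 = 1369 / 1600 < 1\<close>, which outweighs the factor 16 from each of the
  rare positions off \<open>Q\<close>.\<close>

lemma digit_bound_sum_square:
  assumes "40 * card (- Q \<inter> {1..n}) \<le> n"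
  shows "(\<Sum>l<4 ^ n. digit_bound Q n l)\<^sup>2 / 4 ^ card (Q \<inter> {1..n}) \<le> exp 30 * (93 / 100) ^ n"
proof -
  define q p where "q = card (Q \<inter> {1..n})" and "p = card (- Q \<inter> {1..n})"
  have "q + p = card ((Q \<inter> {1..n}) \<union> (- Q \<inter> {1..n}))"
    unfolding q_def p_def by (rule card_Un_disjoint[symmetric]) auto
  also have "(Q \<inter> {1..n}) \<union> (- Q \<inter> {1..n}) = {1..n}" by auto
  finally have n: "n = q + p" by simp
  define S where "S = (\<Sum>l<4 ^ n. digit_bound Q n l)"
  have "S \<le> exp (15 * (1 - 1 / 4 ^ n)) * ((37 / 20) ^ q * 4 ^ p)"
    unfolding S_def q_def p_def by (rule digit_bound_sum)
  also have "\<dots> \<le> exp 15 * ((37 / 20) ^ q * 4 ^ p)" by (intro mult_right_mono) auto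
  finally have "S\<^sup>2 \<le> (exp 15 * ((37 / 20) ^ q * 4 ^ p))\<^sup>2"
    unfolding S_def by (intro power_mono sum_nonneg digit_bound_nonneg)
  also have "\<dots> = exp 30 * ((1369 / 400) ^ q * 16 ^ p)"
  proof -
    have "(exp 15)\<^sup>2 = exp (30 :: real)" by (simp flip: exp_double)
    moreover have "((37 / 20) ^ q)\<^sup>2 = (1369 / 400 :: real) ^ q" "(4 ^ p)\<^sup>2 = (16 :: real) ^ p"
      by (simp_all add: power2_eq_square power_mult_distrib[symmetric])
    ultimately show ?thesis by (simp add: power_mult_distrib)
  qed
  finally have "S\<^sup>2 / 4 ^ q \<le> exp 30 * ((1369 / 400) ^ q * 16 ^ p) / 4 ^ q" by (intro divide_right_mono) auto
  also have "\<dots> = exp 30 * ((1369 / 1600) ^ q * 16 ^ p)"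
  proof -
    have "(1369 / 1600 :: real) ^ q = (1369 / 400) ^ q / 4 ^ q" by (simp flip: power_divide)
    then show ?thesis by simp
  qed
  \<comment> \<open>Writing 16 as at most \<open>1369 / 1600 * 19\<close> gives every position the
    same factor. The remaining \<open>19 ^ p\<close> is absorbed because 19 is at most
    \<open>(27 / 25) ^ 40\<close> and \<open>40 * p\<close> is at most \<open>n\<close>; finally
    \<open>1369 / 1600 * 27 / 25\<close> is below 93/100.\<close>
  also have "(1369 / 1600 :: real) ^ q * 16 ^ p \<le> (1369 / 1600) ^ q * (1369 / 1600 * 19) ^ p"
    by (intro mult_left_mono power_mono) auto
  also have "\<dots> = (1369 / 1600) ^ n * 19 ^ p" by (simp only: n power_add power_mult_distrib mult.assoc)
  also have "(19::real) ^ p \<le> ((27 / 25) ^ 40) ^ p" by (intro power_mono) (auto simp: power_divide)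
  also have "((27 / 25) ^ 40) ^ p \<le> (27 / 25 :: real) ^ n"
    unfolding power_mult[symmetric] using assms by (intro power_increasing) (auto simp: p_def)
  also have "(1369 / 1600) ^ n * (27 / 25) ^ n \<le> (93 / 100 :: real) ^ n"
    unfolding power_mult_distrib[symmetric] by (intro power_mono) auto
  finally show ?thesis by (simp add: S_def q_def mult_left_mono)
qed

text \<open>As \<open>c\<close> runs over all multiples of \<open>4 ^ -n\<close> in the unit interval, each cell of unit length
  contains at most four of the points \<open>h c\<close>, because \<open>h \<ge> 4 ^ (n - 1)\<close>.\<close>

lemma digit_avg_digit_prod:
  assumes "n \<le> N" "4 ^ n \<le> 4 * h" "h < 4 ^ n"
  shows "digit_avg Q N (\<lambda>c. digit_prod Q N (real h * c))
    \<le> 4 * (\<Sum>l<4 ^ n. digit_bound Q n l) / 4 ^ card (Q \<inter> {1..n})"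
proof -
  define \<phi> where "\<phi> = (\<lambda>z. h * z div 4 ^ n)"
  have "digit_avg Q N (\<lambda>c. digit_prod Q N (real h * c)) \<le> digit_avg Q N (\<lambda>c. digit_prod Q n (real h * c))"
    by (intro digit_avg_mono digit_prod_antimono assms(1))
  \<comment> \<open>The digits after \<open>n\<close> move \<open>h * c\<close> by at most 1 and
    rounding down moves it by at most 1 more, within the distance 2 allowed for
    \<open>digit_bound\<close>.\<close>
  also have "\<dots> \<le> digit_avg Q n (\<lambda>w. digit_bound Q n (nat \<lfloor>real h * w\<rfloor>))"
  proof (intro digit_avg_prefix assms(1) digit_prod_le_bound)
    fix w r :: real assume w: "0 \<le> w" and r: "0 \<le> r" "r \<le> 1 / 4 ^ n - 1 / 4 ^ N"
    have "real h * r \<le> 4 ^ n * (1 / 4 ^ n)"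
    proof (intro mult_mono)
      show "real h \<le> 4 ^ n" using assms(3) by (metis less_imp_le of_nat_le_iff of_nat_numeral of_nat_power)
      have "r \<le> 1 / 4 ^ n - 0" by (rule order_trans[OF r(2)]) (intro diff_left_mono, simp)
      then show "r \<le> 1 / 4 ^ n" by simp
    qed (use r in auto)
    then have "0 \<le> real h * r" "real h * r \<le> 1" using r by auto
    moreover have "0 \<le> real h * w" using w by simp
    then have "real (nat \<lfloor>real h * w\<rfloor>) = of_int \<lfloor>real h * w\<rfloor>" by simp
    ultimately show "\<bar>real h * (w + r) - real (nat \<lfloor>real h * w\<rfloor>)\<bar> \<le> 2"
      unfolding distrib_left by linarith
  qed
  also have "\<dots> \<le> (\<Sum>z<4 ^ n. digit_bound Q n (nat \<lfloor>real h * (real z / 4 ^ n)\<rfloor>)) / 4 ^ card (Q \<inter> {1..n})"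
    by (intro digit_avg_le_full digit_bound_nonneg)
  also have "(\<Sum>z<4 ^ n. digit_bound Q n (nat \<lfloor>real h * (real z / 4 ^ n)\<rfloor>)) = (\<Sum>z<4 ^ n. digit_bound Q n (\<phi> z))"
  proof (intro sum.cong refl)
    fix z :: nat
    have "real h * (real z / 4 ^ n) = real (h * z) / real (4 ^ n)" by simp
    then have "nat \<lfloor>real h * (real z / 4 ^ n)\<rfloor> = \<phi> z"
      unfolding \<phi>_def by (simp only: floor_divide_of_nat_eq nat_int)
    then show "digit_bound Q n (nat \<lfloor>real h * (real z / 4 ^ n)\<rfloor>) = digit_bound Q n (\<phi> z)" by simp
  qed
  also have "(\<Sum>z<4 ^ n. digit_bound Q n (\<phi> z)) \<le> 4 * (\<Sum>l<4 ^ n. digit_bound Q n l)"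
  proof -
    have "\<phi> z < 4 ^ n" if "z < 4 ^ n" for z
    proof -
      have "h * z < 4 ^ n * 4 ^ n" using assms(3) that by (intro mult_strict_mono) auto
      then show ?thesis unfolding \<phi>_def by (rule less_mult_imp_div_less)
    qed
    then have "\<phi> ` {..<4 ^ n} \<subseteq> {..<4 ^ n}" by auto
    then have "(\<Sum>z<4 ^ n. digit_bound Q n (\<phi> z))
        = (\<Sum>l<4 ^ n. \<Sum>z\<in>{z \<in> {..<4 ^ n}. \<phi> z = l}. digit_bound Q n (\<phi> z))"
      by (intro sum.group[symmetric]) auto
    also have "\<dots> \<le> (\<Sum>l<4 ^ n. 4 * digit_bound Q n l)"
    proof (intro sum_mono)
      fix l
      define Z where "Z = {z \<in> {..<4 ^ n}. \<phi> z = l}"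
      have "card Z \<le> 4"
      proof (cases "Z = {}")
        case False
        have finZ: "finite Z" unfolding Z_def by auto
        define m where "m = Min Z"
        have m: "m \<in> Z" unfolding m_def using finZ False by (rule Min_in)
        have "Z \<subseteq> {m..<m + 4}"
        proof
          fix z assume z: "z \<in> Z"
          then have "m \<le> z" unfolding m_def using finZ by simp
          have "z < m + 4"
          proof (rule ccontr)
            assume "\<not> z < m + 4"
            then have "h * (m + 4) \<le> h * z" by (intro mult_le_mono2) simp
            then have "h * m + 4 ^ n \<le> h * z" using assms(2) by (simp add: algebra_simps)
            then have "(h * m + 4 ^ n) div 4 ^ n \<le> \<phi> z" unfolding \<phi>_def by (rule div_le_mono)
            then have "\<phi> m + 1 \<le> \<phi> z" unfolding \<phi>_def by simp
            then show False using m z unfolding Z_def by simp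
          qed
          then show "z \<in> {m..<m + 4}" using \<open>m \<le> z\<close> by simp
        qed
        then have "card Z \<le> card {m..<m + 4}" by (intro card_mono) auto
        then show ?thesis by simp
      qed simp
      then have "real (card Z) * digit_bound Q n l \<le> 4 * digit_bound Q n l"
        by (intro mult_right_mono digit_bound_nonneg) simp
      moreover have "(\<Sum>z\<in>Z. digit_bound Q n (\<phi> z)) = real (card Z) * digit_bound Q n l"
        unfolding Z_def by simp
      ultimately show "(\<Sum>z\<in>{z \<in> {..<4 ^ n}. \<phi> z = l}. digit_bound Q n (\<phi> z)) \<le> 4 * digit_bound Q n l"
        unfolding Z_def by simp
    qed
    finally show ?thesis by (simp add: sum_distrib_left)
  qed
  finally show ?thesis by (simp add: divide_right_mono)
qed

text \<open>Bounds the \<open>h\<close>-th Fourier coefficient of \<open>a + b * c\<close>: the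
  first factor comes from \<open>a\<close>, the second from the transform of \<open>b\<close> at
  \<open>h * c\<close>, averaged over \<open>c\<close> in absolute value.\<close>

definition coeff_bound :: "nat set \<Rightarrow> nat \<Rightarrow> nat \<Rightarrow> real" where
  "coeff_bound Q N h = digit_prod Q N (real h) * digit_avg Q N (\<lambda>c. digit_prod Q N (real h * c))"

lemma digit_avg_digit_prod_nonneg: "0 \<le> digit_avg Q N (\<lambda>c. digit_prod Q N (t * c))"
  using digit_avg_mono[of "\<lambda>c. 0" "\<lambda>c. digit_prod Q N (t * c)" Q N] digit_prod_nonneg
  by (simp add: digit_avg_const)

lemma coeff_bound_nonneg: "0 \<le> coeff_bound Q N h"
  unfolding coeff_bound_def by (intro mult_nonneg_nonneg digit_prod_nonneg digit_avg_digit_prod_nonneg)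

text \<open>Frequencies below \<open>4 ^ n0\<close> vanish because of the free initial digits. Above
  that, induction on \<open>M\<close> adds one range of frequencies between consecutive powers of 4
  at a time.\<close>

lemma coeff_bound_sum:
  assumes Q: "{1..n0} \<subseteq> Q" "\<And>n. 40 * card (- Q \<inter> {1..n}) \<le> n" and M: "n0 \<le> M" "M \<le> N"
  shows "(\<Sum>h\<in>{1..<4 ^ M}. coeff_bound Q N h) \<le> 4 * exp 30 * (\<Sum>n\<in>{n0<..M}. (93 / 100) ^ n)"
  using M
proof (induction M rule: nat_induct_at_least)
  case base
  have "coeff_bound Q N h = 0" if "h \<in> {1..<4 ^ n0}" for h :: nat
  proof -
    have "0 < h" "h < 4 ^ n0" using that by auto
    then obtain i where i: "i \<in> {1..n0}" "digit_factor (real h / 4 ^ i) = 0"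
      using digit_factor_zero by blast
    then have "i \<in> Q \<inter> {1..N}" using Q(1) base by auto
    then have "digit_prod Q N (real h) = 0"
      unfolding digit_prod_def using i(2) by (intro prod_zero) auto
    then show ?thesis by (simp add: coeff_bound_def)
  qed
  then show ?case by simp
next
  case (Suc M)
  define n where "n = Suc M"
  define S where "S = (\<Sum>l<4 ^ n. digit_bound Q n l)"
  have S: "0 \<le> S" unfolding S_def by (intro sum_nonneg digit_bound_nonneg)
  \<comment> \<open>The factor from \<open>a\<close> is kept for the summation over
    \<open>h\<close>, while the averaged factor is bounded uniformly in \<open>h\<close>. The result
    is quadratic in \<open>S\<close>.\<close>
  have "(\<Sum>h\<in>{4 ^ M..<4 ^ n}. coeff_bound Q N h)
      \<le> (\<Sum>h\<in>{4 ^ M..<4 ^ n}. digit_bound Q n h * (4 * S / 4 ^ card (Q \<inter> {1..n})))"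
  proof (intro sum_mono)
    fix h :: nat assume h: "h \<in> {4 ^ M..<4 ^ n}"
    have "digit_prod Q N (real h) \<le> digit_prod Q n (real h)"
      using Suc.prems by (intro digit_prod_antimono) (simp add: n_def)
    also have "\<dots> \<le> digit_bound Q n h" by (rule digit_prod_le_bound) simp
    finally have "digit_prod Q N (real h) \<le> digit_bound Q n h" .
    moreover have "digit_avg Q N (\<lambda>c. digit_prod Q N (real h * c)) \<le> 4 * S / 4 ^ card (Q \<inter> {1..n})"
      unfolding S_def using h Suc.prems by (intro digit_avg_digit_prod) (auto simp: n_def)
    ultimately show "coeff_bound Q N h \<le> digit_bound Q n h * (4 * S / 4 ^ card (Q \<inter> {1..n}))"
      unfolding coeff_bound_def by (intro mult_mono digit_bound_nonneg digit_avg_digit_prod_nonneg)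
  qed
  also have "\<dots> = (\<Sum>h\<in>{4 ^ M..<4 ^ n}. digit_bound Q n h) * (4 * S / 4 ^ card (Q \<inter> {1..n}))"
    by (rule sum_distrib_right[symmetric])
  also have "\<dots> \<le> S * (4 * S / 4 ^ card (Q \<inter> {1..n}))"
    unfolding S_def using S[unfolded S_def]
    by (intro mult_right_mono sum_mono2 digit_bound_nonneg) auto
  also have "\<dots> = 4 * (S\<^sup>2 / 4 ^ card (Q \<inter> {1..n}))" by (simp add: power2_eq_square)
  also have "\<dots> \<le> 4 * (exp 30 * (93 / 100) ^ n)"
    unfolding S_def by (intro mult_left_mono digit_bound_sum_square Q(2)) simp
  finally have new: "(\<Sum>h\<in>{4 ^ M..<4 ^ n}. coeff_bound Q N h) \<le> 4 * exp 30 * (93 / 100) ^ n" by simp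
  have "(4::nat) ^ M \<le> 4 ^ n" by (intro power_increasing) (auto simp: n_def)
  then have "{1..<4 ^ n} = {1..<4 ^ M} \<union> {4 ^ M..<(4::nat) ^ n}" by (intro ivl_disj_un(17)[symmetric]) auto
  then have "(\<Sum>h\<in>{1..<4 ^ n}. coeff_bound Q N h)
      = (\<Sum>h\<in>{1..<4 ^ M}. coeff_bound Q N h) + (\<Sum>h\<in>{4 ^ M..<4 ^ n}. coeff_bound Q N h)"
    by (simp add: sum.union_disjoint)
  also have "\<dots> \<le> 4 * exp 30 * (\<Sum>n\<in>{n0<..M}. (93 / 100) ^ n) + 4 * exp 30 * (93 / 100) ^ n"
    using new Suc by (intro add_mono) auto
  also have "\<dots> = 4 * exp 30 * (\<Sum>n\<in>{n0<..n}. (93 / 100) ^ n)"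
  proof -
    have "{n0<..n} = insert n {n0<..M}" using Suc.hyps by (auto simp: n_def)
    then show ?thesis by (simp add: n_def distrib_left)
  qed
  finally show ?case unfolding n_def .
qed

text \<open>On the left is the Fourier coefficient at \<open>j - k\<close> of the image under \<open>(a, b, c) \<mapsto> x - a - c b\<close> of the uniform
  distribution on triples of digit sums.\<close>

lemma norm_digit_avg_character:
  fixes x :: real and j k :: nat
  assumes "j \<noteq> k"
  shows "norm (digit_avg Q N (\<lambda>a. digit_avg Q N (\<lambda>c. digit_avg Q N (\<lambda>b.
      cis (2 * pi * (real j - real k) * (x - a - c * b))))))
    \<le> coeff_bound Q N (if k < j then j - k else k - j)"
proof -
  define h where "h = real j - real k"
  define m where "m = (if k < j then j - k else k - j)"
  have h: "h = real m \<or> h = - real m" using assms by (auto simp: h_def m_def)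
  define A where "A = (\<lambda>a. cis (2 * pi * (- h) * a))"
  define C where "C = (\<lambda>c. digit_avg Q N (\<lambda>b. cis (2 * pi * (- h * c) * b)))"
  have split: "cis (2 * pi * h * (x - a - c * b)) = cis (2 * pi * h * x) * A a * cis (2 * pi * (- h * c) * b)"
    for a b c
    unfolding A_def cis_mult by (rule arg_cong[of _ _ cis]) (simp add: algebra_simps)
  have "digit_avg Q N (\<lambda>a. digit_avg Q N (\<lambda>c. digit_avg Q N (\<lambda>b. cis (2 * pi * h * (x - a - c * b)))))
      = digit_avg Q N (\<lambda>a. cis (2 * pi * h * x) * A a * digit_avg Q N C)"
    unfolding split digit_avg_cmult C_def ..
  also have "\<dots> = digit_avg Q N (\<lambda>a. (cis (2 * pi * h * x) * digit_avg Q N C) * A a)"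
    by (rule arg_cong[of _ _ "digit_avg Q N"]) (simp add: fun_eq_iff)
  also have "norm \<dots> = norm (digit_avg Q N C) * digit_prod Q N (- h)"
    unfolding digit_avg_cmult A_def by (simp only: norm_mult norm_cis norm_digit_avg_cis mult_1)
  also have "\<dots> \<le> digit_avg Q N (\<lambda>c. digit_prod Q N (- h * c)) * digit_prod Q N (- h)"
    using digit_avg_norm[of Q N C]
    unfolding C_def norm_digit_avg_cis by (intro mult_right_mono digit_prod_nonneg)
  also have "\<dots> = coeff_bound Q N m"
    using h unfolding coeff_bound_def by (auto simp: digit_prod_minus mult.commute)
  finally show ?thesis unfolding h_def m_def .
qed

section \<open>Solving x = a + bc modulo 1\<close>

text \<open>The geometric sum, multiplied out so as to include the ratio 1.\<close>

lemma norm_geometric_cis: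
  "(norm (1 - cis (2 * pi * \<theta>)))\<^sup>2 * (norm (\<Sum>j<M. cis (2 * pi * real j * \<theta>)))\<^sup>2 \<le> 4"
proof -
  define z where "z = cis (2 * pi * \<theta>)"
  have "cis (2 * pi * real j * \<theta>) = z ^ j" for j
    unfolding z_def Complex.DeMoivre by (rule arg_cong[of _ _ cis]) simp
  then have "(1 - z) * (\<Sum>j<M. cis (2 * pi * real j * \<theta>)) = 1 - z ^ M"
    by (simp add: one_diff_power_eq)
  then have "norm (1 - z) * norm (\<Sum>j<M. cis (2 * pi * real j * \<theta>)) = norm (1 - z ^ M)"
    by (metis norm_mult)
  also have "\<dots> \<le> 2"
    using norm_triangle_ineq4[of 1 "z ^ M"] by (simp add: norm_power z_def)
  finally have "(norm (1 - z) * norm (\<Sum>j<M. cis (2 * pi * real j * \<theta>)))\<^sup>2 \<le> 2\<^sup>2"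
    by (intro power_mono) auto
  then show ?thesis by (simp add: power_mult_distrib z_def)
qed

text \<open>The squared modulus \<open>F\<close> of a geometric sum of \<open>M\<close> characters
  is a multiple of the Fejer kernel. Its average over triples is at least \<open>M / 2\<close>, as
  the zero frequency gives \<open>M\<close> and the others at most \<open>M / 2\<close>. At a triple
  where \<open>F\<close> is this large, the geometric sum formula forces
  \<open>x - a - c * b\<close> to be close to an integer.\<close>

lemma digit_sums_near_mod_1:
  assumes small: "(\<Sum>h\<in>{1..<4 ^ N}. coeff_bound Q N h) \<le> 1 / 4"
  shows "\<exists>a\<in>digit_sums Q N. \<exists>b\<in>digit_sums Q N. \<exists>c\<in>digit_sums Q N.
    (norm (1 - cis (2 * pi * (x - a - c * b))))\<^sup>2 \<le> 8 / 4 ^ N"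
proof -
  define M :: nat where "M = 4 ^ N"
  define F where "F = (\<lambda>a c b. (norm (\<Sum>j<M. cis (2 * pi * real j * (x - a - c * b))))\<^sup>2)"
  define G where "G = (\<lambda>h. digit_avg Q N (\<lambda>a. digit_avg Q N (\<lambda>c. digit_avg Q N (\<lambda>b.
      cis (2 * pi * h * (x - a - c * b))))))"
  define T where "T = digit_avg Q N (\<lambda>a. digit_avg Q N (\<lambda>c. digit_avg Q N (F a c)))"
  have expand: "complex_of_real (F a c b) = (\<Sum>j<M. \<Sum>k<M. cis (2 * pi * (real j - real k) * (x - a - c * b)))" for a c b
    unfolding F_def complex_norm_square cnj_sum sum_product cis_cnj cis_mult
    by (intro sum.cong refl arg_cong[of _ _ cis]) (simp add: algebra_simps)
  have "complex_of_real T = digit_avg Q N (\<lambda>a. digit_avg Q N (\<lambda>c. digit_avg Q N (\<lambda>b. complex_of_real (F a c b))))"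
    unfolding T_def digit_avg_of_real ..
  also have "\<dots> = (\<Sum>j<M. \<Sum>k<M. G (real j - real k))"
    unfolding expand digit_avg_sum G_def ..
  finally have "T = (\<Sum>j<M. \<Sum>k<M. Re (G (real j - real k)))"
    using Re_complex_of_real[of T] by (simp only: Re_sum)
  moreover have "1 / 2 \<le> (\<Sum>k<M. Re (G (real j - real k)))" if j: "j < M" for j
  proof -
    have "Re (G (real j - real j)) = 1" by (simp add: G_def digit_avg_const)
    then have "(\<Sum>k<M. Re (G (real j - real k))) = 1 + (\<Sum>k\<in>{..<M} - {j}. Re (G (real j - real k)))"
      using j by (subst sum.remove[of _ j]) auto
    moreover have "\<bar>\<Sum>k\<in>{..<M} - {j}. Re (G (real j - real k))\<bar> \<le> 1 / 2"
    proof -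
      have "\<bar>\<Sum>k\<in>{..<M} - {j}. Re (G (real j - real k))\<bar> \<le> (\<Sum>k\<in>{..<M} - {j}. \<bar>Re (G (real j - real k))\<bar>)"
        by (rule sum_abs)
      also have "\<dots> \<le> (\<Sum>k\<in>{..<M} - {j}. coeff_bound Q N (if k < j then j - k else k - j))"
      proof (intro sum_mono)
        fix k assume "k \<in> {..<M} - {j}"
        then have "j \<noteq> k" by auto
        then have "norm (G (real j - real k)) \<le> coeff_bound Q N (if k < j then j - k else k - j)"
          unfolding G_def by (rule norm_digit_avg_character)
        then show "\<bar>Re (G (real j - real k))\<bar> \<le> coeff_bound Q N (if k < j then j - k else k - j)"
          using abs_Re_le_cmod[of "G (real j - real k)"] by linarith
      qed
      \<comment> \<open>For fixed \<open>j\<close> each positive frequency occurs at most twice,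
        once below and once above \<open>j\<close>. This doubles the bound 1/4.\<close>
      also have "\<dots> = (\<Sum>k\<in>{..<j} \<union> {j<..<M}. coeff_bound Q N (if k < j then j - k else k - j))"
        using j by (intro sum.cong) auto
      also have "\<dots> = (\<Sum>k<j. coeff_bound Q N (j - k)) + (\<Sum>k\<in>{j<..<M}. coeff_bound Q N (k - j))"
        by (subst sum.union_disjoint) auto
      also have "(\<Sum>k<j. coeff_bound Q N (j - k)) = sum (coeff_bound Q N) ((\<lambda>k. j - k) ` {..<j})"
        by (subst sum.reindex) (auto simp: inj_on_def)
      also have "\<dots> \<le> sum (coeff_bound Q N) {1..<M}"
        using j by (intro sum_mono2 coeff_bound_nonneg) auto
      also have "(\<Sum>k\<in>{j<..<M}. coeff_bound Q N (k - j)) = sum (coeff_bound Q N) ((\<lambda>k. k - j) ` {j<..<M})"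
        by (subst sum.reindex) (auto simp: inj_on_def)
      also have "\<dots> \<le> sum (coeff_bound Q N) {1..<M}"
        using j by (intro sum_mono2 coeff_bound_nonneg) auto
      finally show ?thesis using small by (simp add: M_def)
    qed
    ultimately show ?thesis by linarith
  qed
  then have "(\<Sum>j<M. 1 / 2) \<le> (\<Sum>j<M. \<Sum>k<M. Re (G (real j - real k)))" by (intro sum_mono) auto
  ultimately have T: "real M / 2 \<le> T" by simp
  obtain a where a: "a \<in> digit_sums Q N" "T \<le> digit_avg Q N (\<lambda>c. digit_avg Q N (F a c))"
    using digit_avg_le_some unfolding T_def by blast
  obtain c where c: "c \<in> digit_sums Q N" "digit_avg Q N (\<lambda>c. digit_avg Q N (F a c)) \<le> digit_avg Q N (F a c)"
    using digit_avg_le_some by blast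
  obtain b where b: "b \<in> digit_sums Q N" "digit_avg Q N (F a c) \<le> F a c b"
    using digit_avg_le_some by blast
  define \<delta> where "\<delta> = (norm (1 - cis (2 * pi * (x - a - c * b))))\<^sup>2"
  have "real M / 2 \<le> F a c b" using T a(2) c(2) b(2) by linarith
  then have "\<delta> * (real M / 2) \<le> \<delta> * F a c b" by (intro mult_left_mono) (auto simp: \<delta>_def)
  also have "\<dots> \<le> 4" unfolding \<delta>_def F_def by (rule norm_geometric_cis)
  finally have "\<delta> \<le> 8 / 4 ^ N" by (simp add: M_def field_simps)
  then show ?thesis using a(1) b(1) c(1) unfolding \<delta>_def by blast
qed

lemma geometric_tail_le: "(\<Sum>n\<in>{n0<..M}. (93 / 100) ^ n) \<le> 93 / 7 * (93 / 100 :: real) ^ n0"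
proof (cases "n0 \<le> M")
  case True
  then have "(\<Sum>n\<in>{n0<..M}. (93 / 100) ^ n) = 93 / 7 * ((93 / 100 :: real) ^ n0 - (93 / 100) ^ M)"
  proof (induction M rule: nat_induct_at_least)
    case (Suc M)
    then have "{n0<..Suc M} = insert (Suc M) {n0<..M}" by auto
    then show ?case using Suc by (simp add: algebra_simps)
  qed simp
  then show ?thesis by simp
qed simp

text \<open>The tail of the coefficients beyond \<open>4 ^ n0\<close> is bounded by numerical
  constants only, so \<open>n0\<close> is fixed before \<open>Q\<close>. Approximate solutions at
  every \<open>N\<close> become an exact one by minimising the distance to the integers over the
  compact set \<open>D\<close>.\<close>

lemma digit_expansions_cover_mod_1:
  "\<exists>n0. \<forall>Q. {1..n0} \<subseteq> Q \<longrightarrow> (\<forall>n. 40 * card (- Q \<inter> {1..n}) \<le> n) \<longrightarrow>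
    (\<forall>x. \<exists>a\<in>digit_expansions Q. \<exists>b\<in>digit_expansions Q. \<exists>c\<in>digit_expansions Q. x - (a + b * c) \<in> \<int>)"
proof -
  obtain n0 where n0: "(93 / 100 :: real) ^ n0 < 1 / (16 * exp 30 * (93 / 7))"
    using real_arch_pow_inv[of "1 / (16 * exp 30 * (93 / 7)) :: real" "93 / 100"] by auto
  have "\<exists>a\<in>digit_expansions Q. \<exists>b\<in>digit_expansions Q. \<exists>c\<in>digit_expansions Q. x - (a + b * c) \<in> \<int>"
    if Q: "{1..n0} \<subseteq> Q" "\<And>n. 40 * card (- Q \<inter> {1..n}) \<le> n" for Q x
  proof -
    define D where "D = digit_expansions Q \<times> digit_expansions Q \<times> digit_expansions Q"
    define f where "f = (\<lambda>(a, b, c). norm (1 - cis (2 * pi * (x - a - c * b))))"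
    have "compact D" unfolding D_def by (intro compact_Times compact_digit_expansions)
    moreover have "D \<noteq> {}" unfolding D_def using zero_in_digit_sums digit_sums_subset_expansions by blast
    moreover have "continuous_on D f"
      unfolding f_def split_beta by (intro continuous_intros)
    ultimately obtain p where p: "p \<in> D" and min: "\<And>q. q \<in> D \<Longrightarrow> f p \<le> f q"
      using continuous_attains_inf[of D f] by blast
    have "(f p)\<^sup>2 \<le> 8 * (1 / 4) ^ N" if "N \<ge> n0" for N
    proof -
      have "(\<Sum>h\<in>{1..<4 ^ N}. coeff_bound Q N h) \<le> 4 * exp 30 * (\<Sum>n\<in>{n0<..N}. (93 / 100) ^ n)"
        using that by (intro coeff_bound_sum Q) auto
      also have "\<dots> \<le> 4 * exp 30 * (93 / 7 * (93 / 100) ^ n0)"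
        by (intro mult_left_mono geometric_tail_le) simp
      also have "\<dots> \<le> 1 / 4" using n0 by (simp add: field_simps)
      finally have "(\<Sum>h\<in>{1..<4 ^ N}. coeff_bound Q N h) \<le> 1 / 4" .
      from digit_sums_near_mod_1[OF this, of x] obtain a b c
        where abc: "a \<in> digit_sums Q N" "b \<in> digit_sums Q N" "c \<in> digit_sums Q N"
          "(f (a, b, c))\<^sup>2 \<le> 8 / 4 ^ N"
        unfolding f_def by auto
      have "(a, b, c) \<in> D" using abc digit_sums_subset_expansions unfolding D_def by blast
      then have "f p \<le> f (a, b, c)" by (rule min)
      moreover have "0 \<le> f p" by (simp add: f_def split_beta)
      ultimately have "(f p)\<^sup>2 \<le> (f (a, b, c))\<^sup>2" by (rule power_mono)
      then show ?thesis using abc(4) by (simp add: power_one_over)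
    qed
    note le = this
    have "(\<lambda>N. 8 * (1 / 4) ^ N) \<longlonglongrightarrow> (8 * 0 :: real)"
      by (intro tendsto_mult tendsto_const LIMSEQ_realpow_zero) auto
    then have "(f p)\<^sup>2 \<le> 8 * 0" by (rule LIMSEQ_le_const) (use le in blast)
    then have "f p = 0" by simp
    moreover obtain a b c where abc: "p = (a, b, c)" by (cases p)
    ultimately have "cis (2 * pi * (x - a - c * b)) = 1" by (simp add: f_def)
    then have "cos (2 * pi * (x - a - c * b)) = 1" by (simp add: complex_eq_iff)
    then obtain m :: int where "2 * pi * (x - a - c * b) = of_int m * 2 * pi"
      unfolding cos_one_2pi_int by blast
    then have "x - a - c * b = of_int m" by simp
    then have "x - (a + b * c) = of_int m" by (simp add: algebra_simps)
    then have "x - (a + b * c) \<in> \<int>" by simp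
    then show ?thesis using p unfolding D_def abc by blast
  qed
  then show ?thesis by blast
qed

section \<open>Intervals in the sum set\<close>

text \<open>A number in \<open>(0, 1)\<close> has only itself and its successor as representatives
  modulo 1 in \<open>[0, 2]\<close>. If \<open>X\<close> misses a point of \<open>(0, 1)\<close>, it
  misses a neighbourhood, and must contain the translate of this neighbourhood by 1.\<close>

lemma interval_if_cover_mod_1:
  fixes X :: "real set"
  assumes "closed X" "X \<subseteq> {0..2}" and cover: "\<And>x. \<exists>y\<in>X. x - y \<in> \<int>"
  shows "\<exists>u v. u < v \<and> {u<..<v} \<subseteq> X"
proof (cases "{0<..<1} \<subseteq> X")
  case False
  then obtain x0 where x0: "x0 \<in> {0<..<1}" "x0 \<notin> X" by blast
  have "open ({0<..<1} - X)" using assms(1) by (intro open_Diff) auto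
  then obtain e where e: "e > 0" "ball x0 e \<subseteq> {0<..<1} - X"
    using x0 open_contains_ball by (metis Diff_iff)
  have "{x0 + 1 <..< x0 + 1 + e} \<subseteq> X"
  proof
    fix z assume z: "z \<in> {x0 + 1 <..< x0 + 1 + e}"
    then have "z - 1 \<in> ball x0 e" by (auto simp: dist_real_def)
    then have x: "z - 1 \<in> {0<..<1}" "z - 1 \<notin> X" using e(2) by auto
    obtain y where y: "y \<in> X" "(z - 1) - y \<in> \<int>" using cover by blast
    then obtain k :: int where k: "(z - 1) - y = of_int k" by (auto elim: Ints_cases)
    have "0 \<le> y" "y \<le> 2" using y(1) assms(2) by auto
    then have "of_int k < (1 :: real)" "(- 2 :: real) < of_int k" using k x(1) by auto
    then have "k = 0 \<or> k = - 1" by linarith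
    then show "z \<in> X"
    proof
      assume "k = 0"
      then show ?thesis using k y(1) x(2) by simp
    next
      assume "k = - 1"
      then have "y = z" using k by simp
      then show ?thesis using y(1) by simp
    qed
  qed
  then show ?thesis using e(1) by (intro exI[of _ "x0 + 1"] exI[of _ "x0 + 1 + e"]) auto
qed (use zero_less_one in blast)

lemma interval_in_digit_expansions:
  assumes "\<And>x. \<exists>a\<in>digit_expansions Q. \<exists>b\<in>digit_expansions Q. \<exists>c\<in>digit_expansions Q. x - (a + b * c) \<in> \<int>"
  shows "\<exists>u v. u < v \<and> {u<..<v} \<subseteq>
    {a + b * c | a b c. a \<in> digit_expansions Q \<and> b \<in> digit_expansions Q \<and> c \<in> digit_expansions Q}"
proof -
  let ?D = "digit_expansions Q"
  define X where "X = {a + b * c | a b c. a \<in> ?D \<and> b \<in> ?D \<and> c \<in> ?D}"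
  have "X = (\<lambda>(a, b, c). a + b * c) ` (?D \<times> ?D \<times> ?D)" unfolding X_def by force
  moreover have "compact ((\<lambda>(a, b, c). a + b * c) ` (?D \<times> ?D \<times> ?D))"
    unfolding split_beta
    by (intro compact_continuous_image compact_Times compact_digit_expansions continuous_intros)
  ultimately have "closed X" by (simp add: compact_imp_closed)
  moreover have "X \<subseteq> {0..2}"
  proof
    fix y assume "y \<in> X"
    then obtain a b c where abc: "y = a + b * c" "a \<in> ?D" "b \<in> ?D" "c \<in> ?D" unfolding X_def by blast
    note bd = digit_expansions_bounds[OF abc(2)] digit_expansions_bounds[OF abc(3)] digit_expansions_bounds[OF abc(4)]
    have "b * c \<le> 1" using mult_mono[of b 1 c 1] bd by simp
    moreover have "0 \<le> b * c" using bd by simp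
    ultimately show "y \<in> {0..2}" using bd abc(1) by simp
  qed
  moreover have "\<exists>y\<in>X. x - y \<in> \<int>" for x
    using assms[of x] unfolding X_def by blast
  ultimately have "\<exists>u v. u < v \<and> {u<..<v} \<subseteq> X" by (rule interval_if_cover_mod_1)
  then show ?thesis unfolding X_def .
qed

text \<open>Adding \<open>{1..n0}\<close> lengthens progressions by at most \<open>n0 + 1\<close>
  terms: after its first \<open>Suc n0\<close> terms a progression has passed \<open>n0\<close>, so
  the rest lies in \<open>B\<close>.\<close>

lemma dense_AP_free_with_initial_segment:
  assumes "\<not> Szemeredi_statement"
  shows "\<exists>Q K. \<not> contains_AP Q K \<and> {1..n0} \<subseteq> Q \<and> (\<forall>n. 40 * card (- Q \<inter> {1..n}) \<le> n)"
proof -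
  obtain k \<delta> B0 where "\<delta> > 0" "dense_AP_free k \<delta> B0"
    using dense_AP_free_if_not_Szemeredi[OF assms] by blast
  then obtain K B where "dense_AP_free K (1 - 1 / 40) B"
    using dense_AP_free_boost[of k \<delta> B0 "1 / 40"] by auto
  then have B: "\<not> contains_AP B K" "\<And>n. (1 - 1 / 40) * real n \<le> real (card (B \<inter> {1..n}))"
    unfolding dense_AP_free_def by auto
  define Q where "Q = B \<union> {1..n0}"
  have "\<not> contains_AP Q (Suc n0 + K)"
  proof
    assume "contains_AP Q (Suc n0 + K)"
    then obtain a d where ad: "d > 0" "\<And>i. i < Suc n0 + K \<Longrightarrow> a + i * d \<in> Q"
      unfolding contains_AP_def by blast
    have "(a + Suc n0 * d) + i * d \<in> B" if "i < K" for i
    proof -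
      have "Suc n0 * 1 \<le> Suc n0 * d" using ad(1) by (intro mult_le_mono2) simp
      moreover have "(a + Suc n0 * d) + i * d \<in> Q"
        using ad(2)[of "Suc n0 + i"] that by (simp add: algebra_simps)
      ultimately show ?thesis unfolding Q_def by auto
    qed
    then show False using B(1) ad(1) unfolding contains_AP_def by blast
  qed
  moreover have "40 * card (- Q \<inter> {1..n}) \<le> n" for n
  proof -
    have "- Q \<inter> {1..n} \<subseteq> {1..n} - (B \<inter> {1..n})" unfolding Q_def by auto
    then have "card (- Q \<inter> {1..n}) \<le> card ({1..n} - (B \<inter> {1..n}))" by (intro card_mono) auto
    also have "\<dots> = n - card (B \<inter> {1..n})" by (subst card_Diff_subset) auto
    finally have "card (- Q \<inter> {1..n}) \<le> n - card (B \<inter> {1..n})" .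
    moreover have "card (B \<inter> {1..n}) \<le> n" using card_mono[of "{1..n}" "B \<inter> {1..n}"] by simp
    ultimately have "real (card (- Q \<inter> {1..n})) \<le> real n - real (card (B \<inter> {1..n}))" by linarith
    moreover have "39 / 40 * real n \<le> real (card (B \<inter> {1..n}))" using B(2)[of n] by simp
    ultimately have "40 * real (card (- Q \<inter> {1..n})) \<le> real n" by linarith
    then show ?thesis by linarith
  qed
  moreover have "{1..n0} \<subseteq> Q" unfolding Q_def by auto
  ultimately show ?thesis by blast
qed

theorem theorem4p4:
  shows "(Szemeredi_statement \<longleftrightarrow> Hausdorff_dim Erdos_set = 0) \<and>
    (Hausdorff_dim Erdos_set = 0 \<longleftrightarrow>
      \<not> (\<exists>u v :: real. u < v \<and>
          {u<..<v} \<subseteq> {a + b * c | a b c. a \<in> Erdos_set \<and> b \<in> Erdos_set \<and> c \<in> Erdos_set}))"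
proof (cases Szemeredi_statement)
  case True
  have "\<not> (\<exists>u v. u < v \<and>
      {u<..<v} \<subseteq> {a + b * c | a b c. a \<in> Erdos_set \<and> b \<in> Erdos_set \<and> c \<in> Erdos_set})"
  proof (rule notI, elim exE conjE)
    fix u v :: real
    assume "u < v" and sub:
      "{u<..<v} \<subseteq> {a + b * c | a b c. a \<in> Erdos_set \<and> b \<in> Erdos_set \<and> c \<in> Erdos_set}"
    from no_interval_if_Szemeredi[OF True \<open>u < v\<close>] sub show False by (rule notE)
  qed
  then show ?thesis using True Hausdorff_dim_Erdos_set_if_Szemeredi[OF True] by (simp only: simp_thms)
next
  case False
  \<comment> \<open>\<open>n0\<close> comes first, as the set \<open>Q\<close> is then built to
    contain \<open>{1..n0}\<close>.\<close>
  obtain n0 where n0: "\<forall>Q. {1..n0} \<subseteq> Q \<longrightarrow> (\<forall>n. 40 * card (- Q \<inter> {1..n}) \<le> n) \<longrightarrow>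
      (\<forall>x. \<exists>a\<in>digit_expansions Q. \<exists>b\<in>digit_expansions Q. \<exists>c\<in>digit_expansions Q. x - (a + b * c) \<in> \<int>)"
    using digit_expansions_cover_mod_1 by (elim exE)
  obtain Q K where Q: "\<not> contains_AP Q K" "{1..n0} \<subseteq> Q" "\<forall>n. 40 * card (- Q \<inter> {1..n}) \<le> n"
    using dense_AP_free_with_initial_segment[OF False, of n0] by (elim exE conjE)
  have "2 * card (- Q \<inter> {1..n}) \<le> n" for n
    using spec[OF Q(3), of n] by linarith
  then have "Hausdorff_dim Erdos_set \<noteq> 0"
    by (rule Hausdorff_dim_Erdos_set_nonzero[OF Q(1)])
  moreover have sub: "digit_expansions Q \<subseteq> Erdos_set"
    by (rule digit_expansions_subset_Erdos_set[OF Q(1)])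
  have "\<exists>u v. u < v \<and>
      {u<..<v} \<subseteq> {a + b * c | a b c. a \<in> Erdos_set \<and> b \<in> Erdos_set \<and> c \<in> Erdos_set}"
  proof -
    obtain u v where "u < v" and uv: "{u<..<v} \<subseteq>
        {a + b * c | a b c. a \<in> digit_expansions Q \<and> b \<in> digit_expansions Q \<and> c \<in> digit_expansions Q}"
      using interval_in_digit_expansions[OF n0[THEN spec, THEN mp, THEN mp, THEN spec, OF Q(2,3)]] by (elim exE conjE)
    have "{a + b * c | a b c. a \<in> digit_expansions Q \<and> b \<in> digit_expansions Q \<and> c \<in> digit_expansions Q}
        \<subseteq> {a + b * c | a b c. a \<in> Erdos_set \<and> b \<in> Erdos_set \<and> c \<in> Erdos_set}"
      using sub by blast
    with uv have "{u<..<v} \<subseteq> {a + b * c | a b c. a \<in> Erdos_set \<and> b \<in> Erdos_set \<and> c \<in> Erdos_set}"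
      by (rule subset_trans)
    with \<open>u < v\<close> show ?thesis by (intro exI conjI)
  qed
  ultimately show ?thesis using False by (simp only: simp_thms)
qed

end
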